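(* Let $\mathcal{M}\models\mathrm{KP}^{\mathcal{P}}+\Sigma_1^{\mathcal{P}}\text{-Separation}$ and $\mathcal{N}\models\mathrm{KP}^{\mathcal{P}}$ be countable and non-standard, and let $\mathcal{S}$ be a shared rank-initial topless substructure of $\mathcal{M}$ and $\mathcal{N}$. Moreover, let $m_0\in\mathcal{M}$, let $n_0\in\mathcal{N}$, and let $\beta\in\mathrm{Ord}^{\mathcal{N}}$. Then the following are equivalent: (a) There is a rank-initial embedding $i:\mathcal{M}\to\mathcal{N}$ fixing $\mathcal{S}$ pointwise, such that $i(m_0)=n_0$ and $i(\mathcal{M})\subseteq\mathcal{N}_\beta$. (b) $\mathrm{SSy}_{\mathcal{S}}(\mathcal{M})\cong\mathrm{SSy}_{\mathcal{S}}(\mathcal{N})$, and for all $s\in\mathcal{S}$ and all $\delta(x,y,z)\in\Delta_0^{\mathcal{P}}[x,y,z]$: $\mathcal{M}\models\exists x\,.\,\delta(x,m_0,s)\Rightarrow\mathcal{N}\models\exists x\in V_\beta\,.\,\delta(x,n_0,s)$. (c) There is a map $g\mapsto i_g$, from sequences $g:\omega\to2$, to embeddings $i_g:\mathcal{M}\to\mathcal{N}$ satisfying (a) (that is, rank-initial, fixing $\mathcal{S}$ pointwise, with $i_g(m_0)=n_0$ and $i_g(\mathcal{M})\subseteq\mathcal{N}_\beta$), such that for any $g<^{\mathrm{lex}}g':\omega\to2$, we have $i_g<^{\mathrm{rank}}i_{g'}$. (d) There is a topless embedding $i:\mathcal{M}\to\mathcal{N}$ satisfying (a).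
   Context: Theories. The language is $\{\in\}$. Quantifiers of the forms $\exists x\in y$, $\forall x\in y$, $\exists x\subseteq y$, $\forall x\subseteq y$ count as bounded. $\Delta_0^{\mathcal{P}}=\Sigma_0^{\mathcal{P}}=\Pi_0^{\mathcal{P}}$ is the set of formulae all of whose quantifiers are bounded in this sense; $\Sigma_{n+1}^{\mathcal{P}}$ consists of the formulae $\exists x\,.\,\phi$ with $\phi\in\Pi_n^{\mathcal{P}}$, and $\Pi_{n+1}^{\mathcal{P}}$ of the $\forall x\,.\,\phi$ with $\phi\in\Sigma_n^{\mathcal{P}}$ (all up to provable equivalence in the background theory). $\Gamma[\vec{x}]$ denotes the formulae in $\Gamma$ with free variables among $\vec{x}$. $\mathrm{KP}^{\mathcal{P}}$ is axiomatized by Extensionality, Pair, Union, Powerset, Infinity, $\Delta_0^{\mathcal{P}}$-Separation, $\Delta_0^{\mathcal{P}}$-Collection ($\forall u\in x\exists v\,\phi(u,v)\to\exists y\forall u\in x\exists v\in y\,\phi(u,v)$) and $\Pi_1^{\mathcal{P}}$-Foundation ($\exists x\,\phi(x)\to\exists y(\phi(y)\wedge\forall v\in y\,\neg\phi(v))$). $\mathrm{KP}^{\mathcal{P}}$ proves that each set has an ordinal rank and that $V_\alpha$ exists for each ordinal $\alpha$. Models. A model is non-standard if its membership relation is not well-founded. $\mathcal{N}_\beta=\{n\in\mathcal{N}\mid\mathcal{N}\models\mathrm{rank}(n)<\beta\}$. An embedding is an injection preserving and reflecting $\in$. An embedding $i:\mathcal{M}\to\mathcal{N}$ is rank-initial if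 every $n\in\mathcal{N}$ with $\mathrm{rank}^{\mathcal{N}}(n)\le\mathrm{rank}^{\mathcal{N}}(i(m))$ for some $m\in\mathcal{M}$ lies in $i(\mathcal{M})$; it is topless if $i(\mathcal{M})\subseteq\mathcal{N}_\alpha$ for some $\alpha\in\mathrm{Ord}^{\mathcal{N}}$ and $\mathrm{Ord}^{\mathcal{N}}\setminus i(\mathcal{M})$ has no least element. A substructure is rank-initial/topless if its inclusion map is. $i_g<^{\mathrm{rank}}i_{g'}$ means that $i_g(\mathcal{M})$ is a proper rank-initial substructure of $i_{g'}(\mathcal{M})$. $<^{\mathrm{lex}}$ is the lexicographic order on sequences $\omega\to2$. Standard systems. $\mathrm{SSy}_{\mathcal{S}}(\mathcal{M})$ is the structure $\mathcal{S}$ together with, as classes, all sets of the form $\{x\in\mathcal{S}\mid\mathcal{M}\models x\in c\}$, $c\in\mathcal{M}$. Here $\mathrm{SSy}_{\mathcal{S}}(\mathcal{M})\cong\mathrm{SSy}_{\mathcal{S}}(\mathcal{N})$ refers to isomorphism over $\mathcal{S}$ (induced by the identity on $\mathcal{S}$), i.e. the same subsets of $\mathcal{S}$ are coded in $\mathcal{M}$ and in $\mathcal{N}$. *)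

theory Defs
  imports "HOL-Library.Fun_Lexorder" "HOL-Library.Countable_Set"
begin

datatype fm =
    Mem nat nat
  | Eq nat nat
  | Neg fm
  | And fm fm
  | Or fm fm
  | Imp fm fm
  | All nat fm
  | Ex nat fm

abbreviation Iff :: "fm \<Rightarrow> fm \<Rightarrow> fm" where
  "Iff \<phi> \<psi> \<equiv> And (Imp \<phi> \<psi>) (Imp \<psi> \<phi>)"

primrec fv :: "fm \<Rightarrow> nat set" where
  "fv (Mem x y) = {x, y}"
| "fv (Eq x y) = {x, y}"
| "fv (Neg \<phi>) = fv \<phi>"
| "fv (And \<phi> \<psi>) = fv \<phi> \<union> fv \<psi>"
| "fv (Or \<phi> \<psi>) = fv \<phi> \<union> fv \<psi>"
| "fv (Imp \<phi> \<psi>) = fv \<phi> \<union> fv \<psi>"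
| "fv (All x \<phi>) = fv \<phi> - {x}"
| "fv (Ex x \<phi>) = fv \<phi> - {x}"

text \<open>The bound variable of \<open>Sub x y\<close> is larger than both \<open>x\<close> and \<open>y\<close>, hence fresh.\<close>

definition Sub :: "nat \<Rightarrow> nat \<Rightarrow> fm" where
  "Sub x y = (let z = Suc (max x y) in All z (Imp (Mem z x) (Mem z y)))"

inductive_set Delta0P :: "fm set" where
  mem: "Mem x y \<in> Delta0P"
| eq: "Eq x y \<in> Delta0P"
| neg: "\<phi> \<in> Delta0P \<Longrightarrow> Neg \<phi> \<in> Delta0P"
| conj: "\<phi> \<in> Delta0P \<Longrightarrow> \<psi> \<in> Delta0P \<Longrightarrow> And \<phi> \<psi> \<in> Delta0P"
| disj: "\<phi> \<in> Delta0P \<Longrightarrow> \<psi> \<in> Delta0P \<Longrightarrow> Or \<phi> \<psi> \<in> Delta0P"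
| imp: "\<phi> \<in> Delta0P \<Longrightarrow> \<psi> \<in> Delta0P \<Longrightarrow> Imp \<phi> \<psi> \<in> Delta0P"
| ex_mem: "\<phi> \<in> Delta0P \<Longrightarrow> x \<noteq> y \<Longrightarrow> Ex x (And (Mem x y) \<phi>) \<in> Delta0P"
| all_mem: "\<phi> \<in> Delta0P \<Longrightarrow> x \<noteq> y \<Longrightarrow> All x (Imp (Mem x y) \<phi>) \<in> Delta0P"
| ex_sub: "\<phi> \<in> Delta0P \<Longrightarrow> x \<noteq> y \<Longrightarrow> Ex x (And (Sub x y) \<phi>) \<in> Delta0P"
| all_sub: "\<phi> \<in> Delta0P \<Longrightarrow> x \<noteq> y \<Longrightarrow> All x (Imp (Sub x y) \<phi>) \<in> Delta0P"

text \<open>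
  The classes are taken as literal syntactic classes. Closing them under equivalence
  provable in \<open>KPP\<close> changes neither that theory nor what is expressible in its models.
\<close>

fun SigmaP PiP :: "nat \<Rightarrow> fm set" where
  "SigmaP 0 = Delta0P"
| "SigmaP (Suc n) = {Ex x \<phi> |x \<phi>. \<phi> \<in> PiP n}"
| "PiP 0 = Delta0P"
| "PiP (Suc n) = {All x \<phi> |x \<phi>. \<phi> \<in> SigmaP n}"

text \<open>
  Free variables of an axiom are parameters; since \<open>models\<close> (below) quantifies over all
  assignments, an axiom stands for its universal closure.
\<close>

definition Extensionality :: fm where
  "Extensionality = All 0 (All 1 (Imp (All 2 (Iff (Mem 2 0) (Mem 2 1))) (Eq 0 1)))"

definition Pair_ax :: fm where
  "Pair_ax = All 0 (All 1 (Ex 2 (All 3 (Iff (Mem 3 2) (Or (Eq 3 0) (Eq 3 1))))))"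

definition Union_ax :: fm where
  "Union_ax = All 0 (Ex 1 (All 2 (Iff (Mem 2 1) (Ex 3 (And (Mem 3 0) (Mem 2 3))))))"

definition Powerset_ax :: fm where
  "Powerset_ax = All 0 (Ex 1 (All 2 (Iff (Mem 2 1) (Sub 2 0))))"

text \<open>There is a set containing the empty set and closed under \<open>y \<mapsto> y \<union> {y}\<close>.\<close>

definition Infinity_ax :: fm where
  "Infinity_ax = Ex 0 (And
     (Ex 1 (And (Mem 1 0) (All 2 (Neg (Mem 2 1)))))
     (All 1 (Imp (Mem 1 0)
       (Ex 2 (And (Mem 2 0) (All 3 (Iff (Mem 3 2) (Or (Mem 3 1) (Eq 3 1)))))))))"

definition Separation :: "fm set \<Rightarrow> fm set" where
  "Separation \<Gamma> =
     {All x (Ex y (All u (Iff (Mem u y) (And (Mem u x) \<phi>)))) |\<phi> x y u.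
        \<phi> \<in> \<Gamma> \<and> distinct [x, y, u] \<and> y \<notin> fv \<phi>}"

definition Collection :: "fm set \<Rightarrow> fm set" where
  "Collection \<Gamma> =
     {All x (Imp (All u (Imp (Mem u x) (Ex v \<phi>)))
        (Ex y (All u (Imp (Mem u x) (Ex v (And (Mem v y) \<phi>)))))) |\<phi> x y u v.
        \<phi> \<in> \<Gamma> \<and> distinct [x, y, u, v] \<and> y \<notin> fv \<phi>}"

text \<open>
  With \<open>\<phi> = \<phi>(x)\<close> and \<open>v\<close> not free in it, \<open>\<phi>(v)\<close> is written as \<open>\<exists>x. x = v \<and> \<phi>(x)\<close>,
  which avoids a substitution operation.
\<close>

definition Foundation :: "fm set \<Rightarrow> fm set" where
  "Foundation \<Gamma> =
     {Imp (Ex x \<phi>)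
        (Ex x (And \<phi> (All v (Imp (Mem v x) (Neg (Ex x (And (Eq x v) \<phi>))))))) |\<phi> x v.
        \<phi> \<in> \<Gamma> \<and> x \<noteq> v \<and> v \<notin> fv \<phi>}"

definition KPP :: "fm set" where
  "KPP = {Extensionality, Pair_ax, Union_ax, Powerset_ax, Infinity_ax}
     \<union> Separation Delta0P \<union> Collection Delta0P \<union> Foundation (PiP 1)"

record 'a str =
  univ :: "'a set"
  mem :: "'a \<Rightarrow> 'a \<Rightarrow> bool"

primrec sat :: "'a str \<Rightarrow> (nat \<Rightarrow> 'a) \<Rightarrow> fm \<Rightarrow> bool" where
  "sat M \<rho> (Mem x y) \<longleftrightarrow> mem M (\<rho> x) (\<rho> y)"
| "sat M \<rho> (Eq x y) \<longleftrightarrow> \<rho> x = \<rho> y"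
| "sat M \<rho> (Neg \<phi>) \<longleftrightarrow> \<not> sat M \<rho> \<phi>"
| "sat M \<rho> (And \<phi> \<psi>) \<longleftrightarrow> sat M \<rho> \<phi> \<and> sat M \<rho> \<psi>"
| "sat M \<rho> (Or \<phi> \<psi>) \<longleftrightarrow> sat M \<rho> \<phi> \<or> sat M \<rho> \<psi>"
| "sat M \<rho> (Imp \<phi> \<psi>) \<longleftrightarrow> (sat M \<rho> \<phi> \<longrightarrow> sat M \<rho> \<psi>)"
| "sat M \<rho> (All x \<phi>) \<longleftrightarrow> (\<forall>a\<in>univ M. sat M (\<rho>(x := a)) \<phi>)"
| "sat M \<rho> (Ex x \<phi>) \<longleftrightarrow> (\<exists>a\<in>univ M. sat M (\<rho>(x := a)) \<phi>)"

definition models :: "'a str \<Rightarrow> fm set \<Rightarrow> bool" where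
  "models M T \<longleftrightarrow> univ M \<noteq> {} \<and> (\<forall>\<phi>\<in>T. \<forall>\<rho>. range \<rho> \<subseteq> univ M \<longrightarrow> sat M \<rho> \<phi>)"

definition nonstandard :: "'a str \<Rightarrow> bool" where
  "nonstandard M \<longleftrightarrow> \<not> wfp_on (univ M) (mem M)"

definition substructure :: "'a str \<Rightarrow> 'a str \<Rightarrow> bool" where
  "substructure S M \<longleftrightarrow> univ S \<subseteq> univ M \<and>
     (\<forall>x\<in>univ S. \<forall>y\<in>univ S. mem S x y \<longleftrightarrow> mem M x y)"

definition transitive_in :: "'a str \<Rightarrow> 'a \<Rightarrow> bool" where
  "transitive_in M t \<longleftrightarrow>
     (\<forall>x\<in>univ M. mem M x t \<longrightarrow> (\<forall>y\<in>univ M. mem M y x \<longrightarrow> mem M y t))"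

text \<open>In the presence of Foundation, ordinals are the transitive sets of transitive sets.\<close>

definition Ord :: "'a str \<Rightarrow> 'a set" where
  "Ord M = {\<alpha> \<in> univ M. transitive_in M \<alpha> \<and>
     (\<forall>x\<in>univ M. mem M x \<alpha> \<longrightarrow> transitive_in M x)}"

definition is_upair :: "'a str \<Rightarrow> 'a \<Rightarrow> 'a \<Rightarrow> 'a \<Rightarrow> bool" where
  "is_upair M a b p \<longleftrightarrow> p \<in> univ M \<and> (\<forall>w\<in>univ M. mem M w p \<longleftrightarrow> w = a \<or> w = b)"

definition is_opair :: "'a str \<Rightarrow> 'a \<Rightarrow> 'a \<Rightarrow> 'a \<Rightarrow> bool" where
  "is_opair M a b p \<longleftrightarrow> p \<in> univ M \<and>
     (\<exists>u\<in>univ M. \<exists>w\<in>univ M. is_upair M a a u \<and> is_upair M a b w \<and> is_upair M u w p)"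

definition app_in :: "'a str \<Rightarrow> 'a \<Rightarrow> 'a \<Rightarrow> 'a \<Rightarrow> bool" where
  "app_in M f x y \<longleftrightarrow> (\<exists>p\<in>univ M. is_opair M x y p \<and> mem M p f)"

definition is_function_on :: "'a str \<Rightarrow> 'a \<Rightarrow> 'a \<Rightarrow> bool" where
  "is_function_on M f t \<longleftrightarrow>
     (\<forall>p\<in>univ M. mem M p f \<longrightarrow>
        (\<exists>x\<in>univ M. \<exists>y\<in>univ M. mem M x t \<and> is_opair M x y p)) \<and>
     (\<forall>x\<in>univ M. mem M x t \<longrightarrow> (\<exists>!y. y \<in> univ M \<and> app_in M f x y))"

text \<open>
  \<open>f\<close> is the rank function on the transitive set \<open>t\<close>: it satisfies
  \<open>f(x) = sup {f(y) + 1 | y \<in> x} = \<Union> {f(y) \<union> {f(y)} | y \<in> x}\<close> for all \<open>x \<in> t\<close>.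
\<close>

definition is_rank_function :: "'a str \<Rightarrow> 'a \<Rightarrow> 'a \<Rightarrow> bool" where
  "is_rank_function M f t \<longleftrightarrow> transitive_in M t \<and> is_function_on M f t \<and>
     (\<forall>x\<in>univ M. \<forall>\<alpha>\<in>univ M. mem M x t \<and> app_in M f x \<alpha> \<longrightarrow>
        (\<forall>w\<in>univ M. mem M w \<alpha> \<longleftrightarrow>
           (\<exists>y\<in>univ M. \<exists>\<gamma>\<in>univ M. mem M y x \<and> app_in M f y \<gamma> \<and> (mem M w \<gamma> \<or> w = \<gamma>))))"

definition is_rank :: "'a str \<Rightarrow> 'a \<Rightarrow> 'a \<Rightarrow> bool" where
  "is_rank M x \<alpha> \<longleftrightarrow> \<alpha> \<in> univ M \<and>
     (\<exists>t\<in>univ M. \<exists>f\<in>univ M. mem M x t \<and> is_rank_function M f t \<and> app_in M f x \<alpha>)"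

definition rank_le :: "'a str \<Rightarrow> 'a \<Rightarrow> 'a \<Rightarrow> bool" where
  "rank_le M x y \<longleftrightarrow>
     (\<exists>\<alpha> \<gamma>. is_rank M x \<alpha> \<and> is_rank M y \<gamma> \<and> (mem M \<alpha> \<gamma> \<or> \<alpha> = \<gamma>))"

definition below :: "'a str \<Rightarrow> 'a \<Rightarrow> 'a set" where
  "below M \<beta> = {x \<in> univ M. \<exists>\<alpha>. is_rank M x \<alpha> \<and> mem M \<alpha> \<beta>}"

text \<open>\<open>v\<close> is \<open>V\<^sub>\<beta>\<close> in the sense of \<open>M\<close>, i.e. the set of all sets of rank less than \<open>\<beta>\<close>.\<close>

definition is_V :: "'a str \<Rightarrow> 'a \<Rightarrow> 'a \<Rightarrow> bool" where
  "is_V M \<beta> v \<longleftrightarrow> v \<in> univ M \<and> {x \<in> univ M. mem M x v} = below M \<beta>"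

definition embedding :: "'a str \<Rightarrow> 'b str \<Rightarrow> ('a \<Rightarrow> 'b) \<Rightarrow> bool" where
  "embedding M N i \<longleftrightarrow> i ` univ M \<subseteq> univ N \<and> inj_on i (univ M) \<and>
     (\<forall>x\<in>univ M. \<forall>y\<in>univ M. mem M x y \<longleftrightarrow> mem N (i x) (i y))"

definition rank_initial :: "'a str \<Rightarrow> 'b str \<Rightarrow> ('a \<Rightarrow> 'b) \<Rightarrow> bool" where
  "rank_initial M N i \<longleftrightarrow> embedding M N i \<and>
     (\<forall>n\<in>univ N. \<forall>m\<in>univ M. rank_le N n (i m) \<longrightarrow> n \<in> i ` univ M)"

definition topless :: "'a str \<Rightarrow> 'b str \<Rightarrow> ('a \<Rightarrow> 'b) \<Rightarrow> bool" where
  "topless M N i \<longleftrightarrow> embedding M N i \<and>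
     (\<exists>\<alpha>\<in>Ord N. i ` univ M \<subseteq> below N \<alpha>) \<and>
     \<not> (\<exists>\<alpha>\<in>Ord N - i ` univ M. \<forall>\<gamma>\<in>Ord N - i ` univ M. \<alpha> = \<gamma> \<or> mem N \<alpha> \<gamma>)"

definition rank_initial_substructure :: "'a str \<Rightarrow> 'a str \<Rightarrow> bool" where
  "rank_initial_substructure S M \<longleftrightarrow> substructure S M \<and> rank_initial S M id"

definition topless_substructure :: "'a str \<Rightarrow> 'a str \<Rightarrow> bool" where
  "topless_substructure S M \<longleftrightarrow> substructure S M \<and> topless S M id"

definition image_str :: "'a str \<Rightarrow> 'b str \<Rightarrow> ('a \<Rightarrow> 'b) \<Rightarrow> 'b str" where
  "image_str M N i = \<lparr>univ = i ` univ M, mem = mem N\<rparr>"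

definition rank_less :: "'a str \<Rightarrow> 'b str \<Rightarrow> ('a \<Rightarrow> 'b) \<Rightarrow> ('a \<Rightarrow> 'b) \<Rightarrow> bool" where
  "rank_less M N i j \<longleftrightarrow>
     rank_initial_substructure (image_str M N i) (image_str M N j) \<and>
     i ` univ M \<noteq> j ` univ M"

definition good_embedding ::
  "'a str \<Rightarrow> 'a str \<Rightarrow> 'a str \<Rightarrow> 'a \<Rightarrow> 'a \<Rightarrow> 'a \<Rightarrow> ('a \<Rightarrow> 'a) \<Rightarrow> bool" where
  "good_embedding M N S m\<^sub>0 n\<^sub>0 \<beta> i \<longleftrightarrow> rank_initial M N i \<and>
     (\<forall>s\<in>univ S. i s = s) \<and> i m\<^sub>0 = n\<^sub>0 \<and> i ` univ M \<subseteq> below N \<beta>"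

text \<open>
  The structure \<open>S\<close> together with its coded classes. Isomorphism induced by the identity on \<open>S\<close>
  is equality of these pairs.
\<close>

definition SSy :: "'a str \<Rightarrow> 'a str \<Rightarrow> 'a str \<times> 'a set set" where
  "SSy S M = (S, {{x \<in> univ S. mem M x c} |c. c \<in> univ M})"

end

theory Submission
  imports Defs
begin

text \<open>
  \<open>A\<close> implies \<open>B\<close> by absoluteness. The image of a rank-initial embedding \<open>i\<close> is closed under elements
  and subsets, so \<open>i\<close> preserves \<open>\<Delta>\<^sub>0\<^sup>P\<close> formulae (\<open>Delta0P_absolute\<close>). A subset of \<open>S\<close> coded in \<open>N\<close> by \<open>d\<close>
  is also coded by \<open>d \<inter> i(v)\<close>, where \<open>v\<close> covers \<open>S\<close> in \<open>M\<close>; being a subset of \<open>i(v)\<close>, that set lies in the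
  image, and its preimage is a code in \<open>M\<close>.

  \<open>B\<close> implies \<open>C\<close> by a back-and-forth argument. One builds finite sequences \<open>ms\<close> in \<open>M\<close> and \<open>ns\<close> in \<open>N\<close> and
  keeps the invariant that every existential fact about \<open>ms\<close> with parameters from \<open>S\<close> holds of \<open>ns\<close> with
  witnesses in a bound \<open>w\<close>. Extending the sequences calls for a uniform definition of these facts inside
  the models. Instead of a satisfaction predicate for coded formulae, the proof uses a truth game: a code
  is a set, and a set \<open>T\<close> of positions is \<open>sound\<close> if each of its positions is justified, through one local
  rule, by other positions of \<open>T\<close>. A position is true if some sound set contains it. Soundness is \<open>\<Delta>\<^sub>0\<^sup>P\<close>,
  so truth is \<open>\<Sigma>\<^sub>1\<^sup>P\<close>, and the codes are exactly rich enough for the three ways to continue: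

  \<^item> \<open>forth_step\<close>: for \<open>m\<close> in \<open>M\<close>, \<open>\<Sigma>\<^sub>1\<^sup>P\<close>-Separation gives a code \<open>c\<close> in \<open>M\<close> of the type of \<open>(ms, m)\<close> over \<open>S\<close>, and
    \<open>N\<close> has a code \<open>d\<close> of the same subset of \<open>S\<close>. For each ordinal \<open>\<sigma>\<close> of \<open>S\<close> the part of \<open>d\<close> of rank below \<open>\<sigma>\<close>
    is an element of \<open>S\<close>, so that the invariant yields an \<open>n\<close> realizing it. As \<open>S\<close> is topless, this spills
    over to some \<open>\<sigma>\<close> outside \<open>S\<close>, and the \<open>n\<close> found there realizes the whole type.
  \<^item> \<open>back_step\<close>: for \<open>n\<close> below an entry of \<open>ns\<close>, the same is done with the complement of the type of
    \<open>(ns, n)\<close>; here the spilling over takes place in \<open>M\<close>.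
  \<^item> \<open>split_step\<close>: by Collection all witnesses needed for the type of \<open>ms\<close> lie in one set \<open>\<mu>\<close>. If \<open>\<nu>\<close> is a partner of
    \<open>\<mu>\<close>, then \<open>\<nu>\<close> can replace \<open>w\<close> as the bound for \<open>(ms, ns)\<close>, and alternatively \<open>(\<mu>, \<nu>)\<close> can be appended.

  Taking the first option at a \<open>False\<close> of \<open>g\<close> and the second at a \<open>True\<close> gives a tree of embeddings: if \<open>g\<close>
  is lexicographically below \<open>g'\<close>, the image of \<open>g\<close> consists of elements of some \<open>\<nu>\<close> in the image of \<open>g'\<close>.

  \<open>C\<close> implies \<open>D\<close> by counting. If no embedding in the tree is topless, the least ordinals of \<open>N\<close> missed by
  the images are pairwise distinct, and the countable \<open>N\<close> has uncountably many elements. \<open>D\<close> implies \<open>A\<close>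
  trivially.
\<close>

section \<open>\<open>\<Delta>\<^sub>0\<^sup>P\<close>-definable predicates\<close>

definition els :: "'a str \<Rightarrow> 'a \<Rightarrow> 'a set" where
  "els M x = {y \<in> univ M. mem M y x}"

lemma finite_fv: "finite (fv \<phi>)"
  by (induction \<phi>) auto

lemma ex_fresh: "finite A \<Longrightarrow> \<exists>x :: nat. x \<notin> A"
  using ex_new_if_finite infinite_UNIV_nat by blast

lemma sat_cong:
  "(\<And>x. x \<in> fv \<phi> \<Longrightarrow> \<rho> x = \<rho>' x) \<Longrightarrow> sat M \<rho> \<phi> = sat M \<rho>' \<phi>"
proof (induction \<phi> arbitrary: \<rho> \<rho>')
  case (All x \<phi>)
  have "sat M (\<rho>(x := a)) \<phi> = sat M (\<rho>'(x := a)) \<phi>" for a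
    by (rule All.IH) (use All.prems in auto)
  then show ?case by simp
next
  case (Ex x \<phi>)
  have "sat M (\<rho>(x := a)) \<phi> = sat M (\<rho>'(x := a)) \<phi>" for a
    by (rule Ex.IH) (use Ex.prems in auto)
  then show ?case by simp
next
  case (And \<phi> \<psi>) then show ?case by (metis UnCI fv.simps(4) sat.simps(4))
next
  case (Or \<phi> \<psi>) then show ?case by (metis UnCI fv.simps(5) sat.simps(5))
next
  case (Imp \<phi> \<psi>) then show ?case by (metis UnCI fv.simps(6) sat.simps(6))
next
  case (Neg \<phi>) then show ?case by (metis fv.simps(3) sat.simps(3))
qed simp_all

lemma fv_Sub: "fv (Sub x y) = {x, y}"
  by (auto simp: Sub_def Let_def)

lemma sat_Sub: "sat M \<rho> (Sub x y) \<longleftrightarrow> els M (\<rho> x) \<subseteq> els M (\<rho> y)"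
  by (auto simp: Sub_def Let_def els_def)

lemma sat_bounded:
  assumes "x \<noteq> y"
  shows "sat M \<rho> (Ex x (And (Mem x y) \<phi>)) \<longleftrightarrow> (\<exists>a\<in>els M (\<rho> y). sat M (\<rho>(x := a)) \<phi>)"
    and "sat M \<rho> (All x (Imp (Mem x y) \<phi>)) \<longleftrightarrow> (\<forall>a\<in>els M (\<rho> y). sat M (\<rho>(x := a)) \<phi>)"
    and "sat M \<rho> (Ex x (And (Sub x y) \<phi>)) \<longleftrightarrow>
      (\<exists>a\<in>univ M. els M a \<subseteq> els M (\<rho> y) \<and> sat M (\<rho>(x := a)) \<phi>)"
    and "sat M \<rho> (All x (Imp (Sub x y) \<phi>)) \<longleftrightarrow>
      (\<forall>a\<in>univ M. els M a \<subseteq> els M (\<rho> y) \<longrightarrow> sat M (\<rho>(x := a)) \<phi>)"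
  using assms by (auto simp: els_def sat_Sub)

text \<open>
  The first argument fixes the type of the structures considered: a single formula has to work for all
  structures over that type.
\<close>

definition renames :: "'a itself \<Rightarrow> (nat \<Rightarrow> nat) \<Rightarrow> fm \<Rightarrow> fm \<Rightarrow> bool" where
  "renames _ f \<phi> \<psi> \<longleftrightarrow> \<psi> \<in> Delta0P \<and> fv \<psi> \<subseteq> f ` fv \<phi> \<and>
     (\<forall>(M::'a str) \<rho>. sat M \<rho> \<psi> \<longleftrightarrow> sat M (\<lambda>n. \<rho> (f n)) \<phi>)"

text \<open>
  The renaming \<open>f\<close> need not be injective, so a bound variable has to be replaced by one outside the
  range of \<open>f\<close> on the free variables.
\<close>

lemma renames_binder:
  assumes "\<And>f. \<exists>\<psi>. renames TYPE('a) f \<phi> \<psi>"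
  shows "\<exists>z \<psi>. z \<noteq> f y \<and> \<psi> \<in> Delta0P \<and> fv \<psi> - {z} \<subseteq> f ` (fv \<phi> - {x}) \<and>
    (\<forall>(M::'a str) \<rho> a. sat M (\<rho>(z := a)) \<psi> \<longleftrightarrow> sat M ((\<lambda>n. \<rho> (f n))(x := a)) \<phi>)"
proof -
  obtain z where z: "z \<notin> f ` fv \<phi> \<union> {f y}"
    using ex_fresh[of "f ` fv \<phi> \<union> {f y}"] finite_fv by blast
  obtain \<psi> where \<psi>: "\<psi>\<in>Delta0P" "fv \<psi> \<subseteq> f(x := z) ` fv \<phi>"
      "\<forall>(M::'a str) \<rho>. sat M \<rho> \<psi> \<longleftrightarrow> sat M (\<lambda>n. \<rho> ((f(x := z)) n)) \<phi>"
    using assms[of "f(x := z)"] unfolding renames_def by blast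
  have "sat M (\<rho>(z := a)) \<psi> = sat M ((\<lambda>n. \<rho> (f n))(x := a)) \<phi>" for M \<rho> and a :: 'a
    unfolding \<psi>(3)[rule_format] by (rule sat_cong) (use z in auto)
  moreover have "fv \<psi> - {z} \<subseteq> f ` (fv \<phi> - {x})" using \<psi>(2) by (auto split: if_splits)
  ultimately show ?thesis using z \<psi>(1) by blast
qed

lemma renames_ex: "\<phi> \<in> Delta0P \<Longrightarrow> \<exists>\<psi>. renames TYPE('a) f \<phi> \<psi>"
proof (induction arbitrary: f rule: Delta0P.induct)
  case (mem x y)
  show ?case by (rule exI[of _ "Mem (f x) (f y)"]) (auto simp: renames_def intro: Delta0P.mem)
next
  case (eq x y)
  show ?case by (rule exI[of _ "Eq (f x) (f y)"]) (auto simp: renames_def intro: Delta0P.eq)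
next
  case (neg \<phi>)
  then obtain \<psi> where "renames TYPE('a) f \<phi> \<psi>" by blast
  then show ?case by (intro exI[of _ "Neg \<psi>"]) (auto simp: renames_def intro: Delta0P.neg)
next
  case (conj \<phi> \<phi>')
  then obtain \<psi> \<psi>' where "renames TYPE('a) f \<phi> \<psi>" "renames TYPE('a) f \<phi>' \<psi>'" by meson
  then show ?case by (intro exI[of _ "And \<psi> \<psi>'"]) (auto simp: renames_def intro: Delta0P.conj)
next
  case (disj \<phi> \<phi>')
  then obtain \<psi> \<psi>' where "renames TYPE('a) f \<phi> \<psi>" "renames TYPE('a) f \<phi>' \<psi>'" by meson
  then show ?case by (intro exI[of _ "Or \<psi> \<psi>'"]) (auto simp: renames_def intro: Delta0P.disj)
next
  case (imp \<phi> \<phi>')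
  then obtain \<psi> \<psi>' where "renames TYPE('a) f \<phi> \<psi>" "renames TYPE('a) f \<phi>' \<psi>'" by meson
  then show ?case by (intro exI[of _ "Imp \<psi> \<psi>'"]) (auto simp: renames_def intro: Delta0P.imp)
next
  case (ex_mem \<phi> x y)
  obtain z \<psi> where "z \<noteq> f y" "\<psi> \<in> Delta0P" "fv \<psi> - {z} \<subseteq> f ` (fv \<phi> - {x})"
    "\<forall>(M::'a str) \<rho> a. sat M (\<rho>(z := a)) \<psi> \<longleftrightarrow> sat M ((\<lambda>n. \<rho> (f n))(x := a)) \<phi>"
    using renames_binder[OF ex_mem.IH, of f y x] by blast
  with ex_mem.hyps show ?case unfolding renames_def
    by (intro exI[of _ "Ex z (And (Mem z (f y)) \<psi>)"] conjI Delta0P.ex_mem)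
      (auto simp: sat_bounded fv_Sub simp del: sat.simps)
next
  case (all_mem \<phi> x y)
  obtain z \<psi> where "z \<noteq> f y" "\<psi> \<in> Delta0P" "fv \<psi> - {z} \<subseteq> f ` (fv \<phi> - {x})"
    "\<forall>(M::'a str) \<rho> a. sat M (\<rho>(z := a)) \<psi> \<longleftrightarrow> sat M ((\<lambda>n. \<rho> (f n))(x := a)) \<phi>"
    using renames_binder[OF all_mem.IH, of f y x] by blast
  with all_mem.hyps show ?case unfolding renames_def
    by (intro exI[of _ "All z (Imp (Mem z (f y)) \<psi>)"] conjI Delta0P.all_mem)
      (auto simp: sat_bounded fv_Sub simp del: sat.simps)
next
  case (ex_sub \<phi> x y)
  obtain z \<psi> where "z \<noteq> f y" "\<psi> \<in> Delta0P" "fv \<psi> - {z} \<subseteq> f ` (fv \<phi> - {x})"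
    "\<forall>(M::'a str) \<rho> a. sat M (\<rho>(z := a)) \<psi> \<longleftrightarrow> sat M ((\<lambda>n. \<rho> (f n))(x := a)) \<phi>"
    using renames_binder[OF ex_sub.IH, of f y x] by blast
  with ex_sub.hyps show ?case unfolding renames_def
    by (intro exI[of _ "Ex z (And (Sub z (f y)) \<psi>)"] conjI Delta0P.ex_sub)
      (auto simp: sat_bounded fv_Sub simp del: sat.simps)
next
  case (all_sub \<phi> x y)
  obtain z \<psi> where "z \<noteq> f y" "\<psi> \<in> Delta0P" "fv \<psi> - {z} \<subseteq> f ` (fv \<phi> - {x})"
    "\<forall>(M::'a str) \<rho> a. sat M (\<rho>(z := a)) \<psi> \<longleftrightarrow> sat M ((\<lambda>n. \<rho> (f n))(x := a)) \<phi>"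
    using renames_binder[OF all_sub.IH, of f y x] by blast
  with all_sub.hyps show ?case unfolding renames_def
    by (intro exI[of _ "All z (Imp (Sub z (f y)) \<psi>)"] conjI Delta0P.all_sub)
      (auto simp: sat_bounded fv_Sub simp del: sat.simps)
qed

lemma Delta0P_rename:
  assumes "\<phi> \<in> Delta0P"
  shows "\<exists>\<psi>\<in>Delta0P. fv \<psi> \<subseteq> f ` fv \<phi> \<and> (\<forall>(M::'a str) \<rho>. sat M \<rho> \<psi> \<longleftrightarrow> sat M (\<lambda>n. \<rho> (f n)) \<phi>)"
  using renames_ex[OF assms, of f] unfolding renames_def by blast

text \<open>
  Predicates of structures and environments are shown to be \<open>\<Delta>\<^sub>0\<^sup>P\<close> without writing formulae down. The
  environment is a stack: a bounded quantifier pushes its witness at index \<open>0\<close> and shifts all other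
  indices by one, which makes the premises of the rules below syntactic instances of their conclusions.
  One formula serves all structures, so that facts can be carried from \<open>M\<close> to \<open>N\<close>.
\<close>

definition definable :: "('a str \<Rightarrow> (nat \<Rightarrow> 'a) \<Rightarrow> bool) \<Rightarrow> bool" where
  "definable P \<longleftrightarrow> (\<exists>\<phi>\<in>Delta0P. \<forall>M \<rho>. sat M \<rho> \<phi> \<longleftrightarrow> P M \<rho>)"

lemma definable_eq: "definable (\<lambda>M \<rho>. \<rho> i = \<rho> j)"
  unfolding definable_def by (rule bexI[of _ "Eq i j"]) (auto intro: Delta0P.eq)

lemma definable_not: "definable P \<Longrightarrow> definable (\<lambda>M \<rho>. \<not> P M \<rho>)"
  unfolding definable_def by (meson Delta0P.neg sat.simps(3))

lemma definable_and: "definable P \<Longrightarrow> definable Q \<Longrightarrow> definable (\<lambda>M \<rho>. P M \<rho> \<and> Q M \<rho>)"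
  unfolding definable_def by (metis Delta0P.conj sat.simps(4))

lemma definable_or: "definable P \<Longrightarrow> definable Q \<Longrightarrow> definable (\<lambda>M \<rho>. P M \<rho> \<or> Q M \<rho>)"
  unfolding definable_def by (metis Delta0P.disj sat.simps(5))

lemma definable_imp: "definable P \<Longrightarrow> definable Q \<Longrightarrow> definable (\<lambda>M \<rho>. P M \<rho> \<longrightarrow> Q M \<rho>)"
  unfolding definable_def by (metis Delta0P.imp sat.simps(6))

lemma definable_shift:
  assumes "definable (\<lambda>M \<rho>. Q M (\<rho> 0) (\<lambda>n. \<rho> (Suc n)))"
  shows "\<exists>x>k. \<exists>\<phi>\<in>Delta0P. \<forall>M \<rho> a. sat M (\<rho>(x := a)) \<phi> \<longleftrightarrow> Q M a \<rho>"
proof -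
  obtain \<phi> where \<phi>: "\<phi>\<in>Delta0P" "\<And>M \<rho>. sat M \<rho> \<phi> \<longleftrightarrow> Q M (\<rho> 0) (\<lambda>n. \<rho> (Suc n))"
    using assms unfolding definable_def by metis
  obtain x where x: "x \<notin> fv \<phi> \<union> {..k}" and big: "\<forall>y\<in>fv \<phi>. y < x"
  proof -
    have "finite (fv \<phi> \<union> {..k})" using finite_fv by blast
    then obtain b where "\<forall>y\<in>fv \<phi> \<union> {..k}. y < b"
      using finite_nat_set_iff_bounded by blast
    then show thesis using that[of b] by (meson UnCI less_irrefl)
  qed
  obtain \<psi> where \<psi>: "\<psi>\<in>Delta0P"
      "\<And>(M::'a str) \<rho>. sat M \<rho> \<psi> \<longleftrightarrow> sat M (\<lambda>n. \<rho> (case n of 0 \<Rightarrow> x | Suc n \<Rightarrow> n)) \<phi>"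
    using Delta0P_rename[OF \<phi>(1)] by metis
  have "sat M (\<rho>(x := a)) \<psi> \<longleftrightarrow> Q M a \<rho>" for M \<rho> and a :: 'a
  proof -
    have "sat M (\<rho>(x := a)) \<psi> \<longleftrightarrow> sat M (case_nat a \<rho>) \<phi>"
      unfolding \<psi>(2) by (rule sat_cong) (use big in \<open>auto split: nat.split\<close>)
    then show ?thesis by (simp add: \<phi>(2))
  qed
  then show ?thesis using x \<psi>(1) by (intro exI[of _ x]) auto
qed

lemma definable_bex:
  assumes "definable (\<lambda>M \<rho>. Q M (\<rho> 0) (\<lambda>n. \<rho> (Suc n)))"
  shows "definable (\<lambda>M \<rho>. \<exists>a\<in>els M (\<rho> i). Q M a \<rho>)"
proof -
  obtain x \<phi> where *: "x > i" "\<phi>\<in>Delta0P" "\<And>M \<rho> a. sat M (\<rho>(x := a)) \<phi> \<longleftrightarrow> Q M a \<rho>"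
    using definable_shift[OF assms] by blast
  show ?thesis unfolding definable_def
    by (rule bexI[of _ "Ex x (And (Mem x i) \<phi>)"])
      (use * in \<open>auto simp: els_def intro!: Delta0P.ex_mem\<close>)
qed

lemma definable_sex:
  assumes "definable (\<lambda>M \<rho>. Q M (\<rho> 0) (\<lambda>n. \<rho> (Suc n)))"
  shows "definable (\<lambda>M \<rho>. \<exists>a\<in>univ M. els M a \<subseteq> els M (\<rho> i) \<and> Q M a \<rho>)"
proof -
  obtain x \<phi> where *: "x > i" "\<phi>\<in>Delta0P" "\<And>M \<rho> a. sat M (\<rho>(x := a)) \<phi> \<longleftrightarrow> Q M a \<rho>"
    using definable_shift[OF assms] by blast
  show ?thesis unfolding definable_def
    by (rule bexI[of _ "Ex x (And (Sub x i) \<phi>)"])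
      (use * in \<open>auto simp: sat_Sub intro!: Delta0P.ex_sub\<close>)
qed

lemma definable_ball:
  assumes "definable (\<lambda>M \<rho>. Q M (\<rho> 0) (\<lambda>n. \<rho> (Suc n)))"
  shows "definable (\<lambda>M \<rho>. \<forall>a\<in>els M (\<rho> i). Q M a \<rho>)"
  using definable_not[OF definable_bex[OF definable_not[OF assms]]] by simp

lemma definable_sall:
  assumes "definable (\<lambda>M \<rho>. Q M (\<rho> 0) (\<lambda>n. \<rho> (Suc n)))"
  shows "definable (\<lambda>M \<rho>. \<forall>a\<in>univ M. els M a \<subseteq> els M (\<rho> i) \<longrightarrow> Q M a \<rho>)"
  using definable_not[OF definable_sex[OF definable_not[OF assms]]] by simp

lemma definable_in: "definable (\<lambda>M \<rho>. \<rho> i \<in> els M (\<rho> j))"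
proof -
  have "definable (\<lambda>M \<rho>. \<exists>a\<in>els M (\<rho> j). a = \<rho> i)" by (rule definable_bex) (rule definable_eq)
  then show ?thesis by simp
qed

lemma definable_const: "definable (\<lambda>M \<rho>. b)"
proof (cases b)
  case True
  then show ?thesis using definable_eq[of 0 0] by simp
next
  case False
  then show ?thesis using definable_not[OF definable_eq[of 0 0]] by simp
qed

lemma definable_subset: "definable (\<lambda>M \<rho>. els M (\<rho> i) \<subseteq> els M (\<rho> j))"
  unfolding subset_eq by (intro definable_ball definable_in)

lemma definable_set_eq: "definable (\<lambda>M \<rho>. els M (\<rho> i) = els M (\<rho> j))"
  unfolding set_eq_subset by (intro definable_and definable_subset)

lemmas definable_logic = definable_eq definable_in definable_subset definable_set_eq definable_and definable_or definable_imp definable_not definable_ball definable_bex definable_sall definable_sex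

text \<open>
  \<open>p\<close> is the Kuratowski pair of \<open>a\<close> and \<open>b\<close>, said with quantifiers bounded by \<open>p\<close>.
\<close>

definition opr :: "'a str \<Rightarrow> 'a \<Rightarrow> 'a \<Rightarrow> 'a \<Rightarrow> bool" where
  "opr M a b p \<longleftrightarrow> (\<exists>u\<in>els M p. \<exists>w\<in>els M p. els M u = {a} \<and> els M w = {a, b} \<and> els M p = {u, w})"

definition app :: "'a str \<Rightarrow> 'a \<Rightarrow> 'a \<Rightarrow> 'a \<Rightarrow> bool" where
  "app M f x y \<longleftrightarrow> (\<exists>p\<in>els M f. opr M x y p)"

definition trans_set :: "'a str \<Rightarrow> 'a \<Rightarrow> bool" where
  "trans_set M t \<longleftrightarrow> (\<forall>x\<in>els M t. els M x \<subseteq> els M t)"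

lemma definable_upair: "definable (\<lambda>M \<rho>. els M (\<rho> k) = {\<rho> i, \<rho> j})"
proof -
  have *: "(A = {a, b}) \<longleftrightarrow> (\<forall>x\<in>A. x = a \<or> x = b) \<and> (\<exists>x\<in>A. x = a) \<and> (\<exists>x\<in>A. x = b)" for A and a b :: 'a
    by auto
  show ?thesis unfolding * by (intro definable_logic)
qed

lemma definable_single: "definable (\<lambda>M \<rho>. els M (\<rho> k) = {\<rho> i})"
  using definable_upair[of k i i] by simp

lemma definable_opr: "definable (\<lambda>M \<rho>. opr M (\<rho> i) (\<rho> j) (\<rho> k))"
  unfolding opr_def by (intro definable_logic definable_upair definable_single)

lemma definable_app: "definable (\<lambda>M \<rho>. app M (\<rho> k) (\<rho> i) (\<rho> j))"
  unfolding app_def by (intro definable_logic definable_opr)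

lemma definable_trans_set: "definable (\<lambda>M \<rho>. trans_set M (\<rho> i))"
  unfolding trans_set_def by (intro definable_logic)

lemma opr_comps:
  "opr M x y p \<Longrightarrow> \<exists>u\<in>els M p. x \<in> els M u"
  "opr M x y p \<Longrightarrow> \<exists>v\<in>els M p. y \<in> els M v"
  unfolding opr_def by auto

text \<open>
  The components of a pair \<open>p\<close> are elements of elements of \<open>p\<close>, so quantifying over them is bounded. The
  renaming \<open>f\<close> skips the two intermediate elements.
\<close>

lemma definable_ex_opr:
  assumes "definable (\<lambda>M \<rho>. Q M (\<rho> (Suc 0)) (\<rho> 0) (\<lambda>n. \<rho> (Suc (Suc n))))"
  shows "definable (\<lambda>M \<rho>. \<exists>x y. opr M x y (\<rho> i) \<and> Q M x y \<rho>)"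
proof -
  obtain \<phi> where \<phi>: "\<phi>\<in>Delta0P" "\<And>M \<rho>. sat M \<rho> \<phi> \<longleftrightarrow> Q M (\<rho> (Suc 0)) (\<rho> 0) (\<lambda>n. \<rho> (Suc (Suc n)))"
    using assms unfolding definable_def by metis
  define f :: "nat \<Rightarrow> nat" where "f n = (case n of 0 \<Rightarrow> 0 | Suc 0 \<Rightarrow> Suc (Suc 0) | Suc (Suc k) \<Rightarrow> Suc (Suc (Suc (Suc k))))" for n
  obtain \<psi> where \<psi>: "\<psi>\<in>Delta0P" "\<And>(M::'a str) \<rho>. sat M \<rho> \<psi> \<longleftrightarrow> sat M (\<lambda>n. \<rho> (f n)) \<phi>"
    using Delta0P_rename[OF \<phi>(1)] by metis
  have Q': "definable (\<lambda>M \<rho>. Q M (\<rho> (Suc (Suc 0))) (\<rho> 0) (\<lambda>n. \<rho> (Suc (Suc (Suc (Suc n))))))"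
    unfolding definable_def
    by (rule bexI[OF _ \<psi>(1)]) (simp add: \<psi>(2) \<phi>(2) f_def)
  have "definable (\<lambda>M \<rho>. \<exists>u\<in>els M (\<rho> i). \<exists>x\<in>els M u. \<exists>v\<in>els M (\<rho> i). \<exists>y\<in>els M v. opr M x y (\<rho> i) \<and> Q M x y \<rho>)"
    by (intro definable_logic definable_opr Q')
  moreover have "(\<exists>u\<in>els M (\<rho> i). \<exists>x\<in>els M u. \<exists>v\<in>els M (\<rho> i). \<exists>y\<in>els M v. opr M x y (\<rho> i) \<and> Q M x y \<rho>)
      \<longleftrightarrow> (\<exists>x y. opr M x y (\<rho> i) \<and> Q M x y \<rho>)" for M \<rho>
    using opr_comps[of M _ _ "\<rho> i"] by metis
  ultimately show ?thesis by simp
qed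

lemma definable_all_opr:
  assumes "definable (\<lambda>M \<rho>. Q M (\<rho> (Suc 0)) (\<rho> 0) (\<lambda>n. \<rho> (Suc (Suc n))))"
  shows "definable (\<lambda>M \<rho>. \<forall>x y. opr M x y (\<rho> i) \<longrightarrow> Q M x y \<rho>)"
  using definable_not[OF definable_ex_opr[OF definable_not[OF assms]]] by simp

lemma definable_subst:
  assumes "definable P"
  shows "definable (\<lambda>M \<rho>. P M (\<lambda>n. \<rho> (f n)))"
proof -
  obtain \<phi> where \<phi>: "\<phi>\<in>Delta0P" "\<And>M \<rho>. sat M \<rho> \<phi> \<longleftrightarrow> P M \<rho>"
    using assms unfolding definable_def by metis
  obtain \<psi> where \<psi>: "\<psi>\<in>Delta0P" "\<And>(M::'a str) \<rho>. sat M \<rho> \<psi> \<longleftrightarrow> sat M (\<lambda>n. \<rho> (f n)) \<phi>"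
    using Delta0P_rename[OF \<phi>(1)] by metis
  show ?thesis unfolding definable_def
    by (rule bexI[OF _ \<psi>(1)]) (simp add: \<psi>(2) \<phi>(2))
qed

lemma definable_ex_app:
  assumes "definable (\<lambda>M \<rho>. Q M (\<rho> 0) (\<lambda>n. \<rho> (Suc n)))"
  shows "definable (\<lambda>M \<rho>. \<exists>y. app M (\<rho> i) (\<rho> j) y \<and> Q M y \<rho>)"
proof -
  have Q': "definable (\<lambda>M \<rho>. Q M (\<rho> 0) (\<lambda>n. \<rho> (Suc (Suc (Suc n)))))"
    using definable_subst[OF assms, of "\<lambda>n. case n of 0 \<Rightarrow> 0 | Suc n \<Rightarrow> Suc (Suc (Suc n))"] by simp
  have "definable (\<lambda>M \<rho>. \<exists>p\<in>els M (\<rho> i). \<exists>x y. opr M x y p \<and> x = \<rho> j \<and> Q M y \<rho>)"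
    by (intro definable_logic definable_ex_opr Q')
  moreover have "(\<exists>p\<in>els M (\<rho> i). \<exists>x y. opr M x y p \<and> x = \<rho> j \<and> Q M y \<rho>) \<longleftrightarrow> (\<exists>y. app M (\<rho> i) (\<rho> j) y \<and> Q M y \<rho>)" for M \<rho>
    unfolding app_def by blast
  ultimately show ?thesis by simp
qed

lemma definable_all_app:
  assumes "definable (\<lambda>M \<rho>. Q M (\<rho> 0) (\<lambda>n. \<rho> (Suc n)))"
  shows "definable (\<lambda>M \<rho>. \<forall>y. app M (\<rho> i) (\<rho> j) y \<longrightarrow> Q M y \<rho>)"
  using definable_not[OF definable_ex_app[OF definable_not[OF assms]]] by simp

lemmas definable_intros = definable_logic definable_upair definable_single definable_opr definable_app definable_trans_set definable_ex_opr definable_all_opr definable_ex_app definable_all_app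

text \<open>
  Closure of the image under elements makes the quantifiers bounded by \<open>\<in>\<close> absolute, closure under
  subsets those bounded by \<open>\<subseteq>\<close>.
\<close>

lemma Delta0P_absolute:
  assumes emb: "embedding M N i"
    and tr: "\<And>m n. m \<in> univ M \<Longrightarrow> n \<in> els N (i m) \<Longrightarrow> n \<in> i ` univ M"
    and sub: "\<And>m n. m \<in> univ M \<Longrightarrow> n \<in> univ N \<Longrightarrow> els N n \<subseteq> els N (i m) \<Longrightarrow> n \<in> i ` univ M"
    and "\<phi> \<in> Delta0P" "range \<rho> \<subseteq> univ M"
  shows "sat M \<rho> \<phi> \<longleftrightarrow> sat N (\<lambda>n. i (\<rho> n)) \<phi>"
proof -
  have iU: "i a \<in> univ N" if "a \<in> univ M" for a
    using emb that unfolding embedding_def by blast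
  have imem: "mem N (i a) (i b) \<longleftrightarrow> mem M a b" if "a \<in> univ M" "b \<in> univ M" for a b
    using emb that unfolding embedding_def by blast
  have iels: "els N (i a) = i ` els M a" if a: "a \<in> univ M" for a
  proof
    show "els N (i a) \<subseteq> i ` els M a"
    proof
      fix n assume n: "n \<in> els N (i a)"
      then obtain b where "b \<in> univ M" "n = i b" using tr[OF a n] by blast
      then show "n \<in> i ` els M a" using n imem[of b a] a by (simp add: els_def)
    qed
    show "i ` els M a \<subseteq> els N (i a)"
      using imem[OF _ a] iU by (simp add: els_def image_subset_iff)
  qed
  have inj: "i a = i b \<longleftrightarrow> a = b" if "a \<in> univ M" "b \<in> univ M" for a b
    using emb that unfolding embedding_def by (meson inj_onD)
  have isub: "els N (i a) \<subseteq> els N (i b) \<longleftrightarrow> els M a \<subseteq> els M b" if "a \<in> univ M" "b \<in> univ M" for a b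
    unfolding iels[OF that(1)] iels[OF that(2)]
    using inj that by (auto simp: els_def image_iff subset_iff)
  have upd: "(\<lambda>n. i ((\<rho>(x := a)) n)) = (\<lambda>n. i (\<rho> n))(x := i a)" for \<rho> x a by auto
  have rng: "range (\<rho>(x := a)) \<subseteq> univ M" if "range \<rho> \<subseteq> univ M" "a \<in> univ M" for \<rho> x a
    using that by auto
  show ?thesis using assms(4,5)
  proof (induction arbitrary: \<rho>)
    case (mem x y)
    then show ?case using imem by (auto simp: image_subset_iff)
  next
    case (eq x y)
    then show ?case using inj by (auto simp: image_subset_iff)
  next
    case (ex_mem \<phi> x y)
    have IH: "sat M (\<rho>(x := a)) \<phi> \<longleftrightarrow> sat N ((\<lambda>n. i (\<rho> n))(x := i a)) \<phi>" if "a \<in> univ M" for a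
      by (rule ex_mem.IH[of "\<rho>(x := a)", unfolded upd]) (rule rng[OF ex_mem.prems that])
    have "\<rho> y \<in> univ M" using ex_mem.prems by auto
    then show ?case unfolding sat_bounded[OF ex_mem.hyps(2)]
      using IH by (subst iels) (auto simp: els_def)
  next
    case (all_mem \<phi> x y)
    have IH: "sat M (\<rho>(x := a)) \<phi> \<longleftrightarrow> sat N ((\<lambda>n. i (\<rho> n))(x := i a)) \<phi>" if "a \<in> univ M" for a
      by (rule all_mem.IH[of "\<rho>(x := a)", unfolded upd]) (rule rng[OF all_mem.prems that])
    have "\<rho> y \<in> univ M" using all_mem.prems by auto
    then show ?case unfolding sat_bounded[OF all_mem.hyps(2)]
      using IH by (subst iels) (auto simp: els_def)
  next
    case (ex_sub \<phi> x y)
    have IH: "sat M (\<rho>(x := a)) \<phi> \<longleftrightarrow> sat N ((\<lambda>n. i (\<rho> n))(x := i a)) \<phi>" if "a \<in> univ M" for a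
      by (rule ex_sub.IH[of "\<rho>(x := a)", unfolded upd]) (rule rng[OF ex_sub.prems that])
    have "\<rho> y \<in> univ M" using ex_sub.prems by auto
    then show ?case unfolding sat_bounded[OF ex_sub.hyps(2)]
      using IH isub sub iU by (smt (verit, best) image_iff)
  next
    case (all_sub \<phi> x y)
    have IH: "sat M (\<rho>(x := a)) \<phi> \<longleftrightarrow> sat N ((\<lambda>n. i (\<rho> n))(x := i a)) \<phi>" if "a \<in> univ M" for a
      by (rule all_sub.IH[of "\<rho>(x := a)", unfolded upd]) (rule rng[OF all_sub.prems that])
    have "\<rho> y \<in> univ M" using all_sub.prems by auto
    then show ?case unfolding sat_bounded[OF all_sub.hyps(2)]
      using IH isub sub iU by (smt (verit, best) image_iff)
  qed auto
qed

section \<open>Basic set theory in a model\<close>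

lemma separation_sat:
  assumes "models M T" "Separation \<Gamma> \<subseteq> T" "\<phi> \<in> \<Gamma>" "range \<rho> \<subseteq> univ M" "X \<in> univ M"
  shows "\<exists>Y\<in>univ M. els M Y = {u \<in> els M X. sat M (\<rho>(k := u)) \<phi>}"
proof -
  obtain x where x: "x \<notin> fv \<phi> \<union> {k}" using ex_fresh[of "fv \<phi> \<union> {k}"] finite_fv by blast
  obtain y where y: "y \<notin> fv \<phi> \<union> {k, x}" using ex_fresh[of "fv \<phi> \<union> {k, x}"] finite_fv by blast
  have "All x (Ex y (All k (Iff (Mem k y) (And (Mem k x) \<phi>)))) \<in> Separation \<Gamma>"
    unfolding Separation_def mem_Collect_eq using assms(3) x y by (intro exI[of _ \<phi>] exI[of _ x] exI[of _ y] exI[of _ k]) simp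
  then have "sat M \<rho> (All x (Ex y (All k (Iff (Mem k y) (And (Mem k x) \<phi>)))))"
    using assms(1,2,4) unfolding models_def by blast
  then obtain Y where Y: "Y \<in> univ M"
    "\<forall>u\<in>univ M. sat M (\<rho>(x := X, y := Y, k := u)) (Iff (Mem k y) (And (Mem k x) \<phi>))"
    using assms(5) unfolding sat.simps(7,8) by blast
  have eq: "sat M (\<rho>(x := X, y := Y, k := u)) \<phi> = sat M (\<rho>(k := u)) \<phi>" for u
    by (rule sat_cong) (use x y in auto)
  have Y': "mem M u Y \<longleftrightarrow> mem M u X \<and> sat M (\<rho>(k := u)) \<phi>" if u: "u \<in> univ M" for u
  proof -
    have "sat M (\<rho>(x := X, y := Y, k := u)) (Mem k y) \<longleftrightarrow>
        sat M (\<rho>(x := X, y := Y, k := u)) (Mem k x) \<and> sat M (\<rho>(k := u)) \<phi>"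
      using Y(2)[rule_format, OF u] unfolding sat.simps(4,6) eq by argo
    then show ?thesis using x y by simp
  qed
  have "els M Y = {u \<in> els M X. sat M (\<rho>(k := u)) \<phi>}"
    unfolding els_def using Y' by (simp add: set_eq_iff cong: conj_cong)
  then show ?thesis using Y(1) by (rule bexI)
qed

lemma collection_sat:
  assumes "models M T" "Collection \<Gamma> \<subseteq> T" "\<phi> \<in> \<Gamma>" "range \<rho> \<subseteq> univ M" "X \<in> univ M" "k \<noteq> l"
    and ex: "\<forall>u\<in>els M X. \<exists>v\<in>univ M. sat M (\<rho>(k := u, l := v)) \<phi>"
  shows "\<exists>Y\<in>univ M. \<forall>u\<in>els M X. \<exists>v\<in>els M Y. sat M (\<rho>(k := u, l := v)) \<phi>"
proof -
  obtain x where x: "x \<notin> fv \<phi> \<union> {k, l}" using ex_fresh[of "fv \<phi> \<union> {k, l}"] finite_fv by blast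
  obtain y where y: "y \<notin> fv \<phi> \<union> {k, l, x}" using ex_fresh[of "fv \<phi> \<union> {k, l, x}"] finite_fv by blast
  let ?A = "All x (Imp (All k (Imp (Mem k x) (Ex l \<phi>)))
        (Ex y (All k (Imp (Mem k x) (Ex l (And (Mem l y) \<phi>))))))"
  have "?A \<in> Collection \<Gamma>"
    unfolding Collection_def mem_Collect_eq using assms(3,6) x y
    by (intro exI[of _ \<phi>] exI[of _ x] exI[of _ y] exI[of _ k] exI[of _ l]) auto
  then have "sat M \<rho> ?A"
    using assms(1,2,4) unfolding models_def by blast
  then have A: "sat M (\<rho>(x := X)) (All k (Imp (Mem k x) (Ex l \<phi>))) \<longrightarrow>
      sat M (\<rho>(x := X)) (Ex y (All k (Imp (Mem k x) (Ex l (And (Mem l y) \<phi>)))))"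
    using assms(5) by (simp only: sat.simps) blast
  have eq1: "sat M (\<rho>(x := X, k := u, l := v)) \<phi> = sat M (\<rho>(k := u, l := v)) \<phi>" for u v
    by (rule sat_cong) (use x in auto)
  have eq: "sat M (\<rho>(x := X, y := Y, k := u, l := v)) \<phi> = sat M (\<rho>(k := u, l := v)) \<phi>" for u v Y
    by (rule sat_cong) (use x y in auto)
  have "sat M (\<rho>(x := X)) (All k (Imp (Mem k x) (Ex l \<phi>)))"
    using ex x by (simp add: eq1 els_def)
  with A obtain Y where "Y \<in> univ M" "sat M (\<rho>(x := X, y := Y)) (All k (Imp (Mem k x) (Ex l (And (Mem l y) \<phi>))))"
    unfolding sat.simps(8) by blast
  then show ?thesis using x y \<open>k \<noteq> l\<close> by (intro bexI[of _ Y]) (auto simp: els_def eq)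
qed

lemma foundation_sat:
  assumes "models M T" "Foundation \<Gamma> \<subseteq> T" "\<phi> \<in> \<Gamma>" "range \<rho> \<subseteq> univ M"
    and ex: "\<exists>a\<in>univ M. sat M (\<rho>(k := a)) \<phi>"
  shows "\<exists>a\<in>univ M. sat M (\<rho>(k := a)) \<phi> \<and> (\<forall>b\<in>els M a. \<not> sat M (\<rho>(k := b)) \<phi>)"
proof -
  obtain v where v: "v \<notin> fv \<phi> \<union> {k}" using ex_fresh[of "fv \<phi> \<union> {k}"] finite_fv by blast
  let ?A = "Imp (Ex k \<phi>) (Ex k (And \<phi> (All v (Imp (Mem v k) (Neg (Ex k (And (Eq k v) \<phi>)))))))"
  have "?A \<in> Foundation \<Gamma>"
    unfolding Foundation_def mem_Collect_eq using assms(3) v by (intro exI[of _ \<phi>] exI[of _ k] exI[of _ v]) simp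
  then have "sat M \<rho> ?A"
    using assms(1,2,4) unfolding models_def by blast
  then obtain a where a: "a \<in> univ M" "sat M (\<rho>(k := a)) \<phi>"
    "sat M (\<rho>(k := a)) (All v (Imp (Mem v k) (Neg (Ex k (And (Eq k v) \<phi>)))))"
    using ex unfolding sat.simps(4,6,8) by blast
  have eq: "sat M (\<rho>(k := a, v := b, k := b)) \<phi> = sat M (\<rho>(k := b)) \<phi>" for b
    by (rule sat_cong) (use v in auto)
  have "\<not> sat M (\<rho>(k := b)) \<phi>" if "b \<in> els M a" for b
    using a(3) that v eq[of b] by (auto simp: els_def)
  then show ?thesis using a by blast
qed

abbreviation (input) env6 :: "'a \<Rightarrow> 'a \<Rightarrow> 'a \<Rightarrow> 'a \<Rightarrow> 'a \<Rightarrow> 'a \<Rightarrow> nat \<Rightarrow> 'a" where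
  "env6 a b c d e f \<equiv> case_nat a (case_nat b (case_nat c (case_nat d (case_nat e (\<lambda>_. f)))))"

lemma range_case_nat: "range (case_nat a \<rho>) \<subseteq> A \<longleftrightarrow> a \<in> A \<and> range \<rho> \<subseteq> A"
  by (auto simp: image_subset_iff split: nat.split)

lemma case_nat_upd: "(case_nat a \<rho>)(0 := u) = case_nat u \<rho>"
  "(case_nat b (case_nat a \<rho>))(Suc 0 := u) = case_nat b (case_nat u \<rho>)"
  by (auto simp: fun_eq_iff split: nat.split)

locale kpp =
  fixes M :: "'a str"
  assumes KPP: "models M KPP"
begin

abbreviation U :: "'a set" where "U \<equiv> univ M"

lemma axiom: "\<phi> \<in> KPP \<Longrightarrow> range \<rho> \<subseteq> U \<Longrightarrow> sat M \<rho> \<phi>"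
  using KPP unfolding models_def by blast

lemma els_U: "y \<in> els M x \<Longrightarrow> y \<in> U"
  by (simp add: els_def)

lemma sep:
  assumes "definable (\<lambda>M \<rho>. Q M (\<rho> 0) (\<rho> (Suc 0)) (\<rho> 2) (\<rho> 3)
      (\<rho> 4) (\<rho> 5) (\<rho> 6))"
    and "X \<in> U" "a \<in> U" "b \<in> U" "c \<in> U" "d \<in> U" "e \<in> U" "f \<in> U"
  shows "\<exists>Y\<in>U. els M Y = {u \<in> els M X. Q M u a b c d e f}"
proof -
  obtain \<phi> where \<phi>: "\<phi>\<in>Delta0P" "\<forall>M \<rho>. sat M \<rho> \<phi> \<longleftrightarrow> Q M (\<rho> 0) (\<rho> (Suc 0)) (\<rho> 2) (\<rho> 3)
      (\<rho> 4) (\<rho> 5) (\<rho> 6)"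
    using assms(1) unfolding definable_def by metis
  have "\<exists>Y\<in>U. els M Y = {u \<in> els M X. sat M ((case_nat X (env6 a b c d e f))(0 := u)) \<phi>}"
    by (rule separation_sat[OF KPP _ \<phi>(1)]) (use assms in \<open>auto simp: KPP_def range_case_nat\<close>)
  then show ?thesis by (simp add: \<phi>(2) case_nat_upd)
qed

lemma coll:
  assumes "definable (\<lambda>M \<rho>. Q M (\<rho> 0) (\<rho> (Suc 0)) (\<rho> 2) (\<rho> 3)
      (\<rho> 4) (\<rho> 5) (\<rho> 6)
      (\<rho> 7))"
    and "X \<in> U" "a \<in> U" "b \<in> U" "c \<in> U" "d \<in> U" "e \<in> U" "f \<in> U"
    and "\<And>u. u \<in> els M X \<Longrightarrow> \<exists>v\<in>U. Q M v u a b c d e f"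
  shows "\<exists>Y\<in>U. \<forall>u\<in>els M X. \<exists>v\<in>els M Y. Q M v u a b c d e f"
proof -
  obtain \<phi> where \<phi>: "\<phi>\<in>Delta0P" "\<forall>M \<rho>. sat M \<rho> \<phi> \<longleftrightarrow> Q M (\<rho> 0) (\<rho> (Suc 0)) (\<rho> 2) (\<rho> 3)
      (\<rho> 4) (\<rho> 5) (\<rho> 6)
      (\<rho> 7)"
    using assms(1) unfolding definable_def by metis
  have "\<exists>Y\<in>U. \<forall>u\<in>els M X. \<exists>v\<in>els M Y. sat M ((case_nat X (case_nat X (env6 a b c d e f)))(Suc 0 := u, 0 := v)) \<phi>"
    by (rule collection_sat[OF KPP _ \<phi>(1)]) (use assms in \<open>auto simp: KPP_def range_case_nat \<phi>(2) case_nat_upd\<close>)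
  then show ?thesis by (simp add: \<phi>(2) case_nat_upd)
qed

text \<open>
  The failure set of a \<open>\<Sigma>\<^sub>1\<^sup>P\<close> predicate is \<open>\<Pi>\<^sub>1\<^sup>P\<close>, so \<open>\<Pi>\<^sub>1\<^sup>P\<close>-Foundation is induction for \<open>\<Sigma>\<^sub>1\<^sup>P\<close> predicates.
\<close>

lemma sigma_induct:
  assumes "definable (\<lambda>M \<rho>. Q M (\<rho> 0) (\<rho> (Suc 0)))"
    and step: "\<And>x. x \<in> U \<Longrightarrow> (\<And>y. y \<in> els M x \<Longrightarrow> \<exists>v\<in>U. Q M v y) \<Longrightarrow> \<exists>v\<in>U. Q M v x"
    and x: "x \<in> U"
  shows "\<exists>v\<in>U. Q M v x"
proof (rule ccontr)
  assume no: "\<not> ?thesis"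
  obtain \<phi> where \<phi>: "\<phi>\<in>Delta0P" "\<forall>M \<rho>. sat M \<rho> \<phi> \<longleftrightarrow> Q M (\<rho> 0) (\<rho> (Suc 0))"
    using assms(1) unfolding definable_def by metis
  have s: "sat M ((\<lambda>_. x)(Suc 0 := a)) (All 0 (Neg \<phi>)) \<longleftrightarrow> \<not> (\<exists>v\<in>U. Q M v a)" for a
    by (simp add: \<phi>(2))
  have "\<exists>a\<in>U. sat M ((\<lambda>_. x)(Suc 0 := a)) (All 0 (Neg \<phi>)) \<and>
      (\<forall>b\<in>els M a. \<not> sat M ((\<lambda>_. x)(Suc 0 := b)) (All 0 (Neg \<phi>)))"
  proof (rule foundation_sat[OF KPP, where \<Gamma>="PiP 1"])
    show "Foundation (PiP 1) \<subseteq> KPP" unfolding KPP_def by blast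
    show "All 0 (Neg \<phi>) \<in> PiP 1" using \<phi>(1) by (auto intro: Delta0P.neg)
    show "\<exists>a\<in>U. sat M ((\<lambda>_. x)(Suc 0 := a)) (All 0 (Neg \<phi>))"
      unfolding s using no x by blast
  qed (use x in auto)
  then show False unfolding s using step by blast
qed

lemma ext: "x \<in> U \<Longrightarrow> y \<in> U \<Longrightarrow> els M x = els M y \<Longrightarrow> x = y"
proof -
  assume a: "x \<in> U" "y \<in> U" "els M x = els M y"
  have "sat M (\<lambda>_. x) Extensionality" using a by (intro axiom) (auto simp: KPP_def)
  then have "\<forall>x\<in>U. \<forall>y\<in>U. (\<forall>z\<in>U. (mem M z x \<longrightarrow> mem M z y) \<and> (mem M z y \<longrightarrow> mem M z x)) \<longrightarrow> x = y"
    unfolding Extensionality_def by simp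
  moreover have "\<forall>z\<in>U. (mem M z x \<longrightarrow> mem M z y) \<and> (mem M z y \<longrightarrow> mem M z x)"
    using a(3) unfolding els_def by blast
  ultimately show ?thesis using a by blast
qed

lemma upair_ex: "x \<in> U \<Longrightarrow> y \<in> U \<Longrightarrow> \<exists>z\<in>U. els M z = {x, y}"
proof -
  assume a: "x \<in> U" "y \<in> U"
  have "sat M (\<lambda>_. x) Pair_ax" using a by (intro axiom) (auto simp: KPP_def)
  then have *: "\<forall>x\<in>U. \<forall>y\<in>U. \<exists>z\<in>U. \<forall>w\<in>U. (mem M w z \<longrightarrow> w = x \<or> w = y) \<and> (w = x \<or> w = y \<longrightarrow> mem M w z)"
    unfolding Pair_ax_def by simp
  from bspec[OF bspec[OF *, OF a(1)], OF a(2)] obtain z where z: "z\<in>U" "\<forall>w\<in>U. (mem M w z \<longrightarrow> w = x \<or> w = y) \<and> (w = x \<or> w = y \<longrightarrow> mem M w z)"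
    by (rule bexE)
  then have "els M z = {x, y}" using a unfolding els_def by blast
  then show ?thesis using z(1) by blast
qed

lemma Union_ex: "x \<in> U \<Longrightarrow> \<exists>z\<in>U. els M z = (\<Union>y\<in>els M x. els M y)"
proof -
  assume a: "x \<in> U"
  have "sat M (\<lambda>_. x) Union_ax" using a by (intro axiom) (auto simp: KPP_def)
  then have *: "\<forall>x\<in>U. \<exists>z\<in>U. \<forall>w\<in>U. (mem M w z \<longrightarrow> (\<exists>y\<in>U. mem M y x \<and> mem M w y)) \<and>
      ((\<exists>y\<in>U. mem M y x \<and> mem M w y) \<longrightarrow> mem M w z)"
    unfolding Union_ax_def by simp
  from bspec[OF *, OF a] obtain z where z: "z\<in>U" "\<forall>w\<in>U. (mem M w z \<longrightarrow> (\<exists>y\<in>U. mem M y x \<and> mem M w y)) \<and>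
      ((\<exists>y\<in>U. mem M y x \<and> mem M w y) \<longrightarrow> mem M w z)"
    by (rule bexE)
  then have "els M z = (\<Union>y\<in>els M x. els M y)" unfolding els_def by blast
  then show ?thesis using z(1) by blast
qed

lemma Pow_ex: "x \<in> U \<Longrightarrow> \<exists>z\<in>U. els M z = {w\<in>U. els M w \<subseteq> els M x}"
proof -
  assume a: "x \<in> U"
  have "sat M (\<lambda>_. x) Powerset_ax" using a by (intro axiom) (auto simp: KPP_def)
  then have *: "\<forall>x\<in>U. \<exists>z\<in>U. \<forall>w\<in>U. (mem M w z \<longrightarrow> els M w \<subseteq> els M x) \<and> (els M w \<subseteq> els M x \<longrightarrow> mem M w z)"
    unfolding Powerset_ax_def by (simp add: sat_Sub)
  from bspec[OF *, OF a] obtain z where z: "z\<in>U" "\<forall>w\<in>U. (mem M w z \<longrightarrow> els M w \<subseteq> els M x) \<and> (els M w \<subseteq> els M x \<longrightarrow> mem M w z)"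
    by (rule bexE)
  then have "els M z = {w\<in>U. els M w \<subseteq> els M x}" unfolding els_def[of M z] by blast
  then show ?thesis using z(1) by blast
qed

lemma Un_ex: "x \<in> U \<Longrightarrow> y \<in> U \<Longrightarrow> \<exists>z\<in>U. els M z = els M x \<union> els M y"
proof -
  assume a: "x \<in> U" "y \<in> U"
  obtain p where p: "p\<in>U" "els M p = {x, y}" using upair_ex a by blast
  then show ?thesis using Union_ex[OF p(1)] by simp
qed

lemma insert_ex: "x \<in> U \<Longrightarrow> y \<in> U \<Longrightarrow> \<exists>z\<in>U. els M z = insert x (els M y)"
proof -
  assume a: "x \<in> U" "y \<in> U"
  obtain p where p: "p\<in>U" "els M p = {x, x}" using upair_ex a by blast
  then show ?thesis using Un_ex[OF p(1) a(2)] by simp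
qed

lemma U_ne: "\<exists>x. x \<in> U"
  using KPP unfolding models_def by blast

lemma empty_ex: "\<exists>z\<in>U. els M z = {}"
proof -
  obtain x where x: "x \<in> U" using U_ne by blast
  have "\<exists>Y\<in>U. els M Y = {u \<in> els M x. u \<noteq> u}"
    by (rule sep[where Q="\<lambda>M u a b c d e f. u \<noteq> u", OF _ x x x x x x x]) (intro definable_intros)
  then show ?thesis by simp
qed

lemma foundation: "X \<in> U \<Longrightarrow> els M X \<noteq> {} \<Longrightarrow> \<exists>y\<in>els M X. els M y \<inter> els M X = {}"
proof (rule ccontr)
  assume X: "X \<in> U" "els M X \<noteq> {}" and no: "\<not> ?thesis"
  have "\<exists>a\<in>U. sat M ((\<lambda>_. X)(0 := a)) (All 2 (Mem 0 1)) \<and>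
      (\<forall>b\<in>els M a. \<not> sat M ((\<lambda>_. X)(0 := b)) (All 2 (Mem 0 1)))"
  proof (rule foundation_sat[OF KPP, where \<Gamma>="PiP 1"])
    show "Foundation (PiP 1) \<subseteq> KPP" unfolding KPP_def by blast
    show "All 2 (Mem 0 1) \<in> PiP 1" by (auto intro: Delta0P.mem)
    show "\<exists>a\<in>U. sat M ((\<lambda>_. X)(0 := a)) (All 2 (Mem 0 1))" using X by (auto simp: els_def)
  qed (use X in auto)
  then show False using no X by (auto simp: els_def)
qed

lemma irrefl: "x \<in> U \<Longrightarrow> x \<notin> els M x"
proof
  assume x: "x \<in> U" "x \<in> els M x"
  obtain p where p: "p\<in>U" "els M p = {x, x}" using upair_ex x by blast
  then show False using foundation[OF p(1)] x by auto
qed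

lemma opr_inj: "opr M' a b p \<Longrightarrow> opr M' c d p \<Longrightarrow> a = c \<and> b = d"
  unfolding opr_def by (auto simp: doubleton_eq_iff)

lemma opr_U: "opr M a b p \<Longrightarrow> a \<in> U \<and> b \<in> U"
  unfolding opr_def using els_U by blast

lemma opr_ex: "a \<in> U \<Longrightarrow> b \<in> U \<Longrightarrow> \<exists>p\<in>U. opr M a b p"
proof -
  assume a: "a \<in> U" "b \<in> U"
  obtain u where u: "u\<in>U" "els M u = {a, a}" using upair_ex[OF a(1) a(1)] by blast
  obtain v where v: "v\<in>U" "els M v = {a, b}" using upair_ex[OF a] by blast
  obtain p where p: "p\<in>U" "els M p = {u, v}" using upair_ex[OF u(1) v(1)] by blast
  have "opr M a b p" unfolding opr_def by (rule bexI[of _ u], rule bexI[of _ v]) (use u v p in \<open>simp_all\<close>)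
  then show ?thesis using p(1) by blast
qed

lemma opr_unique: "p \<in> U \<Longrightarrow> q \<in> U \<Longrightarrow> opr M a b p \<Longrightarrow> opr M a b q \<Longrightarrow> p = q"
proof -
  assume pq: "p \<in> U" "q \<in> U" "opr M a b p" "opr M a b q"
  obtain u w where 1: "els M u = {a}" "els M w = {a, b}" "els M p = {u, w}" "u \<in> U" "w \<in> U"
    using pq(3) els_U unfolding opr_def by blast
  obtain u' w' where 2: "els M u' = {a}" "els M w' = {a, b}" "els M q = {u', w'}" "u' \<in> U" "w' \<in> U"
    using pq(4) els_U unfolding opr_def by blast
  have "u = u'" "w = w'" using ext[OF 1(4) 2(4)] ext[OF 1(5) 2(5)] 1 2 by simp_all
  then show ?thesis using ext[OF pq(1,2)] 1 2 by simp
qed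

definition pr :: "'a \<Rightarrow> 'a \<Rightarrow> 'a" where "pr a b = (THE p. p \<in> U \<and> opr M a b p)"

lemma pr: "a \<in> U \<Longrightarrow> b \<in> U \<Longrightarrow> pr a b \<in> U \<and> opr M a b (pr a b)"
proof -
  assume a: "a \<in> U" "b \<in> U"
  then obtain p where p: "p \<in> U \<and> opr M a b p" using opr_ex by blast
  show ?thesis unfolding pr_def by (rule theI[of _ p]) (use p opr_unique in auto)
qed

lemma opr_pr: "p \<in> U \<Longrightarrow> opr M a b p \<longleftrightarrow> a \<in> U \<and> b \<in> U \<and> p = pr a b"
  using pr opr_U opr_unique by blast

lemma pr_inj: "a \<in> U \<Longrightarrow> b \<in> U \<Longrightarrow> c \<in> U \<Longrightarrow> d \<in> U \<Longrightarrow> pr a b = pr c d \<longleftrightarrow> a = c \<and> b = d"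
  using pr opr_inj by metis

lemma app_pr: "app M f a b \<longleftrightarrow> a \<in> U \<and> b \<in> U \<and> pr a b \<in> els M f"
  unfolding app_def using opr_pr els_U pr by metis

lemma app_bounds: "app M f a b \<Longrightarrow> \<exists>p\<in>els M f. \<exists>v\<in>els M p. b \<in> els M v"
  unfolding app_def by (meson opr_comps(2))

text \<open>
  Induction inside one transitive set needs no class Foundation: it suffices that the predicate cuts
  out a set.
\<close>

lemma trans_induct:
  assumes am: "\<exists>z\<in>U. els M z = {x\<in>els M t. P x}" and "t \<in> U" "trans_set M t" "x \<in> els M t"
    and step: "\<And>x. x \<in> els M t \<Longrightarrow> (\<And>y. y \<in> els M x \<Longrightarrow> P y) \<Longrightarrow> P x"
  shows "P x"
proof (rule ccontr)
  assume no: "\<not> P x"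
  obtain z where z: "z \<in> U" "els M z = {x\<in>els M t. P x}" using am by blast
  have "\<exists>Y\<in>U. els M Y = {u \<in> els M t. u \<notin> els M z}"
    by (rule sep[where Q="\<lambda>M u a b c d e f. u \<notin> els M a" and a=z]) (intro definable_intros | use z assms in simp)+
  then obtain Y where Y: "Y \<in> U" "els M Y = {u \<in> els M t. u \<notin> els M z}" by blast
  have "els M Y \<noteq> {}" using no Y z assms(4) by auto
  then obtain y where y: "y \<in> els M Y" "els M y \<inter> els M Y = {}" using foundation Y by blast
  have "P y"
  proof (rule step)
    show "y \<in> els M t" using y Y by auto
    fix v assume v: "v \<in> els M y"
    have "v \<in> els M t" using v \<open>y \<in> els M t\<close> assms(3) unfolding trans_set_def by blast
    then show "P v" using y(2) v Y(2) z(2) by blast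
  qed
  then show False using y Y z by auto
qed

end

section \<open>Recursion along membership\<close>

text \<open>
  \<open>f\<close> is the restriction to the transitive set \<open>t\<close> of the solution of \<open>F(x) = \<Union> {G(F(y)) | y \<in> x}\<close>. Here
  \<open>G M w \<gamma>\<close> says \<open>w \<in> G(\<gamma>)\<close>, and \<open>H M \<gamma> \<alpha>\<close> says \<open>G(\<gamma>) \<subseteq> \<alpha>\<close>; the latter is a separate parameter since \<open>G(\<gamma>)\<close>
  is given only by its elements and the inclusion has to be a bounded statement.
\<close>

definition recfun :: "('a str \<Rightarrow> 'a \<Rightarrow> 'a \<Rightarrow> bool) \<Rightarrow> ('a str \<Rightarrow> 'a \<Rightarrow> 'a \<Rightarrow> bool) \<Rightarrow> 'a str \<Rightarrow> 'a \<Rightarrow> 'a \<Rightarrow> bool" where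
  "recfun G H M f t \<longleftrightarrow> trans_set M t \<and>
     (\<forall>p\<in>els M f. \<exists>x y. opr M x y p \<and> x \<in> els M t) \<and>
     (\<forall>x\<in>els M t. \<exists>y. app M f x y \<and> (\<forall>y'. app M f x y' \<longrightarrow> y' = y)) \<and>
     (\<forall>x\<in>els M t. \<forall>\<alpha>. app M f x \<alpha> \<longrightarrow>
        (\<forall>w\<in>els M \<alpha>. \<exists>y\<in>els M x. \<exists>\<gamma>. app M f y \<gamma> \<and> G M w \<gamma>) \<and>
        (\<forall>y\<in>els M x. \<forall>\<gamma>. app M f y \<gamma> \<longrightarrow> H M \<gamma> \<alpha>))"

locale kpp_rec = kpp M for M :: "'a str" +
  fixes G H :: "'a str \<Rightarrow> 'a \<Rightarrow> 'a \<Rightarrow> bool"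
  assumes definable_G: "\<And>i j. definable (\<lambda>M \<rho>. G M (\<rho> i) (\<rho> j))"
    and definable_H: "\<And>i j. definable (\<lambda>M \<rho>. H M (\<rho> i) (\<rho> j))"
    and H_iff: "\<And>\<gamma> \<alpha>. \<gamma> \<in> U \<Longrightarrow> H M \<gamma> \<alpha> \<longleftrightarrow> (\<forall>w\<in>U. G M w \<gamma> \<longrightarrow> w \<in> els M \<alpha>)"
    and Gex: "\<And>\<gamma>. \<gamma> \<in> U \<Longrightarrow> \<exists>g\<in>U. els M g = {w\<in>U. G M w \<gamma>}"
begin

abbreviation rf :: "'a \<Rightarrow> 'a \<Rightarrow> bool" where "rf \<equiv> recfun G H M"

lemma definable_recfun: "definable (\<lambda>M \<rho>. recfun G H M (\<rho> i) (\<rho> j))"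
  unfolding recfun_def by (intro definable_intros definable_G definable_H)

lemma app_U: "app M f x y \<Longrightarrow> x \<in> U \<and> y \<in> U"
  using app_pr by blast

lemma recfun_trans: "rf f t \<Longrightarrow> x \<in> els M t \<Longrightarrow> y \<in> els M x \<Longrightarrow> y \<in> els M t"
  unfolding recfun_def trans_set_def by blast

lemma recfun_dom: "rf f t \<Longrightarrow> app M f x y \<Longrightarrow> x \<in> els M t"
proof -
  assume r: "rf f t" and "app M f x y"
  then obtain p where p: "p \<in> els M f" "opr M x y p" unfolding app_def by blast
  then obtain x' y' where "opr M x' y' p" "x' \<in> els M t" using r unfolding recfun_def by blast
  then show ?thesis using opr_inj[OF p(2)] by blast
qed

lemma recfun_ex_value: "rf f t \<Longrightarrow> x \<in> els M t \<Longrightarrow> \<exists>y. app M f x y"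
  unfolding recfun_def by blast

lemma recfun_unique: "rf f t \<Longrightarrow> app M f x y \<Longrightarrow> app M f x z \<Longrightarrow> y = z"
proof -
  assume r: "rf f t" and a: "app M f x y" "app M f x z"
  have "x \<in> els M t" by (rule recfun_dom[OF r a(1)])
  then show "y = z" using r a unfolding recfun_def by metis
qed

lemma recfun_els:
  assumes r: "rf f t" and a: "app M f x \<alpha>"
  shows "els M \<alpha> = {w\<in>U. \<exists>y\<in>els M x. \<exists>\<gamma>. app M f y \<gamma> \<and> G M w \<gamma>}"
proof -
  have x: "x \<in> els M t" by (rule recfun_dom[OF r a(1)])
  have 1: "\<forall>w\<in>els M \<alpha>. \<exists>y\<in>els M x. \<exists>\<gamma>. app M f y \<gamma> \<and> G M w \<gamma>"
    using r x a unfolding recfun_def by blast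
  have 2: "w \<in> els M \<alpha>" if "y \<in> els M x" "app M f y \<gamma>" "w \<in> U" "G M w \<gamma>" for w y \<gamma>
  proof -
    have "H M \<gamma> \<alpha>" using r x a that unfolding recfun_def by blast
    then show ?thesis using H_iff[of \<gamma> \<alpha>] app_U[OF that(2)] that by blast
  qed
  show ?thesis
  proof (intro set_eqI iffI)
    fix w assume w: "w \<in> els M \<alpha>"
    then show "w \<in> {w\<in>U. \<exists>y\<in>els M x. \<exists>\<gamma>. app M f y \<gamma> \<and> G M w \<gamma>}" using 1 els_U[OF w] by simp
  next
    fix w assume "w \<in> {w\<in>U. \<exists>y\<in>els M x. \<exists>\<gamma>. app M f y \<gamma> \<and> G M w \<gamma>}"
    then show "w \<in> els M \<alpha>" using 2 by blast
  qed
qed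

lemma recfunI:
  assumes "trans_set M t"
    and "\<And>p. p \<in> els M f \<Longrightarrow> \<exists>x y. opr M x y p \<and> x \<in> els M t"
    and "\<And>x. x \<in> els M t \<Longrightarrow> \<exists>y. app M f x y \<and> (\<forall>y'. app M f x y' \<longrightarrow> y' = y)"
    and els: "\<And>x \<alpha>. x \<in> els M t \<Longrightarrow> app M f x \<alpha> \<Longrightarrow> els M \<alpha> = {w\<in>U. \<exists>y\<in>els M x. \<exists>\<gamma>. app M f y \<gamma> \<and> G M w \<gamma>}"
  shows "rf f t"
proof -
  have "(\<forall>w\<in>els M \<alpha>. \<exists>y\<in>els M x. \<exists>\<gamma>. app M f y \<gamma> \<and> G M w \<gamma>) \<and>
        (\<forall>y\<in>els M x. \<forall>\<gamma>. app M f y \<gamma> \<longrightarrow> H M \<gamma> \<alpha>)" if x: "x \<in> els M t" and a: "app M f x \<alpha>" for x \<alpha>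
  proof (intro conjI ballI allI impI)
    fix w assume "w \<in> els M \<alpha>"
    then show "\<exists>y\<in>els M x. \<exists>\<gamma>. app M f y \<gamma> \<and> G M w \<gamma>" unfolding els[OF x a] by blast
  next
    fix y \<gamma> assume y: "y \<in> els M x" "app M f y \<gamma>"
    have "\<gamma> \<in> U" using app_U[OF y(2)] by blast
    then show "H M \<gamma> \<alpha>" unfolding H_iff[OF \<open>\<gamma> \<in> U\<close>] els[OF x a] using y by blast
  qed
  then show ?thesis unfolding recfun_def using assms(1-3) by blast
qed

text \<open>
  At an \<open>\<in>\<close>-minimal disagreement the two values have the same elements.
\<close>

lemma recfun_agree:
  assumes r: "rf f t" "rf f' t'" and u: "f \<in> U" "t \<in> U" "f' \<in> U" "t' \<in> U"
    and a: "app M f x y" "app M f' x y'"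
  shows "y = y'"
proof (rule ccontr)
  assume no: "y \<noteq> y'"
  have "\<exists>Y\<in>U. els M Y = {u \<in> els M t. \<exists>y. app M f u y \<and> (\<exists>y'. app M f' u y' \<and> y \<noteq> y')}"
    by (rule sep[where Q="\<lambda>M u a b c d e f. \<exists>y. app M a u y \<and> (\<exists>y'. app M b u y' \<and> y \<noteq> y')" and a=f and b=f'])
      (intro definable_intros | use u in simp)+
  then obtain Y where Y: "Y \<in> U" "els M Y = {u \<in> els M t. \<exists>y. app M f u y \<and> (\<exists>y'. app M f' u y' \<and> y \<noteq> y')}" by (rule bexE)
  have "x \<in> els M Y" unfolding Y(2) using recfun_dom[OF r(1) a(1)] a no by blast
  then obtain m where m: "m \<in> els M Y" "els M m \<inter> els M Y = {}" using foundation[OF Y(1)] by blast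
  then obtain z z' where z: "m \<in> els M t" "app M f m z" "app M f' m z'" "z \<noteq> z'" unfolding Y(2) by blast
  have m': "m \<in> els M t'" by (rule recfun_dom[OF r(2) z(3)])
  have eq: "\<gamma> = \<gamma>'" if "v \<in> els M m" "app M f v \<gamma>" "app M f' v \<gamma>'" for v \<gamma> \<gamma>'
  proof -
    have "v \<notin> els M Y" using m(2) that(1) by blast
    then show ?thesis unfolding Y(2) using recfun_dom[OF r(1) that(2)] that by blast
  qed
  have "els M z = els M z'"
  proof -
    have "(\<exists>\<gamma>. app M f v \<gamma> \<and> G M w \<gamma>) \<longleftrightarrow> (\<exists>\<gamma>. app M f' v \<gamma> \<and> G M w \<gamma>)" if v: "v \<in> els M m" for v w
    proof -
      obtain \<gamma> where 1: "app M f v \<gamma>" using recfun_ex_value[OF r(1) recfun_trans[OF r(1) z(1) v]] by blast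
      obtain \<gamma>' where 2: "app M f' v \<gamma>'" using recfun_ex_value[OF r(2) recfun_trans[OF r(2) m' v]] by blast
      show ?thesis using eq[OF v] 1 2 by blast
    qed
    then show ?thesis unfolding recfun_els[OF r(1) z(2)] recfun_els[OF r(2) z(3)] by blast
  qed
  moreover have "z \<in> U" "z' \<in> U" using app_U z(2,3) by blast+
  ultimately show False using ext z(4) by blast
qed

text \<open>
  By \<open>\<Sigma>\<^sub>1\<^sup>P\<close>-induction: Collection gathers recursive functions defined at the elements of \<open>X\<close>; by agreement
  their union \<open>F\<close> is one as well, and it extends by a value at \<open>X\<close>. The witness \<open>b\<close> packs function and
  domain into a single existential quantifier.
\<close>

lemma recfun_ex:
  assumes "x \<in> U"
  shows "\<exists>b\<in>U. \<exists>f\<in>els M b. \<exists>t\<in>els M b. rf f t \<and> x \<in> els M t"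
proof (rule sigma_induct[where Q="\<lambda>M b x. \<exists>f\<in>els M b. \<exists>t\<in>els M b. recfun G H M f t \<and> x \<in> els M t", OF _ _ assms])
  show "definable (\<lambda>M \<rho>. \<exists>f\<in>els M (\<rho> 0). \<exists>t\<in>els M (\<rho> 0). recfun G H M f t \<and> \<rho> (Suc 0) \<in> els M t)"
    by (intro definable_intros definable_recfun)
  fix X assume X: "X \<in> U" and IH: "\<And>y. y \<in> els M X \<Longrightarrow> \<exists>b\<in>U. \<exists>f\<in>els M b. \<exists>t\<in>els M b. rf f t \<and> y \<in> els M t"
  have "\<exists>B\<in>U. \<forall>u\<in>els M X. \<exists>v\<in>els M B. \<exists>f\<in>els M v. \<exists>t\<in>els M v. rf f t \<and> u \<in> els M t"
    by (rule coll[where Q="\<lambda>M v u a b c d e f. \<exists>f\<in>els M v. \<exists>t\<in>els M v. recfun G H M f t \<and> u \<in> els M t", OF _ X X X X X X X])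
      ((intro definable_intros definable_recfun)[1], rule IH)
  then obtain B where B: "B \<in> U" "\<forall>u\<in>els M X. \<exists>v\<in>els M B. \<exists>f\<in>els M v. \<exists>t\<in>els M v. rf f t \<and> u \<in> els M t" by (rule bexE)
  from Union_ex[OF B(1)] obtain UB where UB: "UB \<in> U" "els M UB = (\<Union>b\<in>els M B. els M b)" by (rule bexE)
  have "\<exists>C\<in>U. els M C = {f\<in>els M UB. \<exists>t\<in>els M UB. rf f t}"
    by (rule sep[where Q="\<lambda>M u a b c d e f. \<exists>t\<in>els M a. recfun G H M u t", OF _ UB(1) UB(1) UB(1) UB(1) UB(1) UB(1) UB(1)])
       (intro definable_intros definable_recfun)
  then obtain C where C: "C \<in> U" "els M C = {f\<in>els M UB. \<exists>t\<in>els M UB. rf f t}" by (rule bexE)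
  obtain D where D: "D \<in> U" "els M D = {t\<in>els M UB. \<exists>f\<in>els M UB. rf f t}"
    by (rule bexE[OF sep[where Q="\<lambda>M u a b c d e f. \<exists>f\<in>els M a. recfun G H M f u", OF _ UB(1) UB(1) UB(1) UB(1) UB(1) UB(1) UB(1)]]) (intro definable_intros definable_recfun, rule that)
  from Union_ex[OF C(1)] obtain F where F: "F \<in> U" "els M F = (\<Union>f\<in>els M C. els M f)" by (rule bexE)
  from Union_ex[OF D(1)] obtain T where T: "T \<in> U" "els M T = (\<Union>t\<in>els M D. els M t)" by (rule bexE)
  have appF: "app M F x y \<longleftrightarrow> (\<exists>f\<in>els M C. app M f x y)" for x y
    unfolding app_def F(2) by blast
  have Cr: "\<exists>t\<in>els M D. rf f t" if "f \<in> els M C" for f using that unfolding C(2) D(2) by blast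
  have Dr: "\<exists>f\<in>els M C. rf f t" if "t \<in> els M D" for t using that unfolding C(2) D(2) by blast
  have CD: "f \<in> els M C \<Longrightarrow> f \<in> U" "t \<in> els M D \<Longrightarrow> t \<in> U" for f t using els_U by blast+
  have agree: "y = y'" if "app M F x y" "app M F x y'" for x y y'
  proof -
    obtain f where f: "f \<in> els M C" "app M f x y" using \<open>app M F x y\<close> unfolding appF by blast
    obtain f' where f': "f' \<in> els M C" "app M f' x y'" using \<open>app M F x y'\<close> unfolding appF by blast
    obtain t where t: "t \<in> els M D" "rf f t" using Cr[OF f(1)] by blast
    obtain t' where t': "t' \<in> els M D" "rf f' t'" using Cr[OF f'(1)] by blast
    show ?thesis using recfun_agree[OF t(2) t'(2) _ _ _ _ f(2) f'(2)] CD f(1) f'(1) t(1) t'(1) by blast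
  qed
  have XT: "els M X \<subseteq> els M T"
  proof
    fix u assume "u \<in> els M X"
    then obtain v f t where v: "v\<in>els M B" "f\<in>els M v" "t\<in>els M v" "rf f t" "u \<in> els M t" using B(2) by blast
    have "f \<in> els M UB" "t \<in> els M UB" using v(1-3) unfolding UB(2) by blast+
    then have "t \<in> els M D" unfolding D(2) using v(4) by blast
    then show "u \<in> els M T" unfolding T(2) using v(5) by blast
  qed
  have rF: "rf F T"
  proof (rule recfunI)
    show "trans_set M T" unfolding trans_set_def
    proof
      fix x assume "x \<in> els M T"
      then obtain t where t: "t \<in> els M D" "x \<in> els M t" unfolding T(2) by blast
      obtain f where f: "rf f t" using Dr[OF t(1)] by blast
      have "els M x \<subseteq> els M t" using recfun_trans[OF f t(2)] by blast
      then show "els M x \<subseteq> els M T" unfolding T(2) using t(1) by blast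
    qed
  next
    fix p assume "p \<in> els M F"
    then obtain f where f: "f \<in> els M C" "p \<in> els M f" unfolding F(2) by blast
    obtain t where t: "t \<in> els M D" "rf f t" using Cr[OF f(1)] by blast
    then obtain x y where "opr M x y p" "x \<in> els M t" using f(2) unfolding recfun_def by blast
    then show "\<exists>x y. opr M x y p \<and> x \<in> els M T" unfolding T(2) using t(1) by blast
  next
    fix x assume "x \<in> els M T"
    then obtain t where t: "t \<in> els M D" "x \<in> els M t" unfolding T(2) by blast
    obtain f where f: "f \<in> els M C" "rf f t" using Dr[OF t(1)] by blast
    obtain y where "app M f x y" using recfun_ex_value[OF f(2) t(2)] by blast
    then have "app M F x y" unfolding appF using f(1) by blast
    then show "\<exists>y. app M F x y \<and> (\<forall>y'. app M F x y' \<longrightarrow> y' = y)" using agree by blast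
  next
    fix x \<alpha> assume "app M F x \<alpha>"
    then obtain f where f: "f \<in> els M C" "app M f x \<alpha>" unfolding appF by blast
    obtain t where t: "t \<in> els M D" "rf f t" using Cr[OF f(1)] by blast
    have x: "x \<in> els M t" by (rule recfun_dom[OF t(2) f(2)])
    have "app M f y \<gamma> \<longleftrightarrow> app M F y \<gamma>" if y: "y \<in> els M x" for y \<gamma>
    proof
      show "app M F y \<gamma>" if "app M f y \<gamma>" using that f(1) unfolding appF by blast
      assume g: "app M F y \<gamma>"
      obtain \<gamma>' where g': "app M f y \<gamma>'" using recfun_ex_value[OF t(2) recfun_trans[OF t(2) x y]] by blast
      then have "app M F y \<gamma>'" using f(1) unfolding appF by blast
      then show "app M f y \<gamma>" using agree[OF g] g' by blast
    qed
    then show "els M \<alpha> = {w\<in>U. \<exists>y\<in>els M x. \<exists>\<gamma>. app M F y \<gamma> \<and> G M w \<gamma>}"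
      unfolding recfun_els[OF t(2) f(2)] by blast
  qed
  show "\<exists>b\<in>U. \<exists>f\<in>els M b. \<exists>t\<in>els M b. rf f t \<and> X \<in> els M t"
  proof (cases "X \<in> els M T")
    case True
    from upair_ex[OF F(1) T(1)] obtain b where b: "b \<in> U" "els M b = {F, T}" by (rule bexE)
    show ?thesis by (rule bexI[OF _ b(1)], rule bexI[of _ F], rule bexI[of _ T]) (use rF True b(2) in simp_all)
  next
    case False
    \<comment> \<open>\<open>F2\<close> contains all values of \<open>F\<close>, so Collection over it bounds the union defining the value at \<open>X\<close>.\<close>
    from Union_ex[OF F(1)] obtain F1 where F1: "F1 \<in> U" "els M F1 = (\<Union>b\<in>els M F. els M b)" by (rule bexE)
    from Union_ex[OF F1(1)] obtain F2 where F2: "F2 \<in> U" "els M F2 = (\<Union>b\<in>els M F1. els M b)" by (rule bexE)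
    have "\<exists>B\<in>U. \<forall>u\<in>els M F2. \<exists>v\<in>els M B. (\<forall>w\<in>els M v. G M w u) \<and> H M u v"
    proof (rule coll[where Q="\<lambda>M v u a b c d e f. (\<forall>w\<in>els M v. G M w u) \<and> H M u v", OF _ F2(1) X X X X X X])
      show "definable (\<lambda>M \<rho>. (\<forall>w\<in>els M (\<rho> 0). G M w (\<rho> (Suc 0))) \<and> H M (\<rho> (Suc 0)) (\<rho> 0))"
        by (intro definable_intros definable_G definable_H)
      fix u assume "u \<in> els M F2"
      then have u: "u \<in> U" by (rule els_U)
      from Gex[OF u] obtain g where g: "g \<in> U" "els M g = {w\<in>U. G M w u}" by (rule bexE)
      show "\<exists>v\<in>U. (\<forall>w\<in>els M v. G M w u) \<and> H M u v"
        by (rule bexI[OF _ g(1)]) (unfold g(2) H_iff[OF u], blast)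
    qed
    then obtain K where K: "K \<in> U" "\<forall>u\<in>els M F2. \<exists>v\<in>els M K. (\<forall>w\<in>els M v. G M w u) \<and> H M u v" by (rule bexE)
    from Union_ex[OF K(1)] obtain K' where K': "K' \<in> U" "els M K' = (\<Union>b\<in>els M K. els M b)" by (rule bexE)
    obtain A where A: "A \<in> U" "els M A = {w\<in>els M K'. \<exists>y\<in>els M X. \<exists>\<gamma>. app M F y \<gamma> \<and> G M w \<gamma>}"
      by (rule bexE[OF sep[where Q="\<lambda>M w a b c d e f. \<exists>y\<in>els M a. \<exists>\<gamma>. app M b y \<gamma> \<and> G M w \<gamma>", OF _ K'(1) X F(1) X X X X]]) (intro definable_intros definable_G, rule that)
    have A': "els M A = {w\<in>U. \<exists>y\<in>els M X. \<exists>\<gamma>. app M F y \<gamma> \<and> G M w \<gamma>}"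
    proof -
      have "w \<in> els M K'" if w: "w \<in> U" "app M F y \<gamma>" "G M w \<gamma>" for w y \<gamma>
      proof -
        from app_bounds[OF w(2)] have "\<gamma> \<in> els M F2" unfolding F2(2) F1(2) by blast
        then obtain v where v: "v\<in>els M K" "H M \<gamma> v" using K(2) by blast
        have "\<gamma> \<in> U" using app_U[OF w(2)] by blast
        then have "w \<in> els M v" using v(2) w(1,3) H_iff by blast
        then show ?thesis unfolding K'(2) using v(1) by blast
      qed
      then show ?thesis unfolding A(2) using els_U by blast
    qed
    from insert_ex[OF X T(1)] obtain T1 where T1: "T1 \<in> U" "els M T1 = insert X (els M T)" by (rule bexE)
    have P: "pr X A \<in> U" "opr M X A (pr X A)" using pr[OF X A(1)] by blast+
    from insert_ex[OF P(1) F(1)] obtain E where E: "E \<in> U" "els M E = insert (pr X A) (els M F)" by (rule bexE)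
    have appE: "app M E x y \<longleftrightarrow> app M F x y \<or> x = X \<and> y = A" for x y
    proof -
      have "opr M x y (pr X A) \<longleftrightarrow> x = X \<and> y = A" using P(2) opr_inj[OF P(2)] by blast
      then show ?thesis unfolding app_def E(2) by blast
    qed
    have FX: "\<not> app M F X y" for y using recfun_dom[OF rF] False by blast
    have appT: "app M E y \<gamma> \<longleftrightarrow> app M F y \<gamma>" if "y \<in> els M T" for y \<gamma>
      using that False unfolding appE by blast
    have "rf E T1"
    proof (rule recfunI)
      show "trans_set M T1" unfolding trans_set_def T1(2) using XT recfun_trans[OF rF] by blast
    next
      fix p assume "p \<in> els M E"
      then consider "p = pr X A" | "p \<in> els M F" unfolding E(2) by blast
      then show "\<exists>x y. opr M x y p \<and> x \<in> els M T1"
      proof cases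
        case 1
        then show ?thesis using P(2) unfolding T1(2) by blast
      next
        case 2
        then show ?thesis using rF unfolding recfun_def T1(2) by blast
      qed
    next
      fix x assume "x \<in> els M T1"
      then consider "x = X" | "x \<in> els M T" unfolding T1(2) by blast
      then show "\<exists>y. app M E x y \<and> (\<forall>y'. app M E x y' \<longrightarrow> y' = y)"
      proof cases
        case 1
        then show ?thesis unfolding appE using FX by blast
      next
        case 2
        then show ?thesis unfolding appT[OF 2] using rF unfolding recfun_def by blast
      qed
    next
      fix x \<alpha> assume x: "x \<in> els M T1" "app M E x \<alpha>"
      have sub: "els M x \<subseteq> els M T" using x(1) XT recfun_trans[OF rF] unfolding T1(2) by blast
      have "els M \<alpha> = {w\<in>U. \<exists>y\<in>els M x. \<exists>\<gamma>. app M F y \<gamma> \<and> G M w \<gamma>}"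
      proof (cases "x = X")
        case True
        then have "\<alpha> = A" using x(2) FX unfolding appE by blast
        then show ?thesis using A' True by simp
      next
        case False
        then have "app M F x \<alpha>" using x(2) unfolding appE by blast
        then show ?thesis by (rule recfun_els[OF rF])
      qed
      also have "\<dots> = {w\<in>U. \<exists>y\<in>els M x. \<exists>\<gamma>. app M E y \<gamma> \<and> G M w \<gamma>}"
        using appT sub by blast
      finally show "els M \<alpha> = {w\<in>U. \<exists>y\<in>els M x. \<exists>\<gamma>. app M E y \<gamma> \<and> G M w \<gamma>}" .
    qed
    moreover from upair_ex[OF E(1) T1(1)] obtain b where b: "b \<in> U" "els M b = {E, T1}" by (rule bexE)
    ultimately show ?thesis
      by (intro bexI[OF _ b(1)] bexI[of _ E] bexI[of _ T1]) (use T1(2) b(2) in simp_all)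
  qed
qed

definition val :: "'a \<Rightarrow> 'a" where
  "val x = (THE y. \<exists>f\<in>U. \<exists>t\<in>U. rf f t \<and> app M f x y)"

lemma val_app:
  assumes "rf f t" "f \<in> U" "t \<in> U" "x \<in> els M t"
  shows "app M f x y \<longleftrightarrow> y = val x"
proof -
  obtain z where z: "app M f x z" using recfun_ex_value[OF assms(1,4)] by blast
  have "val x = z" unfolding val_def
  proof (rule the_equality)
    show "\<exists>f\<in>U. \<exists>t\<in>U. rf f t \<and> app M f x z" using assms z by blast
    fix y assume "\<exists>f\<in>U. \<exists>t\<in>U. rf f t \<and> app M f x y"
    then obtain f' t' where f': "f' \<in> U" "t' \<in> U" "rf f' t'" "app M f' x y" by blast
    show "y = z" by (rule recfun_agree[OF f'(3) assms(1) f'(1,2) assms(2,3) f'(4) z])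
  qed
  then show ?thesis using z recfun_unique[OF assms(1) z] by blast
qed

lemma val_fun:
  assumes "x \<in> U"
  shows "\<exists>f\<in>U. \<exists>t\<in>U. rf f t \<and> trans_set M t \<and> x \<in> els M t \<and> (\<forall>y\<in>els M t. \<forall>z. app M f y z \<longleftrightarrow> z = val y)"
proof -
  from recfun_ex[OF assms] obtain b f t where b: "f \<in> els M b" "t \<in> els M b" "rf f t" "x \<in> els M t" by blast
  have u: "f \<in> U" "t \<in> U" using els_U b(1,2) by blast+
  have "trans_set M t" using b(3) unfolding recfun_def by blast
  then show ?thesis using b u val_app[OF b(3) u] by blast
qed

lemma val_els:
  assumes "x \<in> U"
  shows "val x \<in> U \<and> els M (val x) = {w\<in>U. \<exists>y\<in>els M x. G M w (val y)}"
proof -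
  from val_fun[OF assms] obtain f t where f: "f\<in>U" "t\<in>U" "rf f t" "trans_set M t" "x \<in> els M t"
    "\<forall>y\<in>els M t. \<forall>z. app M f y z \<longleftrightarrow> z = val y" by blast
  have a: "app M f x (val x)" using f(5,6) by blast
  have "app M f y \<gamma> \<longleftrightarrow> \<gamma> = val y" if "y \<in> els M x" for y \<gamma>
    using f(6) recfun_trans[OF f(3,5) that] by blast
  then have "els M (val x) = {w\<in>U. \<exists>y\<in>els M x. G M w (val y)}"
    unfolding recfun_els[OF f(3) a] by (simp cong: bex_cong)
  then show ?thesis using app_U[OF a] by blast
qed

end

section \<open>Ranks, ordinals and the cumulative hierarchy\<close>

text \<open>
  The two instances of the recursion. With \<open>G(\<gamma>) = \<gamma> \<union> {\<gamma>}\<close> it yields the rank, and with \<open>G(\<gamma>)\<close> the power set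
  of \<open>\<gamma>\<close> it yields \<open>x \<mapsto> V\<^sub>r\<close> for \<open>r\<close> the rank of \<open>x\<close>.
\<close>

definition rankG :: "'a str \<Rightarrow> 'a \<Rightarrow> 'a \<Rightarrow> bool" where
  "rankG M w \<gamma> \<longleftrightarrow> w \<in> els M \<gamma> \<or> w = \<gamma>"
definition rankH :: "'a str \<Rightarrow> 'a \<Rightarrow> 'a \<Rightarrow> bool" where
  "rankH M \<gamma> \<alpha> \<longleftrightarrow> els M \<gamma> \<subseteq> els M \<alpha> \<and> \<gamma> \<in> els M \<alpha>"
definition powG :: "'a str \<Rightarrow> 'a \<Rightarrow> 'a \<Rightarrow> bool" where
  "powG M w \<gamma> \<longleftrightarrow> els M w \<subseteq> els M \<gamma>"
definition powH :: "'a str \<Rightarrow> 'a \<Rightarrow> 'a \<Rightarrow> bool" where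
  "powH M \<gamma> \<alpha> \<longleftrightarrow> (\<forall>w\<in>univ M. els M w \<subseteq> els M \<gamma> \<longrightarrow> w \<in> els M \<alpha>)"

lemma Ord_iff: "a \<in> Ord M \<longleftrightarrow> a \<in> univ M \<and> trans_set M a \<and> (\<forall>x\<in>els M a. trans_set M x)"
  unfolding Ord_def transitive_in_def trans_set_def els_def by blast

context kpp
begin

lemma rank_rec: "kpp_rec M rankG rankH"
proof unfold_locales
  show "definable (\<lambda>M \<rho>. rankG M (\<rho> i) (\<rho> j))" for i j unfolding rankG_def by (intro definable_intros)
  show "definable (\<lambda>M \<rho>. rankH M (\<rho> i) (\<rho> j))" for i j unfolding rankH_def by (intro definable_intros)
  show "rankH M \<gamma> \<alpha> = (\<forall>w\<in>U. rankG M w \<gamma> \<longrightarrow> w \<in> els M \<alpha>)" if "\<gamma> \<in> U" for \<gamma> \<alpha>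
    using that els_U unfolding rankG_def rankH_def by blast
  show "\<exists>g\<in>U. els M g = {w \<in> U. rankG M w \<gamma>}" if g: "\<gamma> \<in> U" for \<gamma>
  proof -
    have "insert \<gamma> (els M \<gamma>) = {w \<in> U. rankG M w \<gamma>}" using g els_U unfolding rankG_def by blast
    then show ?thesis using insert_ex[OF g g] by simp
  qed
qed

lemma pow_rec: "kpp_rec M powG powH"
proof unfold_locales
  show "definable (\<lambda>M \<rho>. powG M (\<rho> i) (\<rho> j))" for i j unfolding powG_def by (intro definable_intros)
  show "definable (\<lambda>M \<rho>. powH M (\<rho> i) (\<rho> j))" for i j unfolding powH_def by (intro definable_intros)
  show "powH M \<gamma> \<alpha> = (\<forall>w\<in>U. powG M w \<gamma> \<longrightarrow> w \<in> els M \<alpha>)" if "\<gamma> \<in> U" for \<gamma> \<alpha>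
    unfolding powG_def powH_def by blast
  show "\<exists>g\<in>U. els M g = {w \<in> U. powG M w \<gamma>}" if g: "\<gamma> \<in> U" for \<gamma>
    using Pow_ex[OF g] unfolding powG_def .
qed

definition rk :: "'a \<Rightarrow> 'a" where "rk = kpp_rec.val M rankG rankH"
definition hier :: "'a \<Rightarrow> 'a" where "hier = kpp_rec.val M powG powH"

lemma rk_U: "x \<in> U \<Longrightarrow> rk x \<in> U"
  using kpp_rec.val_els[OF rank_rec] unfolding rk_def by blast

lemma rk_els: "x \<in> U \<Longrightarrow> els M (rk x) = {w\<in>U. \<exists>y\<in>els M x. w \<in> els M (rk y) \<or> w = rk y}"
  using kpp_rec.val_els[OF rank_rec] unfolding rk_def rankG_def by blast

lemma hier_els: "x \<in> U \<Longrightarrow> els M (hier x) = {w\<in>U. \<exists>y\<in>els M x. els M w \<subseteq> els M (hier y)}"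
  using kpp_rec.val_els[OF pow_rec] unfolding hier_def powG_def by blast

lemma rk_fun: "x \<in> U \<Longrightarrow> \<exists>f\<in>U. \<exists>t\<in>U. recfun rankG rankH M f t \<and> trans_set M t \<and> x \<in> els M t \<and> (\<forall>y\<in>els M t. \<forall>z. app M f y z \<longleftrightarrow> z = rk y)"
  using kpp_rec.val_fun[OF rank_rec] unfolding rk_def by blast

lemma rk_fun_on: "x \<in> U \<Longrightarrow> \<exists>f\<in>U. \<forall>y\<in>els M x. \<forall>z. app M f y z \<longleftrightarrow> z = rk y"
proof -
  assume "x \<in> U"
  from rk_fun[OF this] obtain f t where "f\<in>U" "trans_set M t" "x \<in> els M t" "\<forall>y\<in>els M t. \<forall>z. app M f y z \<longleftrightarrow> z = rk y" by blast
  then show ?thesis unfolding trans_set_def by (intro bexI[of _ f]) blast+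
qed

lemma hier_fun_on: "x \<in> U \<Longrightarrow> \<exists>f\<in>U. \<forall>y\<in>els M x. \<forall>z. app M f y z \<longleftrightarrow> z = hier y"
proof -
  assume "x \<in> U"
  from kpp_rec.val_fun[OF pow_rec this] obtain f t where "f\<in>U" "trans_set M t" "x \<in> els M t" "\<forall>y\<in>els M t. \<forall>z. app M f y z \<longleftrightarrow> z = hier y"
    unfolding hier_def by blast
  then show ?thesis unfolding trans_set_def by (intro bexI[of _ f]) blast+
qed

lemma trans_ex: "x \<in> U \<Longrightarrow> \<exists>t\<in>U. trans_set M t \<and> x \<in> els M t"
  using rk_fun by blast

lemma trans_els: "trans_set M t \<Longrightarrow> y \<in> els M x \<Longrightarrow> x \<in> els M t \<Longrightarrow> y \<in> els M t"
  unfolding trans_set_def by blast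

lemma Ord_U: "a \<in> Ord M \<Longrightarrow> a \<in> U"
  by (simp add: Ord_iff)

lemma Ord_trans: "a \<in> Ord M \<Longrightarrow> x \<in> els M a \<Longrightarrow> y \<in> els M x \<Longrightarrow> y \<in> els M a"
  unfolding Ord_iff trans_set_def by blast

lemma Ord_els: "a \<in> Ord M \<Longrightarrow> x \<in> els M a \<Longrightarrow> x \<in> Ord M"
  using Ord_trans[of a x] els_U[of x a] unfolding Ord_iff by blast

text \<open>
  If \<open>x\<close> is minimal incomparable to some ordinal, and \<open>y\<close> minimal incomparable to \<open>x\<close>, then \<open>x\<close> and \<open>y\<close> have the
  same elements.
\<close>

lemma Ord_linear:
  assumes a: "a \<in> Ord M" and b: "b \<in> Ord M"
  shows "a \<in> els M b \<or> a = b \<or> b \<in> els M a"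
proof -
  note aU = Ord_U[OF a] and bU = Ord_U[OF b]
  from insert_ex[OF aU aU] obtain ta where ta: "ta \<in> U" "els M ta = insert a (els M a)" by (rule bexE)
  from insert_ex[OF bU bU] obtain tb where tb: "tb \<in> U" "els M tb = insert b (els M b)" by (rule bexE)
  have tra: "trans_set M ta" using Ord_trans[OF a] unfolding trans_set_def ta(2) by blast
  have trb: "trans_set M tb" using Ord_trans[OF b] unfolding trans_set_def tb(2) by blast
  have oa: "x \<in> Ord M" if "x \<in> els M ta" for x using that a Ord_els[OF a] unfolding ta(2) by blast
  have ob: "x \<in> Ord M" if "x \<in> els M tb" for x using that b Ord_els[OF b] unfolding tb(2) by blast
  let ?P = "\<lambda>x. \<forall>y\<in>els M tb. x \<in> els M y \<or> x = y \<or> y \<in> els M x"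
  have "?P a"
  proof (rule trans_induct[where t=ta and P="?P"])
    show "\<exists>z\<in>U. els M z = {x \<in> els M ta. ?P x}"
      by (rule sep[where Q="\<lambda>M x a b c d e f. \<forall>y\<in>els M a. x \<in> els M y \<or> x = y \<or> y \<in> els M x", OF _ ta(1) tb(1) tb(1) tb(1) tb(1) tb(1) tb(1)])
        (intro definable_intros)
    show "a \<in> els M ta" by (simp add: ta)
    fix x assume x: "x \<in> els M ta" and IH: "\<And>z. z \<in> els M x \<Longrightarrow> ?P z"
    have xU: "x \<in> U" using els_U x .
    show "?P x"
    proof
      fix y assume "y \<in> els M tb"
      then show "x \<in> els M y \<or> x = y \<or> y \<in> els M x"
      proof (rule trans_induct[where t=tb and P="\<lambda>y. x \<in> els M y \<or> x = y \<or> y \<in> els M x", rotated 3])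
        show "\<exists>z\<in>U. els M z = {y \<in> els M tb. x \<in> els M y \<or> x = y \<or> y \<in> els M x}"
          by (rule sep[where Q="\<lambda>M y x b c d e f. x \<in> els M y \<or> x = y \<or> y \<in> els M x", OF _ tb(1) xU xU xU xU xU xU])
            (intro definable_intros)
        show "tb \<in> U" "trans_set M tb" by fact+
        fix y assume y: "y \<in> els M tb" and IHy: "\<And>z. z \<in> els M y \<Longrightarrow> x \<in> els M z \<or> x = z \<or> z \<in> els M x"
        show "x \<in> els M y \<or> x = y \<or> y \<in> els M x"
        proof (rule ccontr)
          assume no: "\<not> ?thesis"
          have "els M x \<subseteq> els M y"
          proof
            fix z assume z: "z \<in> els M x"
            have "z \<in> els M y \<or> z = y \<or> y \<in> els M z" using IH[OF z] y by blast
            then show "z \<in> els M y" using no z Ord_trans[OF oa[OF x] z] by blast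
          qed
          moreover have "els M y \<subseteq> els M x"
          proof
            fix z assume z: "z \<in> els M y"
            then show "z \<in> els M x" using IHy[OF z] no Ord_trans[OF ob[OF y] z] by blast
          qed
          ultimately have "x = y" using ext[OF xU els_U[OF y]] by blast
          then show False using no by blast
        qed
      qed
    qed
  qed (use ta tra in auto)
  then show ?thesis by (simp add: tb(2))
qed

text \<open>
  Induction for \<open>\<Delta>\<^sub>0\<^sup>P\<close> predicates of \<open>x\<close> and its rank: on a transitive set the rank function is a set, so it
  can be used as a parameter.
\<close>

lemma rk_ind:
  assumes "x \<in> U"
    and definable: "definable (\<lambda>M \<rho>. Q M (\<rho> 0) (\<rho> (Suc 0)))"
    and step: "\<And>x. x \<in> U \<Longrightarrow> (\<And>y. y \<in> els M x \<Longrightarrow> Q M y (rk y)) \<Longrightarrow> Q M x (rk x)"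
  shows "Q M x (rk x)"
proof -
  from trans_ex[OF assms(1)] obtain t where t: "t \<in> U" "trans_set M t" "x \<in> els M t" by blast
  from rk_fun_on[OF t(1)] obtain f where f: "f \<in> U" "\<forall>y\<in>els M t. \<forall>z. app M f y z \<longleftrightarrow> z = rk y" by blast
  have definable': "definable (\<lambda>M \<rho>. Q M (\<rho> i) (\<rho> j))" for i j
    using definable_subst[OF definable, of "\<lambda>n. if n = 0 then i else j"] by simp
  have "\<exists>z\<in>U. els M z = {x \<in> els M t. \<exists>y. app M f x y \<and> Q M x y}"
    by (rule sep[where Q="\<lambda>M x f b c d e g. \<exists>y. app M f x y \<and> Q M x y", OF _ t(1) f(1) f(1) f(1) f(1) f(1) f(1)])
      (intro definable_intros definable')
  moreover have "{x \<in> els M t. \<exists>y. app M f x y \<and> Q M x y} = {x \<in> els M t. Q M x (rk x)}" using f(2) by auto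
  ultimately have "\<exists>z\<in>U. els M z = {x \<in> els M t. Q M x (rk x)}" by simp
  then show ?thesis
    by (rule trans_induct[where P="\<lambda>x. Q M x (rk x)", OF _ t]) (rule step[OF els_U])
qed

lemma rk_Ord: "x \<in> U \<Longrightarrow> rk x \<in> Ord M"
proof -
  assume x: "x \<in> U"
  have "trans_set M (rk x) \<and> (\<forall>y\<in>els M (rk x). trans_set M y)"
  proof (rule rk_ind[where Q="\<lambda>M x r. trans_set M r \<and> (\<forall>y\<in>els M r. trans_set M y)", OF x])
    show "definable (\<lambda>M \<rho>. trans_set M (\<rho> (Suc 0)) \<and> (\<forall>y\<in>els M (\<rho> (Suc 0)). trans_set M y))"
      by (intro definable_intros)
    fix x assume x: "x \<in> U" and IH: "\<And>y. y \<in> els M x \<Longrightarrow> trans_set M (rk y) \<and> (\<forall>z\<in>els M (rk y). trans_set M z)"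
    have 1: "trans_set M z" if "z \<in> els M (rk x)" for z using that IH unfolding rk_els[OF x] by blast
    have "w \<in> els M (rk x)" if z: "z \<in> els M (rk x)" "w \<in> els M z" for z w
    proof -
      obtain y where y: "y \<in> els M x" "z \<in> els M (rk y) \<or> z = rk y" using z(1) unfolding rk_els[OF x] by blast
      have "w \<in> els M (rk y)" using y(2) z(2) IH[OF y(1)] unfolding trans_set_def by blast
      then show ?thesis unfolding rk_els[OF x] using y(1) els_U[OF z(2)] by blast
    qed
    then show "trans_set M (rk x) \<and> (\<forall>z\<in>els M (rk x). trans_set M z)" using 1 unfolding trans_set_def by blast
  qed
  then show ?thesis using rk_U[OF x] by (simp add: Ord_iff)
qed

lemma rk_mono: "x \<in> U \<Longrightarrow> y \<in> els M x \<Longrightarrow> rk y \<in> els M (rk x)"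
  using rk_els[of x] rk_U[OF els_U[of y x]] by blast

lemma rk_less_iff: "x \<in> U \<Longrightarrow> w \<in> els M (rk x) \<Longrightarrow> \<exists>y\<in>els M x. w \<in> els M (rk y) \<or> w = rk y"
  using rk_els[of x] by blast

lemma rk_subset: "x \<in> U \<Longrightarrow> y \<in> U \<Longrightarrow> els M x \<subseteq> els M y \<Longrightarrow> rk x \<in> els M (rk y) \<or> rk x = rk y"
proof -
  assume xy: "x \<in> U" "y \<in> U" "els M x \<subseteq> els M y"
  have "els M (rk x) \<subseteq> els M (rk y)" unfolding rk_els[OF xy(1)] rk_els[OF xy(2)] using xy(3) by blast
  then show ?thesis using Ord_linear[OF rk_Ord[OF xy(1)] rk_Ord[OF xy(2)]] irrefl[OF rk_U[OF xy(2)]] by blast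
qed

lemma rk_of_Ord: "a \<in> Ord M \<Longrightarrow> rk a = a"
proof -
  assume a: "a \<in> Ord M"
  have "a \<in> Ord M \<longrightarrow> rk a = a"
  proof -
    have "trans_set M a \<and> (\<forall>x\<in>els M a. trans_set M x) \<longrightarrow> a = rk a"
    proof (rule rk_ind[where Q="\<lambda>M x r. trans_set M x \<and> (\<forall>y\<in>els M x. trans_set M y) \<longrightarrow> x = r", OF Ord_U[OF a]])
      show "definable (\<lambda>M \<rho>. trans_set M (\<rho> 0) \<and> (\<forall>y\<in>els M (\<rho> 0). trans_set M y) \<longrightarrow> \<rho> 0 = \<rho> (Suc 0))"
        by (intro definable_intros)
      fix x assume x: "x \<in> U" and IH: "\<And>y. y \<in> els M x \<Longrightarrow> trans_set M y \<and> (\<forall>z\<in>els M y. trans_set M z) \<longrightarrow> y = rk y"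
      show "trans_set M x \<and> (\<forall>y\<in>els M x. trans_set M y) \<longrightarrow> x = rk x"
      proof
        assume t: "trans_set M x \<and> (\<forall>y\<in>els M x. trans_set M y)"
        then have o: "x \<in> Ord M" using x by (simp add: Ord_iff)
        have eq: "rk y = y" if "y \<in> els M x" for y using IH[OF that] Ord_els[OF o that] by (simp add: Ord_iff)
        have "els M (rk x) = els M x"
        proof (intro set_eqI iffI)
          fix w assume "w \<in> els M (rk x)"
          then obtain y where y: "y \<in> els M x" "w \<in> els M (rk y) \<or> w = rk y" unfolding rk_els[OF x] by blast
          show "w \<in> els M x" using y(2) Ord_trans[OF o y(1)] y(1) unfolding eq[OF y(1)] by blast
        next
          fix w assume w: "w \<in> els M x"
          show "w \<in> els M (rk x)" using rk_mono[OF x w] unfolding eq[OF w] .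
        qed
        then show "x = rk x" using ext[OF x rk_U[OF x]] by simp
      qed
    qed
    then show ?thesis unfolding Ord_iff by simp
  qed
  then show ?thesis using a by blast
qed

lemma succ_ex: "a \<in> Ord M \<Longrightarrow> \<exists>s\<in>Ord M. els M s = insert a (els M a)"
proof -
  assume a: "a \<in> Ord M"
  from insert_ex[OF Ord_U[OF a] Ord_U[OF a]] obtain s where s: "s \<in> U" "els M s = insert a (els M a)" by (rule bexE)
  have "s \<in> Ord M" using a s(1) unfolding Ord_iff s(2) unfolding trans_set_def s(2) by blast
  then show ?thesis using s(2) by blast
qed

text \<open>
  An element \<open>z\<close> with \<open>rk z < rk x\<close> has \<open>rk z \<le> rk y\<close> for some \<open>y \<in> x\<close>; by induction all elements of \<open>z\<close> lie in
  \<open>hier y\<close>, so \<open>z\<close> belongs to its power set. This bounds the class of sets of rank below an ordinal, which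
  is all that is needed to separate \<open>V\<^sub>\<alpha>\<close>.
\<close>

lemma rk_less_hier:
  assumes z: "z \<in> U" and x: "x \<in> U" and less: "rk z \<in> els M (rk x)"
  shows "z \<in> els M (hier x)"
proof -
  from trans_ex[OF z] obtain tz where tz: "tz \<in> U" "trans_set M tz" "z \<in> els M tz" by blast
  from trans_ex[OF x] obtain tx where tx: "tx \<in> U" "trans_set M tx" "x \<in> els M tx" by blast
  from Un_ex[OF tz(1) tx(1)] obtain t where t: "t \<in> U" "els M t = els M tz \<union> els M tx" by (rule bexE)
  from rk_fun_on[OF t(1)] obtain f where f: "f \<in> U" "\<forall>y\<in>els M t. \<forall>z. app M f y z \<longleftrightarrow> z = rk y" by (rule bexE)
  from hier_fun_on[OF tx(1)] obtain g where g: "g \<in> U" "\<forall>y\<in>els M tx. \<forall>z. app M g y z \<longleftrightarrow> z = hier y" by (rule bexE)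
  let ?P = "\<lambda>y. \<forall>z\<in>els M tz. rk z \<in> els M (rk y) \<longrightarrow> z \<in> els M (hier y)"
  have "?P x"
  proof (rule trans_induct[where P="?P", OF _ tx])
    have "\<exists>Y\<in>U. els M Y = {y\<in>els M tx. \<forall>z\<in>els M tz. \<forall>rz. app M f z rz \<longrightarrow> (\<forall>ry. app M f y ry \<longrightarrow> (\<forall>wy. app M g y wy \<longrightarrow> (rz \<in> els M ry \<longrightarrow> z \<in> els M wy)))}"
      by (rule sep[where Q="\<lambda>M y tz f g d e h. \<forall>z\<in>els M tz. \<forall>rz. app M f z rz \<longrightarrow> (\<forall>ry. app M f y ry \<longrightarrow> (\<forall>wy. app M g y wy \<longrightarrow> (rz \<in> els M ry \<longrightarrow> z \<in> els M wy)))",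
          OF _ tx(1) tz(1) f(1) g(1) g(1) g(1) g(1)]) (intro definable_intros)
    moreover have "{y\<in>els M tx. \<forall>z\<in>els M tz. \<forall>rz. app M f z rz \<longrightarrow> (\<forall>ry. app M f y ry \<longrightarrow> (\<forall>wy. app M g y wy \<longrightarrow> (rz \<in> els M ry \<longrightarrow> z \<in> els M wy)))}
        = {y\<in>els M tx. ?P y}"
      using f(2) g(2) unfolding t(2) by auto
    ultimately show "\<exists>Y\<in>U. els M Y = {y\<in>els M tx. ?P y}" by simp
    fix y assume y: "y \<in> els M tx" and IH: "\<And>y'. y' \<in> els M y \<Longrightarrow> ?P y'"
    have yU: "y \<in> U" using els_U y .
    show "?P y"
    proof (intro ballI impI)
      fix z assume z: "z \<in> els M tz" and l: "rk z \<in> els M (rk y)"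
      have zU: "z \<in> U" using els_U z .
      from rk_less_iff[OF yU l] obtain y' where y': "y' \<in> els M y" "rk z \<in> els M (rk y') \<or> rk z = rk y'" by blast
      have "els M z \<subseteq> els M (hier y')"
      proof
        fix v assume v: "v \<in> els M z"
        have "rk v \<in> els M (rk z)" by (rule rk_mono[OF zU v])
        then have "rk v \<in> els M (rk y')" using y'(2) Ord_trans[OF rk_Ord[OF els_U[OF y'(1)]]] by metis
        then show "v \<in> els M (hier y')" using IH[OF y'(1)] trans_els[OF tz(2) v z] by blast
      qed
      then show "z \<in> els M (hier y)" unfolding hier_els[OF yU] using y'(1) zU by blast
    qed
  qed
  then show ?thesis using less tz(3) by blast
qed

lemma V_ex: "a \<in> Ord M \<Longrightarrow> \<exists>v\<in>U. els M v = {x\<in>U. rk x \<in> els M a}"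
proof -
  assume a: "a \<in> Ord M"
  have aU: "a \<in> U" using Ord_U a .
  have hU: "hier a \<in> U" using kpp_rec.val_els[OF pow_rec aU] unfolding hier_def by blast
  from rk_fun_on[OF hU] obtain f where f: "f \<in> U" "\<forall>y\<in>els M (hier a). \<forall>z. app M f y z \<longleftrightarrow> z = rk y" by (rule bexE)
  have "\<exists>Y\<in>U. els M Y = {y\<in>els M (hier a). \<exists>r. app M f y r \<and> r \<in> els M a}"
    by (rule sep[where Q="\<lambda>M y f a b d e h. \<exists>r. app M f y r \<and> r \<in> els M a",
          OF _ hU f(1) aU aU aU aU aU]) (intro definable_intros)
  moreover have "{y\<in>els M (hier a). \<exists>r. app M f y r \<and> r \<in> els M a} = {x\<in>U. rk x \<in> els M a}"
  proof -
    have "y \<in> els M (hier a)" if "y \<in> U" "rk y \<in> els M a" for y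
      using rk_less_hier[OF that(1) aU] that(2) rk_of_Ord[OF a] by simp
    then have "{x\<in>U. rk x \<in> els M a} = {x\<in>els M (hier a). rk x \<in> els M a}" using els_U by blast
    then show ?thesis using f(2) by auto
  qed
  ultimately show ?thesis by simp
qed

lemma is_upair_iff: "a \<in> U \<Longrightarrow> b \<in> U \<Longrightarrow> is_upair M a b p \<longleftrightarrow> p \<in> U \<and> els M p = {a, b}"
  unfolding is_upair_def els_def by blast

lemma is_opair_iff: "a \<in> U \<Longrightarrow> b \<in> U \<Longrightarrow> is_opair M a b p \<longleftrightarrow> p \<in> U \<and> opr M a b p"
proof -
  assume ab: "a \<in> U" "b \<in> U"
  have "is_opair M a b p \<longleftrightarrow> p \<in> U \<and> (\<exists>u\<in>U. \<exists>w\<in>U. els M u = {a} \<and> els M w = {a, b} \<and> els M p = {u, w})"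
    unfolding is_opair_def using is_upair_iff[OF ab(1) ab(1)] is_upair_iff[OF ab] is_upair_iff
    by (auto cong: bex_cong)
  also have "\<dots> \<longleftrightarrow> p \<in> U \<and> opr M a b p"
  proof -
    have "u \<in> els M p \<and> w \<in> els M p" if "els M p = {u, w}" for u w using that by simp
    then show ?thesis unfolding opr_def using els_U by blast
  qed
  finally show ?thesis .
qed

lemma app_in_iff: "x \<in> U \<Longrightarrow> y \<in> U \<Longrightarrow> app_in M f x y \<longleftrightarrow> app M f x y"
  unfolding app_in_def app_def using is_opair_iff[of x y] by (auto simp: els_def)

lemma transitive_in_iff: "transitive_in M t \<longleftrightarrow> trans_set M t"
  unfolding transitive_in_def trans_set_def els_def by blast

lemma is_function_on_iff: "is_function_on M f t \<longleftrightarrow>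
     (\<forall>p\<in>els M f. \<exists>x y. opr M x y p \<and> x \<in> els M t) \<and>
     (\<forall>x\<in>els M t. \<exists>y. app M f x y \<and> (\<forall>y'. app M f x y' \<longrightarrow> y' = y))"
proof -
  have 1: "(\<exists>x\<in>U. \<exists>y\<in>U. mem M x t \<and> is_opair M x y p) \<longleftrightarrow> (\<exists>x y. opr M x y p \<and> x \<in> els M t)" if "p \<in> U" for p
    using is_opair_iff[of _ _ p] opr_U[of _ _ p] that unfolding els_def by blast
  have 2: "(\<exists>!y. y \<in> U \<and> app_in M f x y) \<longleftrightarrow> (\<exists>y. app M f x y \<and> (\<forall>y'. app M f x y' \<longrightarrow> y' = y))" if x: "x \<in> U" for x
  proof -
    have "y \<in> U \<and> app_in M f x y \<longleftrightarrow> app M f x y" for y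
      using app_in_iff[OF x, of y f] app_pr[of f x y] by blast
    then show ?thesis by auto
  qed
  show ?thesis unfolding is_function_on_def using 1 2 by (auto simp: els_def)
qed

lemma is_rank_function_iff: "is_rank_function M f t \<longleftrightarrow> recfun rankG rankH M f t"
proof -
  have A: "app_in M f x y \<longleftrightarrow> app M f x y" if "x \<in> U" "y \<in> U" for x y using app_in_iff that .
  have aU: "x \<in> U \<and> y \<in> U" if "app M f x y" for x y using that app_pr by blast
  have "(\<forall>x\<in>U. \<forall>\<alpha>\<in>U. mem M x t \<and> app_in M f x \<alpha> \<longrightarrow>
        (\<forall>w\<in>U. mem M w \<alpha> \<longleftrightarrow>
           (\<exists>y\<in>U. \<exists>\<gamma>\<in>U. mem M y x \<and> app_in M f y \<gamma> \<and> (mem M w \<gamma> \<or> w = \<gamma>)))) \<longleftrightarrow>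
     (\<forall>x\<in>els M t. \<forall>\<alpha>. app M f x \<alpha> \<longrightarrow>
        (\<forall>w\<in>U. w \<in> els M \<alpha> \<longleftrightarrow> (\<exists>y\<in>els M x. \<exists>\<gamma>. app M f y \<gamma> \<and> (w \<in> els M \<gamma> \<or> w = \<gamma>))))" (is "?L \<longleftrightarrow> ?R")
  proof -
    have in_els: "w \<in> els M z \<longleftrightarrow> mem M w z" if "w \<in> U" for w z using that by (simp add: els_def)
    have inner: "(\<exists>y\<in>U. \<exists>\<gamma>\<in>U. mem M y x \<and> app_in M f y \<gamma> \<and> (mem M w \<gamma> \<or> w = \<gamma>)) \<longleftrightarrow>
       (\<exists>y\<in>els M x. \<exists>\<gamma>. app M f y \<gamma> \<and> (w \<in> els M \<gamma> \<or> w = \<gamma>))" if w: "w \<in> U" for w x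
      using A aU in_els[OF w] els_U[of _ x] in_els by metis
    show ?thesis
    proof
      assume L: ?L
      show ?R
      proof (intro ballI allI impI)
        fix x \<alpha> w assume h: "x \<in> els M t" "app M f x \<alpha>" and w: "w \<in> U"
        have u: "x \<in> U" "\<alpha> \<in> U" using aU[OF h(2)] by auto
        have h': "mem M x t \<and> app_in M f x \<alpha>" using h unfolding A[OF u] in_els[OF u(1)] by (rule conjI)
        show "w \<in> els M \<alpha> \<longleftrightarrow> (\<exists>y\<in>els M x. \<exists>\<gamma>. app M f y \<gamma> \<and> (w \<in> els M \<gamma> \<or> w = \<gamma>))"
          using L[rule_format, OF u h' w] unfolding inner[OF w] in_els[OF w] .
      qed
    next
      assume R: ?R
      show ?L
      proof (intro ballI allI impI)
        fix x \<alpha> w assume u: "x \<in> U" "\<alpha> \<in> U" and h: "mem M x t \<and> app_in M f x \<alpha>" and w: "w \<in> U"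
        have h': "x \<in> els M t" "app M f x \<alpha>" using h A[OF u] in_els[OF u(1)] by auto
        show "mem M w \<alpha> \<longleftrightarrow> (\<exists>y\<in>U. \<exists>\<gamma>\<in>U. mem M y x \<and> app_in M f y \<gamma> \<and> (mem M w \<gamma> \<or> w = \<gamma>))"
          using R[rule_format, OF h' w] unfolding inner[OF w] in_els[OF w] .
      qed
    qed
  qed
  also have "\<dots> \<longleftrightarrow> (\<forall>x\<in>els M t. \<forall>\<alpha>. app M f x \<alpha> \<longrightarrow>
        (\<forall>w\<in>els M \<alpha>. \<exists>y\<in>els M x. \<exists>\<gamma>. app M f y \<gamma> \<and> rankG M w \<gamma>) \<and>
        (\<forall>y\<in>els M x. \<forall>\<gamma>. app M f y \<gamma> \<longrightarrow> rankH M \<gamma> \<alpha>))"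
  proof -
    have "(\<forall>w\<in>U. w \<in> els M \<alpha> \<longleftrightarrow> (\<exists>y\<in>els M x. \<exists>\<gamma>. app M f y \<gamma> \<and> (w \<in> els M \<gamma> \<or> w = \<gamma>))) \<longleftrightarrow>
      (\<forall>w\<in>els M \<alpha>. \<exists>y\<in>els M x. \<exists>\<gamma>. app M f y \<gamma> \<and> rankG M w \<gamma>) \<and>
        (\<forall>y\<in>els M x. \<forall>\<gamma>. app M f y \<gamma> \<longrightarrow> rankH M \<gamma> \<alpha>)" (is "?L \<longleftrightarrow> ?R1 \<and> ?R2") for x \<alpha>
    proof
      assume L: ?L
      have ?R1 using L els_U unfolding rankG_def by blast
      moreover have ?R2 unfolding rankH_def using L els_U aU by blast
      ultimately show "?R1 \<and> ?R2" by blast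
    next
      assume R: "?R1 \<and> ?R2"
      show ?L
      proof (intro ballI iffI)
        fix w assume "w \<in> els M \<alpha>"
        then show "\<exists>y\<in>els M x. \<exists>\<gamma>. app M f y \<gamma> \<and> (w \<in> els M \<gamma> \<or> w = \<gamma>)" using R unfolding rankG_def by blast
      next
        fix w assume "\<exists>y\<in>els M x. \<exists>\<gamma>. app M f y \<gamma> \<and> (w \<in> els M \<gamma> \<or> w = \<gamma>)"
        then show "w \<in> els M \<alpha>" using R unfolding rankH_def by blast
      qed
    qed
    then show ?thesis by simp
  qed
  finally show ?thesis unfolding is_rank_function_def recfun_def transitive_in_iff is_function_on_iff by (simp only: conj_assoc)
qed

lemma is_rank_iff: "x \<in> U \<Longrightarrow> is_rank M x \<alpha> \<longleftrightarrow> \<alpha> = rk x"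
proof -
  assume x: "x \<in> U"
  interpret r: kpp_rec M rankG rankH by (rule rank_rec)
  show ?thesis
  proof
    assume "is_rank M x \<alpha>"
    then obtain t f where t: "t\<in>U" "f\<in>U" "mem M x t" "recfun rankG rankH M f t" "app_in M f x \<alpha>" "\<alpha> \<in> U"
      unfolding is_rank_def is_rank_function_iff by blast
    have "app M f x \<alpha>" using t(5) app_in_iff[OF x t(6)] by blast
    then show "\<alpha> = rk x" using r.val_app[OF t(4) t(2) t(1), of x \<alpha>] t(3) x unfolding rk_def els_def by blast
  next
    assume a: "\<alpha> = rk x"
    from rk_fun[OF x] obtain f t where f: "f\<in>U" "t\<in>U" "recfun rankG rankH M f t" "x \<in> els M t"
      "\<forall>y\<in>els M t. \<forall>z. app M f y z \<longleftrightarrow> z = rk y" by blast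
    have "app M f x \<alpha>" using f(4,5) a by blast
    then have "app_in M f x \<alpha>" using app_in_iff[OF x rk_U[OF x]] a by blast
    moreover have "mem M x t" using f(4) by (simp add: els_def)
    ultimately show "is_rank M x \<alpha>"
      unfolding is_rank_def is_rank_function_iff using f(1-3) rk_U[OF x] a by blast
  qed
qed

lemma rank_le_iff: "x \<in> U \<Longrightarrow> y \<in> U \<Longrightarrow> rank_le M x y \<longleftrightarrow> rk x \<in> els M (rk y) \<or> rk x = rk y"
  unfolding rank_le_def using is_rank_iff rk_U[of x] by (auto simp: els_def)

lemma below_iff: "x \<in> below M a \<longleftrightarrow> x \<in> U \<and> rk x \<in> els M a"
  unfolding below_def using is_rank_iff[of x] rk_U[of x] by (auto simp: els_def)

lemma is_V_iff: "is_V M a v \<longleftrightarrow> v \<in> U \<and> els M v = {x\<in>U. rk x \<in> els M a}"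
proof -
  have "below M a = {x\<in>U. rk x \<in> els M a}" using below_iff by blast
  then show ?thesis unfolding is_V_def els_def[of M v] by simp
qed

end

section \<open>Topless cuts\<close>

locale kpp_cut = kpp M for M :: "'a str" +
  fixes S :: "'a set"
  assumes SU: "S \<subseteq> U"
    and S_rank: "\<And>x y. x \<in> U \<Longrightarrow> y \<in> S \<Longrightarrow> rk x \<in> els M (rk y) \<or> rk x = rk y \<Longrightarrow> x \<in> S"
    and S_bound: "\<exists>\<alpha>\<in>Ord M. \<forall>x\<in>S. rk x \<in> els M \<alpha>"
    and S_nomin: "\<not> (\<exists>\<alpha>\<in>Ord M - S. \<forall>\<gamma>\<in>Ord M - S. \<alpha> = \<gamma> \<or> \<alpha> \<in> els M \<gamma>)"
begin

lemma S_U: "x \<in> S \<Longrightarrow> x \<in> U" using SU by blast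

lemma S_els: "y \<in> S \<Longrightarrow> x \<in> els M y \<Longrightarrow> x \<in> S"
  using S_rank[of x y] els_U[of x y] rk_mono[OF S_U] by blast

lemma S_rk: "x \<in> S \<Longrightarrow> rk x \<in> S"
  using S_rank[of "rk x" x] rk_U[OF S_U] rk_of_Ord[OF rk_Ord[OF S_U]] by metis

lemma Ord_out: "\<alpha> \<in> Ord M \<Longrightarrow> \<alpha> \<notin> S \<Longrightarrow> x \<in> S \<Longrightarrow> rk x \<in> els M \<alpha>"
proof (rule ccontr)
  assume a: "\<alpha> \<in> Ord M" "\<alpha> \<notin> S" "x \<in> S" "rk x \<notin> els M \<alpha>"
  then have "rk x = \<alpha> \<or> \<alpha> \<in> els M (rk x)" using Ord_linear[OF rk_Ord[OF S_U] a(1), of x] by blast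
  then show False using a(2) S_rk[OF a(3)] S_els by metis
qed

lemma S_empty: "z \<in> U \<Longrightarrow> els M z = {} \<Longrightarrow> z \<in> S"
proof (rule ccontr)
  assume z: "z \<in> U" "els M z = {}" "z \<notin> S"
  have o: "z \<in> Ord M" using z by (simp add: Ord_iff trans_set_def)
  have "z = \<gamma> \<or> z \<in> els M \<gamma>" if "\<gamma> \<in> Ord M" for \<gamma> using Ord_linear[OF o that] z(2) by blast
  then show False using S_nomin o z(3) by blast
qed

text \<open>
  A successor of an ordinal of \<open>S\<close> outside \<open>S\<close> would be the least ordinal outside \<open>S\<close>.
\<close>

lemma S_succ: "a \<in> Ord M \<Longrightarrow> a \<in> S \<Longrightarrow> s \<in> Ord M \<Longrightarrow> els M s = insert a (els M a) \<Longrightarrow> s \<in> S"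
proof (rule ccontr)
  assume a: "a \<in> Ord M" "a \<in> S" "s \<in> Ord M" "els M s = insert a (els M a)" "s \<notin> S"
  have "s = \<gamma> \<or> s \<in> els M \<gamma>" if g: "\<gamma> \<in> Ord M - S" for \<gamma>
  proof (rule ccontr)
    assume "\<not> ?thesis"
    then have "\<gamma> \<in> els M s" using Ord_linear[OF a(3), of \<gamma>] g by blast
    then show False using g a(2) S_els[OF a(2)] unfolding a(4) by blast
  qed
  then show False using S_nomin a(3,5) by blast
qed

lemma S_upair: "x \<in> S \<Longrightarrow> y \<in> S \<Longrightarrow> z \<in> U \<Longrightarrow> els M z = {x, y} \<Longrightarrow> z \<in> S"
proof -
  assume a: "x \<in> S" "y \<in> S" "z \<in> U" "els M z = {x, y}"
  note ox = rk_Ord[OF S_U[OF a(1)]] and oy = rk_Ord[OF S_U[OF a(2)]]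
  obtain m where m: "m \<in> S" "m \<in> Ord M" "rk x \<in> els M m \<or> rk x = m" "rk y \<in> els M m \<or> rk y = m"
    using Ord_linear[OF ox oy] S_rk a(1,2) ox oy by metis
  obtain s where s: "s \<in> Ord M" "els M s = insert m (els M m)" using succ_ex[OF m(2)] by (rule bexE)
  have sS: "s \<in> S" by (rule S_succ[OF m(2,1) s])
  have "rk x \<in> els M s" "rk y \<in> els M s" using m s(2) by auto
  then have "els M (rk z) \<subseteq> els M s"
    unfolding rk_els[OF a(3)] a(4) using Ord_trans[OF s(1)] by blast
  then have "rk z \<in> els M s \<or> rk z = s"
    using Ord_linear[OF rk_Ord[OF a(3)] s(1)] irrefl[OF Ord_U[OF s(1)]] by blast
  then show ?thesis using S_rank[OF a(3) sS] unfolding rk_of_Ord[OF s(1)] by blast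
qed

lemma S_pr: "x \<in> S \<Longrightarrow> y \<in> S \<Longrightarrow> pr x y \<in> S"
proof -
  assume a: "x \<in> S" "y \<in> S"
  have p: "pr x y \<in> U" "opr M x y (pr x y)" using pr[OF S_U[OF a(1)] S_U[OF a(2)]] by blast+
  obtain u w where u: "u \<in> els M (pr x y)" "w \<in> els M (pr x y)" "els M u = {x}" "els M w = {x, y}" "els M (pr x y) = {u, w}"
    using p(2) unfolding opr_def by blast
  have "u \<in> S" by (rule S_upair[OF a(1,1) els_U[OF u(1)]]) (simp add: u(3))
  moreover have "w \<in> S" by (rule S_upair[OF a els_U[OF u(2)] u(4)])
  ultimately show ?thesis by (rule S_upair[OF _ _ p(1) u(5)])
qed

text \<open>
  If \<open>Z\<close> contains ordinals below \<open>\<alpha>\<close>, its least one lies outside \<open>S\<close>; as \<open>S\<close> is topless there is a smaller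
  ordinal outside \<open>S\<close>, and that one is not in \<open>Z\<close>.
\<close>

lemma overspill:
  assumes \<alpha>: "\<alpha> \<in> Ord M" "\<alpha> \<notin> S" and Z: "Z \<in> U" "\<And>\<sigma>. \<sigma> \<in> S \<Longrightarrow> \<sigma> \<in> Ord M \<Longrightarrow> \<sigma> \<notin> els M Z"
  shows "\<exists>\<sigma>\<in>Ord M. \<sigma> \<notin> S \<and> \<sigma> \<in> els M \<alpha> \<and> \<sigma> \<notin> els M Z"
proof -
  have aU: "\<alpha> \<in> U" using \<alpha>(1) by (rule Ord_U)
  have below: "\<exists>\<gamma>\<in>Ord M. \<gamma> \<notin> S \<and> \<gamma> \<in> els M \<beta>" if b: "\<beta> \<in> Ord M" "\<beta> \<notin> S" for \<beta>
  proof (rule ccontr)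
    assume no: "\<not> ?thesis"
    have "\<beta> = \<gamma> \<or> \<beta> \<in> els M \<gamma>" if "\<gamma> \<in> Ord M - S" for \<gamma>
      using Ord_linear[OF b(1), of \<gamma>] that no by blast
    then show False using S_nomin b by blast
  qed
  obtain Y where Y: "Y \<in> U" "els M Y = {\<sigma>\<in>els M Z. \<sigma> \<in> els M \<alpha>}"
    by (rule bexE[OF sep[where Q="\<lambda>M x a b c d e f. x \<in> els M a", OF _ Z(1) aU aU aU aU aU aU]]) (intro definable_intros, rule that)
  show ?thesis
  proof (cases "els M Y = {}")
    case True
    obtain \<gamma> where "\<gamma>\<in>Ord M" "\<gamma> \<notin> S" "\<gamma> \<in> els M \<alpha>" using below[OF \<alpha>] by blast
    then show ?thesis using True unfolding Y(2) by blast
  next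
    case False
    obtain \<sigma> where s: "\<sigma> \<in> els M Y" "els M \<sigma> \<inter> els M Y = {}" using foundation[OF Y(1) False] by blast
    have sa: "\<sigma> \<in> els M \<alpha>" "\<sigma> \<in> els M Z" using s(1) unfolding Y(2) by blast+
    have so: "\<sigma> \<in> Ord M" by (rule Ord_els[OF \<alpha>(1) sa(1)])
    then have "\<sigma> \<notin> S" using Z(2) sa(2) by blast
    then obtain \<gamma> where g: "\<gamma>\<in>Ord M" "\<gamma> \<notin> S" "\<gamma> \<in> els M \<sigma>" using below[OF so] by blast
    have "\<gamma> \<in> els M \<alpha>" by (rule Ord_trans[OF \<alpha>(1) sa(1) g(3)])
    moreover have "\<gamma> \<notin> els M Z" using s(2) g(3) calculation unfolding Y(2) by blast
    ultimately show ?thesis using g by blast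
  qed
qed

lemma Ord_out_ex: "\<exists>\<alpha>\<in>Ord M. \<alpha> \<notin> S"
proof -
  obtain \<alpha> where a: "\<alpha>\<in>Ord M" "\<forall>x\<in>S. rk x \<in> els M \<alpha>" using S_bound by (rule bexE)
  have "\<alpha> \<notin> S" using a(2) rk_of_Ord[OF a(1)] irrefl[OF Ord_U[OF a(1)]] by force
  then show ?thesis using a(1) by blast
qed

lemma S_cover: "\<exists>v\<in>U. S \<subseteq> els M v"
proof -
  obtain \<alpha> where a: "\<alpha>\<in>Ord M" "\<forall>x\<in>S. rk x \<in> els M \<alpha>" using S_bound by (rule bexE)
  obtain v where v: "v\<in>U" "els M v = {x\<in>U. rk x \<in> els M \<alpha>}" using V_ex[OF a(1)] by (rule bexE)
  have "S \<subseteq> els M v" unfolding v(2) using a(2) SU by blast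
  then show ?thesis using v(1) by blast
qed

end

lemma kpp_cutI:
  assumes "models M KPP" "rank_initial_substructure S M" "topless_substructure S M"
  shows "kpp_cut M (univ S)"
proof -
  interpret kpp M by unfold_locales fact
  have SU: "univ S \<subseteq> univ M" using assms(2) unfolding rank_initial_substructure_def substructure_def by blast
  show ?thesis
  proof unfold_locales
    show "univ S \<subseteq> U" by (rule SU)
    fix x y assume x: "x \<in> U" and y: "y \<in> univ S" and r: "rk x \<in> els M (rk y) \<or> rk x = rk y"
    have "rank_le M x (id y)" unfolding id_def using rank_le_iff[OF x, of y] SU y r by blast
    then have "x \<in> id ` univ S" using assms(2) x y unfolding rank_initial_substructure_def rank_initial_def by blast
    then show "x \<in> univ S" by simp
  next
    obtain \<alpha> where a: "\<alpha>\<in>Ord M" "id ` univ S \<subseteq> below M \<alpha>"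
      using assms(3) unfolding topless_substructure_def topless_def by blast
    then show "\<exists>\<alpha>\<in>Ord M. \<forall>x\<in>univ S. rk x \<in> els M \<alpha>" using below_iff by auto
  next
    have "\<not> (\<exists>\<alpha>\<in>Ord M - id ` univ S. \<forall>\<gamma>\<in>Ord M - id ` univ S. \<alpha> = \<gamma> \<or> mem M \<alpha> \<gamma>)"
      using assms(3) unfolding topless_substructure_def topless_def by blast
    then show "\<not> (\<exists>\<alpha>\<in>Ord M - univ S. \<forall>\<gamma>\<in>Ord M - univ S. \<alpha> = \<gamma> \<or> \<alpha> \<in> els M \<gamma>)"
      by (auto simp: els_def)
  qed
qed

section \<open>The truth game\<close>

text \<open>
  Zermelo numerals. They belong to every cut and are used both as tags of codes and as names of the
  entries of an assignment. The formula \<open>y \<noteq> y\<close> stands for falsity.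
\<close>

primrec is_num :: "nat \<Rightarrow> 'a str \<Rightarrow> 'a \<Rightarrow> bool" where
  "is_num 0 M x \<longleftrightarrow> (\<forall>y\<in>els M x. y \<noteq> y)"
| "is_num (Suc n) M x \<longleftrightarrow> (\<exists>y\<in>els M x. els M x = {y} \<and> is_num n M y)"

lemma definable_is_num: "definable (\<lambda>M \<rho>. is_num n M (\<rho> i))"
proof (induction n arbitrary: i)
  case 0
  show ?case unfolding is_num.simps by (intro definable_intros)
next
  case (Suc n)
  show ?case unfolding is_num.simps by (intro definable_intros Suc)
qed

lemma is_num_inj: "is_num m M x \<Longrightarrow> is_num n M x \<Longrightarrow> m = n"
proof (induction m arbitrary: n x)
  case 0
  then show ?case by (cases n) auto
next
  case (Suc m)
  then show ?case by (cases n) auto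
qed

text \<open>
  \<open>a'\<close> is \<open>a \<union> {(k, b)}\<close>. The pair is required to be new so that \<open>a\<close> can be recovered from \<open>a'\<close>.
\<close>

definition extends :: "'a str \<Rightarrow> 'a \<Rightarrow> 'a \<Rightarrow> 'a \<Rightarrow> 'a \<Rightarrow> bool" where
  "extends M a k b a' \<longleftrightarrow> \<not> app M a k b \<and> app M a' k b \<and> els M a \<subseteq> els M a' \<and>
     (\<forall>p\<in>els M a'. p \<in> els M a \<or> opr M k b p)"

text \<open>
  A position consists of a code \<open>e\<close>, an assignment \<open>a\<close> and a bound \<open>w\<close> for witnesses; \<open>T\<close> is a set of triples
  \<open>(e, (a, w))\<close>. Allowing a smaller bound \<open>w'\<close> makes acceptance monotone in \<open>w\<close>.
\<close>

definition accepts :: "'a str \<Rightarrow> 'a \<Rightarrow> 'a \<Rightarrow> 'a \<Rightarrow> 'a \<Rightarrow> bool" where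
  "accepts M T e a w \<longleftrightarrow> (\<exists>y. app M T e y \<and> (\<exists>a' w'. opr M a' w' y \<and> a' = a \<and> els M w' \<subseteq> els M w))"

text \<open>
  Acceptance after adding \<open>(k, b)\<close> to the assignment, or removing \<open>(k, v)\<close> from it. Assignments are read off
  from \<open>T\<close>, which keeps the quantifiers bounded.
\<close>

definition accepts_ext :: "'a str \<Rightarrow> 'a \<Rightarrow> 'a \<Rightarrow> 'a \<Rightarrow> 'a \<Rightarrow> 'a \<Rightarrow> 'a \<Rightarrow> bool" where
  "accepts_ext M T e a k b w \<longleftrightarrow> (\<exists>y. app M T e y \<and> (\<exists>a' w'. opr M a' w' y \<and> extends M a k b a' \<and> els M w' \<subseteq> els M w))"

definition accepts_drop :: "'a str \<Rightarrow> 'a \<Rightarrow> 'a \<Rightarrow> 'a \<Rightarrow> 'a \<Rightarrow> 'a \<Rightarrow> bool" where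
  "accepts_drop M T e a k v \<longleftrightarrow> (\<exists>y. app M T e y \<and> (\<exists>a' w'. opr M a' w' y \<and> extends M a' k v a \<and> els M w' \<subseteq> els M v))"

text \<open>
  When a code \<open>(n, x)\<close> holds of the assignment \<open>a\<close> with bound \<open>w\<close>, given the positions in \<open>T\<close>:
  \<^item> \<open>0\<close> and \<open>1\<close>: for \<open>x = (j, k)\<close>, entry \<open>j\<close> is, or is not, an element of entry \<open>k\<close>;
  \<^item> \<open>2\<close>: for \<open>x = (j, s)\<close>, entry \<open>j\<close> is \<open>s\<close>;
  \<^item> \<open>3\<close>: for \<open>x = (k, E)\<close>, some \<open>b \<in> w\<close>, added under the name \<open>k\<close>, satisfies all codes in \<open>E\<close>;
  \<^item> \<open>4\<close>: for \<open>x = ((j, k), E)\<close>, every element and every subset \<open>b\<close> of entry \<open>j\<close>, added under the name \<open>k\<close>,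
    satisfies some code in \<open>E\<close>;
  \<^item> \<open>5\<close>: for \<open>x = (k, e)\<close>, entry \<open>k\<close> is transitive and, once it is removed, \<open>e\<close> holds with entry \<open>k\<close> as the bound.
  
  Codes \<open>3\<close>, \<open>4\<close> and \<open>5\<close> are what the steps forth, back and split transfer. Since \<open>E\<close> is an arbitrary set,
  these are infinitary conjunctions and disjunctions, and a whole type is a single code.
\<close>

definition clause :: "nat \<Rightarrow> 'a str \<Rightarrow> 'a \<Rightarrow> 'a \<Rightarrow> 'a \<Rightarrow> 'a \<Rightarrow> bool" where
  "clause n M T x a w \<longleftrightarrow>
     (n = 0 \<and> (\<exists>j k. opr M j k x \<and> (\<exists>u. app M a j u \<and> (\<exists>v. app M a k v \<and> u \<in> els M v)))) \<or>
     (n = 1 \<and> (\<exists>j k. opr M j k x \<and> (\<exists>u. app M a j u \<and> (\<exists>v. app M a k v \<and> u \<notin> els M v)))) \<or>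
     (n = 2 \<and> x \<in> els M a) \<or>
     (n = 3 \<and> (\<exists>k E. opr M k E x \<and> (\<exists>b\<in>els M w. \<forall>e\<in>els M E. accepts_ext M T e a k b w))) \<or>
     (n = 4 \<and> (\<exists>q E. opr M q E x \<and> (\<exists>j k. opr M j k q \<and> (\<exists>y. app M a j y \<and>
        (\<forall>b\<in>univ M. b \<in> els M y \<or> els M b \<subseteq> els M y \<longrightarrow> (\<exists>e\<in>els M E. accepts_ext M T e a k b w)))))) \<or>
     (n = 5 \<and> (\<exists>k e. opr M k e x \<and> (\<exists>v. app M a k v \<and> trans_set M v \<and> accepts_drop M T e a k v)))"

definition justified :: "'a str \<Rightarrow> 'a \<Rightarrow> 'a \<Rightarrow> 'a \<Rightarrow> 'a \<Rightarrow> bool" where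
  "justified M T e a w \<longleftrightarrow> (\<exists>c x. opr M c x e \<and> (\<exists>n<6. is_num n M c \<and> clause n M T x a w))"

definition sound :: "'a str \<Rightarrow> 'a \<Rightarrow> bool" where
  "sound M T \<longleftrightarrow> (\<forall>t\<in>els M T. \<forall>e y. opr M e y t \<longrightarrow> (\<forall>a w. opr M a w y \<longrightarrow> justified M T e a w))"

lemma definable_ex_less:
  fixes k :: nat
  assumes "\<And>n. definable (P n)"
  shows "definable (\<lambda>M \<rho>. \<exists>n<k. P n M \<rho>)"
proof (induction k)
  case 0
  show ?case using definable_const[of False] by simp
next
  case (Suc k)
  have "definable (\<lambda>M \<rho>. (\<exists>n<k. P n M \<rho>) \<or> P k M \<rho>)" by (rule definable_or[OF Suc assms])
  then show ?case by (simp add: less_Suc_eq ex_disj_distrib conj_disj_distribR disj_commute)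
qed

lemma definable_rall:
  assumes "definable (\<lambda>M \<rho>. Q M (\<rho> 0) (\<lambda>n. \<rho> (Suc n)))"
  shows "definable (\<lambda>M \<rho>. \<forall>a\<in>univ M. a \<in> els M (\<rho> i) \<or> els M a \<subseteq> els M (\<rho> i) \<longrightarrow> Q M a \<rho>)"
proof -
  have "definable (\<lambda>M \<rho>. (\<forall>a\<in>els M (\<rho> i). Q M a \<rho>) \<and> (\<forall>a\<in>univ M. els M a \<subseteq> els M (\<rho> i) \<longrightarrow> Q M a \<rho>))"
    by (intro definable_intros assms)
  moreover have "(\<forall>a\<in>els M (\<rho> i). Q M a \<rho>) \<and> (\<forall>a\<in>univ M. els M a \<subseteq> els M (\<rho> i) \<longrightarrow> Q M a \<rho>) \<longleftrightarrow>
     (\<forall>a\<in>univ M. a \<in> els M (\<rho> i) \<or> els M a \<subseteq> els M (\<rho> i) \<longrightarrow> Q M a \<rho>)" for M \<rho>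
    unfolding els_def by blast
  ultimately show ?thesis by simp
qed

lemma definable_extends: "definable (\<lambda>M \<rho>. extends M (\<rho> i) (\<rho> j) (\<rho> k) (\<rho> l))"
  unfolding extends_def by (intro definable_intros)

lemma definable_accepts: "definable (\<lambda>M \<rho>. accepts M (\<rho> i) (\<rho> j) (\<rho> k) (\<rho> l))"
  unfolding accepts_def by (intro definable_intros)

lemma definable_accepts_ext: "definable (\<lambda>M \<rho>. accepts_ext M (\<rho> i) (\<rho> j) (\<rho> k) (\<rho> l) (\<rho> m) (\<rho> n))"
  unfolding accepts_ext_def by (intro definable_intros definable_extends)

lemma definable_accepts_drop: "definable (\<lambda>M \<rho>. accepts_drop M (\<rho> i) (\<rho> j) (\<rho> k) (\<rho> l) (\<rho> m))"
  unfolding accepts_drop_def by (intro definable_intros definable_extends)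

lemma definable_clause: "definable (\<lambda>M \<rho>. clause n M (\<rho> i) (\<rho> j) (\<rho> k) (\<rho> l))"
  unfolding clause_def by (intro definable_intros definable_rall definable_accepts_ext definable_accepts_drop definable_const)

lemma definable_justified: "definable (\<lambda>M \<rho>. justified M (\<rho> i) (\<rho> j) (\<rho> k) (\<rho> l))"
  unfolding justified_def by (intro definable_intros definable_ex_less definable_is_num definable_clause)

lemma definable_sound: "definable (\<lambda>M \<rho>. sound M (\<rho> i))"
  unfolding sound_def by (intro definable_intros definable_justified)

lemma app_mono: "els M T \<subseteq> els M T' \<Longrightarrow> app M T x y \<Longrightarrow> app M T' x y"
  unfolding app_def by blast

lemma accepts_mono: "accepts M T e a w \<Longrightarrow> els M T \<subseteq> els M T' \<Longrightarrow> els M w \<subseteq> els M w' \<Longrightarrow> accepts M T' e a w'"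
  unfolding accepts_def using app_mono[of M T T'] by (meson subset_trans)

lemma accepts_ext_iff: "accepts_ext M T e a k b w \<longleftrightarrow> (\<exists>a'. extends M a k b a' \<and> accepts M T e a' w)"
  unfolding accepts_ext_def accepts_def by metis

lemma accepts_drop_iff: "accepts_drop M T e a k v \<longleftrightarrow> (\<exists>a'. extends M a' k v a \<and> accepts M T e a' v)"
  unfolding accepts_drop_def accepts_def by metis

lemma accepts_ext_mono: "accepts_ext M T e a k b w \<Longrightarrow> els M T \<subseteq> els M T' \<Longrightarrow> els M w \<subseteq> els M w' \<Longrightarrow> accepts_ext M T' e a k b w'"
  unfolding accepts_ext_iff using accepts_mono by metis

lemma clause_mono:
  assumes b: "clause n M T x a w" and T: "els M T \<subseteq> els M T'" and w: "els M w \<subseteq> els M w'"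
  shows "clause n M T' x a w'"
proof -
  have E: "accepts_ext M T' e a k b w'" if "accepts_ext M T e a k b w" for e k b using accepts_ext_mono[OF that T w] .
  have D: "accepts_drop M T' e a k v" if "accepts_drop M T e a k v" for e k v using that accepts_mono[OF _ T] unfolding accepts_drop_iff by blast
  have h3: "(\<exists>k E. opr M k E x \<and> (\<exists>b\<in>els M w. \<forall>e\<in>els M E. accepts_ext M T e a k b w)) \<Longrightarrow>
      (\<exists>k E. opr M k E x \<and> (\<exists>b\<in>els M w'. \<forall>e\<in>els M E. accepts_ext M T' e a k b w'))"
    using E w by (elim exE conjE bexE) (intro exI conjI bexI ballI; blast)
  have h4: "(\<exists>q E. opr M q E x \<and> (\<exists>j k. opr M j k q \<and> (\<exists>y. app M a j y \<and>
        (\<forall>b\<in>univ M. b \<in> els M y \<or> els M b \<subseteq> els M y \<longrightarrow> (\<exists>e\<in>els M E. accepts_ext M T e a k b w))))) \<Longrightarrow>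
     (\<exists>q E. opr M q E x \<and> (\<exists>j k. opr M j k q \<and> (\<exists>y. app M a j y \<and>
        (\<forall>b\<in>univ M. b \<in> els M y \<or> els M b \<subseteq> els M y \<longrightarrow> (\<exists>e\<in>els M E. accepts_ext M T' e a k b w')))))"
    using E by meson
  have h5: "(\<exists>k e. opr M k e x \<and> (\<exists>v. app M a k v \<and> trans_set M v \<and> accepts_drop M T e a k v)) \<Longrightarrow>
     (\<exists>k e. opr M k e x \<and> (\<exists>v. app M a k v \<and> trans_set M v \<and> accepts_drop M T' e a k v))"
    using D by meson
  show ?thesis using b h3 h4 h5 unfolding clause_def by argo
qed

lemma justified_mono: "justified M T e a w \<Longrightarrow> els M T \<subseteq> els M T' \<Longrightarrow> els M w \<subseteq> els M w' \<Longrightarrow> justified M T' e a w'"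
  unfolding justified_def using clause_mono[of _ M T _ a w T' w'] by meson

lemma accepts_justified:
  assumes s: "sound M T" and i: "accepts M T e a w"
  shows "justified M T e a w"
proof -
  obtain y w' where y: "app M T e y" "opr M a w' y" "els M w' \<subseteq> els M w" using i unfolding accepts_def by blast
  then obtain t where "t \<in> els M T" "opr M e y t" unfolding app_def by blast
  then have "justified M T e a w'" using s y(2) unfolding sound_def by blast
  then show ?thesis by (rule justified_mono[OF _ subset_refl y(3)])
qed

context kpp
begin

lemma justified_clause: "opr M c x e \<Longrightarrow> is_num n M c \<Longrightarrow> n < 6 \<Longrightarrow> justified M T e a w \<longleftrightarrow> clause n M T x a w"
proof -
  assume o: "opr M c x e" and n: "is_num n M c" "n < 6"
  show ?thesis
  proof
    assume "justified M T e a w"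
    then obtain c' x' m where m: "opr M c' x' e" "is_num m M c'" "clause m M T x' a w" unfolding justified_def by blast
    have "c' = c" "x' = x" using opr_inj[OF m(1) o] by blast+
    then show "clause n M T x a w" using is_num_inj[OF n(1)] m(2,3) by blast
  next
    assume "clause n M T x a w"
    then show "justified M T e a w" unfolding justified_def using o n by blast
  qed
qed

lemma sound_Union:
  assumes T: "els M T = (\<Union>t\<in>C. els M t)" and "\<And>t. t \<in> C \<Longrightarrow> sound M t"
  shows "sound M T"
  unfolding sound_def
proof (intro ballI allI impI)
  fix t e y a w assume h: "t \<in> els M T" "opr M e y t" "opr M a w y"
  obtain t' where t': "t' \<in> C" "t \<in> els M t'" using h(1) unfolding T by blast
  have "justified M t' e a w" using assms(2)[OF t'(1)] t'(2) h(2,3) unfolding sound_def by blast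
  then show "justified M T e a w" by (rule justified_mono) (use T t' in auto)
qed

text \<open>
  Adding a justified position to a sound set keeps it sound.
\<close>

lemma truth_intro:
  assumes T: "T \<in> U" "sound M T" and s: "justified M T e a w" and u: "e \<in> U" "a \<in> U" "w \<in> U"
  shows "\<exists>T'\<in>U. sound M T' \<and> accepts M T' e a w"
proof -
  have q: "pr a w \<in> U" "opr M a w (pr a w)" using pr u by blast+
  have p: "pr e (pr a w) \<in> U" "opr M e (pr a w) (pr e (pr a w))" using pr[OF u(1) q(1)] by blast+
  from insert_ex[OF p(1) T(1)] obtain T' where T': "T' \<in> U" "els M T' = insert (pr e (pr a w)) (els M T)" by (rule bexE)
  have sub: "els M T \<subseteq> els M T'" unfolding T'(2) by blast
  have "sound M T'" unfolding sound_def
  proof (intro ballI allI impI)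
    fix t e1 y a1 w1 assume h: "t \<in> els M T'" "opr M e1 y t" "opr M a1 w1 y"
    consider "t = pr e (pr a w)" | "t \<in> els M T" using h(1) unfolding T'(2) by blast
    then have "justified M T e1 a1 w1"
    proof cases
      case 1
      have "e1 = e" "y = pr a w" using opr_inj[OF h(2)] p(2) 1 by blast+
      moreover have "a1 = a" "w1 = w" using opr_inj[OF h(3)] q(2) calculation by blast+
      ultimately show ?thesis using s by simp
    next
      case 2
      then show ?thesis using T(2) h(2,3) unfolding sound_def by blast
    qed
    then show "justified M T' e1 a1 w1" using justified_mono[OF _ sub] by blast
  qed
  moreover have "app M T' e (pr a w)" unfolding app_def T'(2) using p(2) by blast
  then have "accepts M T' e a w" unfolding accepts_def using q(2) by blast
  ultimately show ?thesis using T'(1) by blast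
qed

text \<open>
  Soundness passes to unions, so Collection turns separate witnesses for the elements of \<open>X\<close> into a common
  one.
\<close>

lemma collect_truth:
  assumes definable: "definable (\<lambda>M \<rho>. Q M (\<rho> 0) (\<rho> (Suc 0)) (\<rho> 2) (\<rho> 3)
      (\<rho> 4) (\<rho> 5))"
    and X: "X \<in> U" and p: "p \<in> U" "q \<in> U" "r \<in> U"
    and ex: "\<And>x. x \<in> els M X \<Longrightarrow> \<exists>T\<in>U. \<exists>w\<in>U. sound M T \<and> Q M x T w p q r"
    and mono: "\<And>x T T' w w'. Q M x T w p q r \<Longrightarrow> els M T \<subseteq> els M T' \<Longrightarrow> els M w \<subseteq> els M w' \<Longrightarrow> Q M x T' w' p q r"
  shows "\<exists>T\<in>U. \<exists>w\<in>U. sound M T \<and> (\<forall>x\<in>els M X. Q M x T w p q r)"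
proof -
  have definable': "definable (\<lambda>M \<rho>. Q M (\<rho> i0) (\<rho> i1) (\<rho> i2) (\<rho> i3) (\<rho> i4) (\<rho> i5))" for i0 i1 i2 i3 i4 i5
    using definable_subst[OF definable, of "\<lambda>n. [i0,i1,i2,i3,i4,i5] ! n"] by simp
  have "\<exists>B\<in>U. \<forall>u\<in>els M X. \<exists>v\<in>els M B. \<exists>T\<in>els M v. \<exists>w\<in>els M v. sound M T \<and> Q M u T w p q r"
  proof (rule coll[where Q="\<lambda>M v u p q r d e f. \<exists>T\<in>els M v. \<exists>w\<in>els M v. sound M T \<and> Q M u T w p q r", OF _ X p p])
    show "definable (\<lambda>M \<rho>. \<exists>T\<in>els M (\<rho> 0). \<exists>w\<in>els M (\<rho> 0). sound M T \<and> Q M (\<rho> (Suc 0)) T w (\<rho> 2)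
       (\<rho> 3) (\<rho> 4))"
      by (intro definable_intros definable_sound definable')
    fix x assume "x \<in> els M X"
    from ex[OF this] obtain T w where T: "T\<in>U" "w\<in>U" "sound M T" "Q M x T w p q r" by blast
    from upair_ex[OF T(1,2)] obtain v where v: "v \<in> U" "els M v = {T, w}" by (rule bexE)
    show "\<exists>v\<in>U. \<exists>T\<in>els M v. \<exists>w\<in>els M v. sound M T \<and> Q M x T w p q r"
      by (rule bexI[OF _ v(1)], rule bexI[of _ T], rule bexI[of _ w]) (use T v(2) in simp_all)
  qed
  then obtain B where B: "B\<in>U" "\<forall>u\<in>els M X. \<exists>v\<in>els M B. \<exists>T\<in>els M v. \<exists>w\<in>els M v. sound M T \<and> Q M u T w p q r" by (rule bexE)
  from Union_ex[OF B(1)] obtain UB where UB: "UB \<in> U" "els M UB = (\<Union>b\<in>els M B. els M b)" by (rule bexE)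
  from Union_ex[OF UB(1)] obtain w where w: "w \<in> U" "els M w = (\<Union>b\<in>els M UB. els M b)" by (rule bexE)
  obtain C where C: "C \<in> U" "els M C = {T\<in>els M UB. sound M T}"
    by (rule bexE[OF sep[where Q="\<lambda>M u a b c d e f. sound M u", OF _ UB(1) p p]]) (intro definable_sound, rule that)
  from Union_ex[OF C(1)] obtain T where T: "T \<in> U" "els M T = (\<Union>b\<in>els M C. els M b)" by (rule bexE)
  have s: "sound M T" by (rule sound_Union[OF T(2)]) (use C(2) in blast)
  have "Q M x T w p q r" if x: "x \<in> els M X" for x
  proof -
    obtain v T' w' where v: "v\<in>els M B" "T'\<in>els M v" "w'\<in>els M v" "sound M T'" "Q M x T' w' p q r"
      using bspec[OF B(2) x] by blast
    have "T' \<in> els M UB" "w' \<in> els M UB" using v(1-3) unfolding UB(2) by blast+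
    moreover have "T' \<in> els M C" using calculation(1) v(4) unfolding C(2) by simp
    ultimately have "els M T' \<subseteq> els M T" "els M w' \<subseteq> els M w" unfolding T(2) w(2) by blast+
    then show ?thesis by (rule mono[OF v(5)])
  qed
  then show ?thesis using s T(1) w(1) by blast
qed

lemma snoc_collect:
  "{f i ((l @ [b]) ! i) |i. i < length (l @ [b])} = insert (f (length l) b) {f i (l ! i) |i. i < length l}"
proof -
  have i: "{f i ((l @ [b]) ! i) |i. i < length (l @ [b])} = (\<lambda>i. f i ((l @ [b]) ! i)) ` insert (length l) {..<length l}"
  proof -
    have "{i. i < length (l @ [b])} = insert (length l) {..<length l}" by auto
    then show ?thesis unfolding setcompr_eq_image by (rule arg_cong)
  qed
  have "(\<lambda>i. f i ((l @ [b]) ! i)) ` {..<length l} = (\<lambda>i. f i (l ! i)) ` {..<length l}"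
    by (rule image_cong) (simp_all add: nth_append)
  also have "\<dots> = {f i (l ! i) |i. i < length l}" by blast
  finally show ?thesis unfolding i by simp
qed

definition nm :: "nat \<Rightarrow> 'a" where "nm n = (THE x. x \<in> U \<and> is_num n M x)"

lemma is_num_unique: "x \<in> U \<Longrightarrow> y \<in> U \<Longrightarrow> is_num n M x \<Longrightarrow> is_num n M y \<Longrightarrow> x = y"
proof (induction n arbitrary: x y)
  case 0
  then show ?case using ext[of x y] by auto
next
  case (Suc n)
  obtain x' where x': "x' \<in> els M x" "els M x = {x'}" "is_num n M x'" using Suc.prems(3) by auto
  obtain y' where y': "y' \<in> els M y" "els M y = {y'}" "is_num n M y'" using Suc.prems(4) by auto
  have "x' = y'" by (rule Suc.IH[OF els_U[OF x'(1)] els_U[OF y'(1)] x'(3) y'(3)])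
  then show ?case using ext[OF Suc.prems(1,2)] x'(2) y'(2) by simp
qed

lemma is_num_ex: "\<exists>x\<in>U. is_num n M x"
proof (induction n)
  case 0
  show ?case using empty_ex by auto
next
  case (Suc n)
  then obtain x where x: "x\<in>U" "is_num n M x" by blast
  from upair_ex[OF x(1) x(1)] obtain z where "z\<in>U" "els M z = {x, x}" by (rule bexE)
  then show ?case using x(2) by (intro bexI[of _ z]) auto
qed

lemma nm: "nm n \<in> U \<and> is_num n M (nm n)"
proof -
  obtain x where x: "x\<in>U \<and> is_num n M x" using is_num_ex by blast
  show ?thesis unfolding nm_def by (rule theI[of _ x]) (use x is_num_unique in auto)
qed

lemma nm_inj: "nm i = nm j \<longleftrightarrow> i = j"
  using nm is_num_inj by metis

text \<open>
  The assignment that gives the \<open>i\<close>-th entry of \<open>l\<close> the numeral \<open>i\<close> as its name.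
\<close>

definition asg :: "'a list \<Rightarrow> 'a" where
  "asg l = (THE a. a \<in> U \<and> els M a = {pr (nm i) (l ! i) |i. i < length l})"

lemma asg: "set l \<subseteq> U \<Longrightarrow> asg l \<in> U \<and> els M (asg l) = {pr (nm i) (l ! i) |i. i < length l}"
proof -
  assume l: "set l \<subseteq> U"
  have "\<exists>a\<in>U. els M a = {pr (nm i) (l ! i) |i. i < length l}" using l
  proof (induction l rule: rev_induct)
    case Nil
    then show ?case using empty_ex by simp
  next
    case (snoc b l)
    then obtain a where a: "a\<in>U" "els M a = {pr (nm i) (l ! i) |i. i < length l}" by auto
    have "pr (nm (length l)) b \<in> U" using pr[of "nm (length l)" b] nm snoc.prems by simp
    from insert_ex[OF this a(1)] obtain a' where a': "a' \<in> U" "els M a' = insert (pr (nm (length l)) b) (els M a)" by (rule bexE)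
    have "els M a' = {pr (nm i) ((l @ [b]) ! i) |i. i < length (l @ [b])}"
      unfolding a'(2) a(2) by (rule snoc_collect[symmetric])
    then show ?case using a'(1) by blast
  qed
  then obtain a where a: "a \<in> U \<and> els M a = {pr (nm i) (l ! i) |i. i < length l}" by blast
  show ?thesis unfolding asg_def
  proof (rule theI[of _ a], rule a)
    fix x assume x: "x \<in> U \<and> els M x = {pr (nm i) (l ! i) |i. i < length l}"
    show "x = a" by (rule ext) (simp_all only: x a)
  qed
qed

lemma asg_app: "set l \<subseteq> U \<Longrightarrow> app M (asg l) (nm i) v \<longleftrightarrow> i < length l \<and> v = l ! i"
proof -
  assume l: "set l \<subseteq> U"
  have lj: "l ! j \<in> U" if "j < length l" for j using l that by (meson nth_mem subsetD)
  have nU: "nm j \<in> U" for j using nm by blast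
  show ?thesis
  proof
    assume a: "app M (asg l) (nm i) v"
    then have "v \<in> U" "pr (nm i) v \<in> els M (asg l)" unfolding app_pr by blast+
    then obtain j where j: "j < length l" "pr (nm i) v = pr (nm j) (l ! j)" using asg[OF l] by auto
    then have "nm i = nm j \<and> v = l ! j" using pr_inj[OF nU \<open>v \<in> U\<close> nU lj[OF j(1)]] by blast
    then show "i < length l \<and> v = l ! i" using j(1) by (simp add: nm_inj)
  next
    assume i: "i < length l \<and> v = l ! i"
    then have "pr (nm i) v \<in> els M (asg l)" using asg[OF l] by auto
    then show "app M (asg l) (nm i) v" unfolding app_pr using i lj nU by blast
  qed
qed

lemma extends_iff: "k \<in> U \<Longrightarrow> b \<in> U \<Longrightarrow> extends M a k b a' \<longleftrightarrow> pr k b \<notin> els M a \<and> els M a' = insert (pr k b) (els M a)"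
proof -
  assume u: "k \<in> U" "b \<in> U"
  have 1: "app M z k b \<longleftrightarrow> pr k b \<in> els M z" for z unfolding app_pr using u by blast
  have 2: "opr M k b p \<longleftrightarrow> p = pr k b" if "p \<in> els M z" for p z using opr_pr[OF els_U[OF that]] u by blast
  show ?thesis unfolding extends_def 1 using 2 by blast
qed

lemma asg_fresh: "set l \<subseteq> U \<Longrightarrow> b \<in> U \<Longrightarrow> pr (nm (length l)) b \<notin> els M (asg l)"
  using asg_app[of l "length l" b] nm unfolding app_pr by blast

lemma asg_snoc_els: "set l \<subseteq> U \<Longrightarrow> b \<in> U \<Longrightarrow> els M (asg (l @ [b])) = insert (pr (nm (length l)) b) (els M (asg l))"
proof -
  assume l: "set l \<subseteq> U" "b \<in> U"
  have "set (l @ [b]) \<subseteq> U" using l by simp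
  then have "els M (asg (l @ [b])) = {pr (nm i) ((l @ [b]) ! i) |i. i < length (l @ [b])}" using asg by blast
  also have "\<dots> = insert (pr (nm (length l)) b) {pr (nm i) (l ! i) |i. i < length l}"
    by (rule snoc_collect)
  finally show ?thesis using asg[OF l(1)] by simp
qed

lemma asg_extends: "set l \<subseteq> U \<Longrightarrow> b \<in> U \<Longrightarrow> a' \<in> U \<Longrightarrow> extends M (asg l) (nm (length l)) b a' \<longleftrightarrow> a' = asg (l @ [b])"
proof -
  assume l: "set l \<subseteq> U" "b \<in> U" "a' \<in> U"
  have nU: "nm j \<in> U" for j using nm by blast
  have aU: "asg (l @ [b]) \<in> U" using asg[of "l @ [b]"] l by simp
  show ?thesis unfolding extends_iff[OF nU l(2)] asg_snoc_els[OF l(1,2), symmetric]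
    using asg_fresh[OF l(1,2)] ext[OF l(3) aU] by blast
qed

lemma asg_drop: "set l \<subseteq> U \<Longrightarrow> b \<in> U \<Longrightarrow> a' \<in> U \<Longrightarrow> extends M a' (nm (length l)) b (asg (l @ [b])) \<longleftrightarrow> a' = asg l"
proof -
  assume l: "set l \<subseteq> U" "b \<in> U" "a' \<in> U"
  have nU: "nm j \<in> U" for j using nm by blast
  have aU: "asg l \<in> U" using asg[OF l(1)] by simp
  have "pr (nm (length l)) b \<notin> els M a' \<and> insert (pr (nm (length l)) b) (els M (asg l)) = insert (pr (nm (length l)) b) (els M a')
    \<longleftrightarrow> els M a' = els M (asg l)"
    using asg_fresh[OF l(1,2)] by (auto simp: insert_ident)
  also have "\<dots> \<longleftrightarrow> a' = asg l" using ext[OF l(3) aU] by blast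
  finally show ?thesis unfolding extends_iff[OF nU l(2)] asg_snoc_els[OF l(1,2)] .
qed

lemma accepts_U: "accepts M T e a w \<Longrightarrow> a \<in> U"
  unfolding accepts_def using opr_U by blast

lemma accepts_ext_asg: "set l \<subseteq> U \<Longrightarrow> b \<in> U \<Longrightarrow> accepts_ext M T e (asg l) (nm (length l)) b w \<longleftrightarrow> accepts M T e (asg (l @ [b])) w"
  unfolding accepts_ext_iff using asg_extends accepts_U by metis

lemma accepts_drop_asg: "set l \<subseteq> U \<Longrightarrow> b \<in> U \<Longrightarrow> accepts_drop M T e (asg (l @ [b])) (nm (length l)) b \<longleftrightarrow> accepts M T e (asg l) b"
  unfolding accepts_drop_iff using asg_drop accepts_U by metis

end

section \<open>Back-and-forth between two models\<close>

lemma (in kpp) sigma_sep: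
  assumes sig: "models M (Separation (SigmaP 1))"
    and definable: "definable (\<lambda>M \<rho>. Q M (\<rho> 0) (\<rho> (Suc 0)) (\<rho> 2) (\<rho> 3)
      (\<rho> 4) (\<rho> 5) (\<rho> 6))"
    and "X \<in> U" "a \<in> U" "b \<in> U" "c \<in> U" "d \<in> U" "e \<in> U"
  shows "\<exists>Y\<in>U. els M Y = {u \<in> els M X. \<exists>x\<in>U. Q M x u a b c d e}"
proof -
  obtain \<phi> where \<phi>: "\<phi>\<in>Delta0P" "\<forall>M \<rho>. sat M \<rho> \<phi> \<longleftrightarrow> Q M (\<rho> 0) (\<rho> (Suc 0)) (\<rho> 2) (\<rho> 3)
      (\<rho> 4) (\<rho> 5) (\<rho> 6)"
    using definable unfolding definable_def by metis
  have Ex: "Ex 0 \<phi> \<in> SigmaP 1" using \<phi>(1) by auto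
  have "\<exists>Y\<in>U. els M Y = {u \<in> els M X. sat M ((case_nat X (case_nat X (case_nat a (case_nat b (case_nat c (case_nat d (\<lambda>_. e)))))))(Suc 0 := u)) (Ex 0 \<phi>)}"
    by (rule separation_sat[OF sig subset_refl Ex]) (use assms in \<open>auto simp: range_case_nat\<close>)
  then show ?thesis by (simp add: \<phi>(2) case_nat_upd)
qed

lemma (in kpp) rk_le_Ord:
  assumes x: "x \<in> U" and s: "\<sigma> \<in> Ord M" and sub: "\<And>y. y \<in> els M x \<Longrightarrow> rk y \<in> els M \<sigma>"
  shows "rk x \<in> els M \<sigma> \<or> rk x = \<sigma>"
proof -
  have "els M (rk x) \<subseteq> els M \<sigma>"
  proof
    fix w assume "w \<in> els M (rk x)"
    from rk_less_iff[OF x this] obtain y where y: "y \<in> els M x" "w \<in> els M (rk y) \<or> w = rk y" by (rule bexE)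
    then show "w \<in> els M \<sigma>" using sub[OF y(1)] Ord_trans[OF s] by blast
  qed
  then show ?thesis using Ord_linear[OF rk_Ord[OF x] s] irrefl[OF Ord_U[OF s]] by blast
qed

text \<open>
  The part of a set of rank below an ordinal of \<open>S\<close> is an element of \<open>S\<close>, although the set itself may be
  outside.
\<close>

lemma (in kpp_cut) S_small:
  assumes x: "x \<in> U" and s: "\<sigma> \<in> Ord M" "\<sigma> \<in> S" and sub: "\<And>y. y \<in> els M x \<Longrightarrow> rk y \<in> els M \<sigma>"
  shows "x \<in> S"
  using S_rank[OF x s(2)] rk_le_Ord[OF x s(1) sub] unfolding rk_of_Ord[OF s(1)] by blast

lemma (in kpp) below_set:
  assumes c: "c \<in> U" and s: "\<sigma> \<in> U"
  shows "\<exists>E\<in>U. els M E = {e \<in> els M c. rk e \<in> els M \<sigma>}"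
proof -
  from rk_fun_on[OF c] obtain r where r: "r\<in>U" "\<forall>y\<in>els M c. \<forall>z. app M r y z \<longleftrightarrow> z = rk y" by (rule bexE)
  have "\<exists>E\<in>U. els M E = {e \<in> els M c. \<exists>\<gamma>. app M r e \<gamma> \<and> \<gamma> \<in> els M \<sigma>}"
    by (rule sep[where Q="\<lambda>M e r s a b x y. \<exists>\<gamma>. app M r e \<gamma> \<and> \<gamma> \<in> els M s", OF _ c r(1) s s s s s]) (intro definable_intros)
  moreover have "{e \<in> els M c. \<exists>\<gamma>. app M r e \<gamma> \<and> \<gamma> \<in> els M \<sigma>} = {e \<in> els M c. rk e \<in> els M \<sigma>}"
    using r(2) by auto
  ultimately show ?thesis by simp
qed

lemma (in kpp) sound_ex: "\<exists>T\<in>U. sound M T"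
  using empty_ex unfolding sound_def by auto

locale cut_pair = M: kpp_cut M S + N: kpp_cut N S for M N :: "'a str" and S :: "'a set" +
  fixes \<tau> :: 'a
  assumes S_agree: "\<And>x. x \<in> S \<Longrightarrow> els M x = els N x"
    and sig: "models M (Separation (SigmaP 1))"
    and SSy: "{{x \<in> S. mem M x c} |c. c \<in> univ M} = {{x \<in> S. mem N x c} |c. c \<in> univ N}"
    and \<tau>: "\<tau> \<in> univ N"
begin

lemma code_MN: "c \<in> univ M \<Longrightarrow> \<exists>d\<in>univ N. \<forall>x\<in>S. x \<in> els M c \<longleftrightarrow> x \<in> els N d"
proof -
  assume c: "c \<in> univ M"
  then have "{x \<in> S. mem M x c} \<in> {{x \<in> S. mem N x c} |c. c \<in> univ N}" using SSy by blast
  then obtain d where d: "d \<in> univ N" "{x \<in> S. mem M x c} = {x \<in> S. mem N x d}" by blast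
  have "x \<in> els M c \<longleftrightarrow> x \<in> els N d" if "x \<in> S" for x
    using that d(2) M.S_U[OF that] N.S_U[OF that] unfolding els_def by blast
  then show ?thesis using d(1) by blast
qed

lemma code_NM: "d \<in> univ N \<Longrightarrow> \<exists>c\<in>univ M. \<forall>x\<in>S. x \<in> els M c \<longleftrightarrow> x \<in> els N d"
proof -
  assume d: "d \<in> univ N"
  then have "{x \<in> S. mem N x d} \<in> {{x \<in> S. mem M x c} |c. c \<in> univ M}" using SSy by blast
  then obtain c where c: "c \<in> univ M" "{x \<in> S. mem M x c} = {x \<in> S. mem N x d}" by blast
  have "x \<in> els M c \<longleftrightarrow> x \<in> els N d" if "x \<in> S" for x
    using that c(2) M.S_U[OF that] N.S_U[OF that] unfolding els_def by blast
  then show ?thesis using c(1) by blast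
qed

lemma is_num_S: "x \<in> S \<Longrightarrow> is_num n M x \<longleftrightarrow> is_num n N x"
proof (induction n arbitrary: x)
  case 0
  then show ?case using S_agree[OF 0] by simp
next
  case (Suc n)
  have "is_num n M y \<longleftrightarrow> is_num n N y" if "y \<in> els M x" for y by (rule Suc.IH[OF M.S_els[OF Suc.prems that]])
  then show ?case using S_agree[OF Suc.prems] by auto
qed

lemma nm_S: "M.nm n \<in> S"
proof (induction n)
  case 0
  show ?case using M.S_empty[of "M.nm 0"] M.nm[of 0] by auto
next
  case (Suc n)
  obtain y where y: "y \<in> els M (M.nm (Suc n))" "els M (M.nm (Suc n)) = {y}" "is_num n M y" using M.nm[of "Suc n"] by auto
  have "y = M.nm n" using M.is_num_unique[OF M.els_U[OF y(1)]] M.nm y(3) by blast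
  then have "y \<in> S" using Suc by simp
  then show ?case using M.S_upair[of y y "M.nm (Suc n)"] y(2) M.nm[of "Suc n"] by auto
qed

lemma nm_agree: "N.nm n = M.nm n"
  using N.is_num_unique[of "N.nm n" "M.nm n" n] N.nm[of n] M.nm[of n] is_num_S[OF nm_S] N.S_U[OF nm_S] by blast

lemma opr_S: "p \<in> S \<Longrightarrow> opr M a b p \<longleftrightarrow> opr N a b p"
proof -
  assume p: "p \<in> S"
  have "els M u = els N u" if "u \<in> els N p" for u by (rule S_agree[OF N.S_els[OF p that]])
  then show ?thesis unfolding opr_def S_agree[OF p] by (metis (no_types, lifting))
qed

lemma pr_opr_M: "a \<in> S \<Longrightarrow> b \<in> S \<Longrightarrow> opr M a b (M.pr a b)"
  using M.pr[of a b] M.S_U by blast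

lemma pr_opr_N: "a \<in> S \<Longrightarrow> b \<in> S \<Longrightarrow> opr N a b (M.pr a b)"
  using pr_opr_M opr_S[OF M.S_pr] by blast

definition code :: "nat \<Rightarrow> 'a \<Rightarrow> 'a" where "code n x = M.pr (M.nm n) x"

lemma code_S: "x \<in> S \<Longrightarrow> code n x \<in> S"
  unfolding code_def by (rule M.S_pr[OF nm_S])

definition TrueM :: "'a \<Rightarrow> 'a list \<Rightarrow> bool" where
  "TrueM e ms \<longleftrightarrow> (\<exists>T\<in>univ M. \<exists>w\<in>univ M. sound M T \<and> accepts M T e (M.asg ms) w)"

text \<open>
  Unlike \<open>TrueM\<close>, truth in \<open>N\<close> takes its witnesses \<open>T\<close> from the fixed set \<open>\<tau>\<close>. It is therefore \<open>\<Delta>\<^sub>0\<^sup>P\<close> and its complement on a set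
  is a set, although \<open>N\<close> need not satisfy \<open>\<Sigma>\<^sub>1\<^sup>P\<close>-Separation. The
  construction never builds new sound sets in \<open>N\<close>; it only reads off those transferred from \<open>M\<close>.
\<close>

definition TrueN :: "'a \<Rightarrow> 'a list \<Rightarrow> 'a \<Rightarrow> bool" where
  "TrueN e ns w \<longleftrightarrow> (\<exists>T\<in>els N \<tau>. sound N T \<and> accepts N T e (N.asg ns) w)"

text \<open>
  The invariant of the construction. Transitivity of \<open>w\<close> makes the successive bounds decrease with respect
  to inclusion.
\<close>

definition matched :: "'a \<Rightarrow> 'a list \<Rightarrow> 'a list \<Rightarrow> bool" where
  "matched w ms ns \<longleftrightarrow> length ms = length ns \<and> set ms \<subseteq> univ M \<and> set ns \<subseteq> univ N \<and> w \<in> univ N \<and> trans_set N w \<and>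
     (\<forall>e\<in>S. TrueM e ms \<longrightarrow> TrueN e ns w)"

lemma TrueM_intro:
  assumes "T \<in> univ M" "w \<in> univ M" "sound M T" "x \<in> S" "n < 6" "set ms \<subseteq> univ M" "clause n M T x (M.asg ms) w"
  shows "TrueM (code n x) ms"
proof -
  have o: "opr M (M.nm n) x (code n x)" unfolding code_def by (rule pr_opr_M[OF nm_S assms(4)])
  have "justified M T (code n x) (M.asg ms) w"
    using M.justified_clause[OF o _ assms(5), of T "M.asg ms" w] M.nm[of n] assms(7) by blast
  then show ?thesis unfolding TrueM_def
    using M.truth_intro[OF assms(1,3), of "code n x" "M.asg ms" w] M.S_U[OF code_S[OF assms(4)]] M.asg[OF assms(6)] assms(2) by blast
qed

lemma TrueN_elim:
  assumes "TrueN (code n x) ns w" "x \<in> S" "n < 6"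
  shows "\<exists>T\<in>els N \<tau>. sound N T \<and> clause n N T x (N.asg ns) w"
proof -
  obtain T where T: "T\<in>els N \<tau>" "sound N T" "accepts N T (code n x) (N.asg ns) w" using assms(1) unfolding TrueN_def by blast
  have o: "opr N (M.nm n) x (code n x)" unfolding code_def by (rule pr_opr_N[OF nm_S assms(2)])
  have "is_num n N (M.nm n)" using M.nm[of n] is_num_S[OF nm_S] by blast
  then have "clause n N T x (N.asg ns) w"
    using N.justified_clause[OF o _ assms(3), of T "N.asg ns" w] accepts_justified[OF T(2,3)] by blast
  then show ?thesis using T by blast
qed

lemma transfer:
  assumes "matched w ms ns" "T \<in> univ M" "w0 \<in> univ M" "sound M T" "x \<in> S" "n < 6" "clause n M T x (M.asg ms) w0"
  shows "\<exists>T\<in>els N \<tau>. sound N T \<and> clause n N T x (N.asg ns) w"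
proof -
  have "TrueM (code n x) ms" using TrueM_intro[OF assms(2,3,4,5,6) _ assms(7)] assms(1) unfolding matched_def by blast
  then have "TrueN (code n x) ns w" using assms(1) code_S[OF assms(5)] unfolding matched_def by blast
  then show ?thesis by (rule TrueN_elim[OF _ assms(5,6)])
qed

text \<open>
  This is where \<open>\<Sigma>\<^sub>1\<^sup>P\<close>-Separation in \<open>M\<close> enters.
\<close>

lemma type_code_M:
  assumes ms: "set ms \<subseteq> univ M"
  shows "\<exists>c\<in>univ M. (\<forall>e\<in>els M c. TrueM e ms) \<and> (\<forall>e\<in>S. TrueM e ms \<longrightarrow> e \<in> els M c)"
proof -
  obtain v where v: "v \<in> univ M" "S \<subseteq> els M v" using M.S_cover by (rule bexE)
  have a: "M.asg ms \<in> univ M" using M.asg[OF ms] by blast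
  have "\<exists>c\<in>univ M. els M c = {e \<in> els M v. \<exists>x\<in>univ M. \<exists>T\<in>els M x. \<exists>w\<in>els M x. sound M T \<and> accepts M T e (M.asg ms) w}"
    by (rule M.sigma_sep[where Q="\<lambda>M x e a b c d f. \<exists>T\<in>els M x. \<exists>w\<in>els M x. sound M T \<and> accepts M T e a w", OF sig _ v(1) a a a a a])
      (intro definable_intros definable_sound definable_accepts)
  then obtain c where c: "c \<in> univ M" "els M c = {e \<in> els M v. \<exists>x\<in>univ M. \<exists>T\<in>els M x. \<exists>w\<in>els M x. sound M T \<and> accepts M T e (M.asg ms) w}"
    by (rule bexE)
  have "TrueM e ms" if "e \<in> els M c" for e
    using that unfolding c(2) TrueM_def using M.els_U by blast
  moreover have "e \<in> els M c" if e: "e \<in> S" "TrueM e ms" for e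
  proof -
    obtain T w where T: "T \<in> univ M" "w \<in> univ M" "sound M T" "accepts M T e (M.asg ms) w" using e(2) unfolding TrueM_def by blast
    from M.upair_ex[OF T(1,2)] obtain x where x: "x \<in> univ M" "els M x = {T, w}" by (rule bexE)
    have "\<exists>x\<in>univ M. \<exists>T\<in>els M x. \<exists>w\<in>els M x. sound M T \<and> accepts M T e (M.asg ms) w"
      by (rule bexI[OF _ x(1)], rule bexI[of _ T], rule bexI[of _ w]) (use T x(2) in simp_all)
    then show ?thesis unfolding c(2) using v(2) e(1) by blast
  qed
  ultimately show ?thesis using c(1) by blast
qed

lemma collect_accepts:
  assumes ms: "set ms \<subseteq> univ M" and E: "E \<in> univ M" and tr: "\<And>e. e \<in> els M E \<Longrightarrow> TrueM e ms"
  shows "\<exists>T\<in>univ M. \<exists>w\<in>univ M. sound M T \<and> (\<forall>e\<in>els M E. accepts M T e (M.asg ms) w)"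
proof -
  have a: "M.asg ms \<in> univ M" using M.asg[OF ms] by blast
  show ?thesis
  proof (rule M.collect_truth[where Q="\<lambda>M e T w a b c. accepts M T e a w", OF _ E a a a])
    show "definable (\<lambda>M \<rho>. accepts M (\<rho> (Suc 0)) (\<rho> 0) (\<rho> 3) (\<rho> 2))" by (rule definable_accepts)
    show "\<exists>T\<in>univ M. \<exists>w\<in>univ M. sound M T \<and> accepts M T e (M.asg ms) w" if "e \<in> els M E" for e
      using tr[OF that] unfolding TrueM_def .
  qed (rule accepts_mono)
qed

text \<open>
  For \<open>E\<close> in \<open>S\<close> consisting of codes true of \<open>ms @ [m]\<close>, the code \<open>(3, (k, E))\<close> is true of \<open>ms\<close> in \<open>M\<close>, so it is true
  of \<open>ns\<close> in \<open>N\<close>. The set \<open>Z\<close> of those \<open>\<sigma>\<close> below which the type is not realized is thus disjoint from \<open>S\<close>.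
\<close>

lemma forth_step:
  assumes g: "matched w ms ns" and m: "m \<in> univ M"
  shows "\<exists>n\<in>els N w. matched w (ms @ [m]) (ns @ [n])"
proof -
  have len: "length ns = length ms" and ms: "set ms \<subseteq> univ M" and ns: "set ns \<subseteq> univ N" and w: "w \<in> univ N" "trans_set N w"
    using g unfolding matched_def by simp_all
  define k where "k = M.nm (length ms)"
  have kS: "k \<in> S" unfolding k_def by (rule nm_S)
  have kN: "k = N.nm (length ns)" unfolding k_def len nm_agree ..
  define a where "a = N.asg ns"
  have aU: "a \<in> univ N" unfolding a_def using N.asg[OF ns] by blast
  have msm: "set (ms @ [m]) \<subseteq> univ M" using ms m by simp
  obtain c where c: "c\<in>univ M" "\<forall>e\<in>els M c. TrueM e (ms @ [m])" "\<forall>e\<in>S. TrueM e (ms @ [m]) \<longrightarrow> e \<in> els M c"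
    using type_code_M[OF msm] by blast
  from code_MN[OF c(1)] obtain d where d: "d \<in> univ N" "\<forall>x\<in>S. x \<in> els M c \<longleftrightarrow> x \<in> els N d" by (rule bexE)
  from N.Ord_out_ex obtain \<alpha> where al: "\<alpha> \<in> Ord N" "\<alpha> \<notin> S" by (rule bexE)
  from N.rk_fun_on[OF d(1)] obtain r where r: "r\<in>univ N" "\<forall>y\<in>els N d. \<forall>z. app N r y z \<longleftrightarrow> z = N.rk y" by (rule bexE)
  let ?P = "\<lambda>\<sigma>. \<exists>b\<in>els N w. \<exists>T\<in>els N \<tau>. sound N T \<and> (\<forall>e\<in>els N d. (\<exists>\<gamma>. app N r e \<gamma> \<and> \<gamma> \<in> els N \<sigma>) \<longrightarrow> accepts_ext N T e a k b w)"
  obtain Z where Z: "Z\<in>univ N" "els N Z = {\<sigma>\<in>els N \<alpha>. \<not> ?P \<sigma>}"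
    by (rule bexE[OF N.sep[where Q="\<lambda>N \<sigma> w \<tau> d r a k. \<not> (\<exists>b\<in>els N w. \<exists>T\<in>els N \<tau>. sound N T \<and> (\<forall>e\<in>els N d. (\<exists>\<gamma>. app N r e \<gamma> \<and> \<gamma> \<in> els N \<sigma>) \<longrightarrow> accepts_ext N T e a k b w))",
          OF _ N.Ord_U[OF al(1)] w(1) \<tau> d(1) r(1) aU N.S_U[OF kS]]]) (intro definable_intros definable_sound definable_accepts_ext, rule that)
  have low: "\<sigma> \<notin> els N Z" if s: "\<sigma> \<in> S" "\<sigma> \<in> Ord N" for \<sigma>
  proof -
    from N.below_set[OF d(1) N.Ord_U[OF s(2)]] obtain E where E: "E \<in> univ N" "els N E = {e \<in> els N d. N.rk e \<in> els N \<sigma>}" by (rule bexE)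
    have ES: "E \<in> S" by (rule N.S_small[OF E(1) s(2,1)]) (simp add: E(2))
    have EM: "els M E = els N E" by (rule S_agree[OF ES])
    have tr: "TrueM e (ms @ [m])" if e: "e \<in> els M E" for e
    proof -
      have "e \<in> S" by (rule M.S_els[OF ES e])
      moreover have "e \<in> els N d" using e unfolding EM E(2) by blast
      ultimately show ?thesis using c(2) d(2) by blast
    qed
    obtain T w0 where T: "T\<in>univ M" "w0\<in>univ M" "sound M T" "\<forall>e\<in>els M E. accepts M T e (M.asg (ms @ [m])) w0"
      using collect_accepts[OF msm M.S_U[OF ES] tr] by blast
    \<comment> \<open>The bound must contain the witness \<open>m\<close> itself.\<close>
    from M.insert_ex[OF m T(2)] obtain w1 where w1: "w1 \<in> univ M" "els M w1 = insert m (els M w0)" by (rule bexE)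
    have "accepts_ext M T e (M.asg ms) k m w1" if e: "e \<in> els M E" for e
      unfolding k_def M.accepts_ext_asg[OF ms m] by (rule accepts_mono[OF bspec[OF T(4) e] subset_refl]) (use w1(2) in blast)
    then have "clause 3 M T (M.pr k E) (M.asg ms) w1"
      unfolding clause_def using pr_opr_M[OF kS ES] w1(2) by auto
    from transfer[OF g T(1) w1(1) T(3) M.S_pr[OF kS ES] _ this]
    obtain T' where T': "T' \<in> els N \<tau>" "sound N T'" "clause 3 N T' (M.pr k E) a w" unfolding a_def by auto
    then obtain k' E' b where b: "opr N k' E' (M.pr k E)" "b \<in> els N w" "\<forall>e\<in>els N E'. accepts_ext N T' e a k' b w"
      unfolding clause_def by auto
    have kE: "k' = k" "E' = E" using N.opr_inj[OF b(1) pr_opr_N[OF kS ES]] by blast+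
    have "?P \<sigma>"
    proof (intro bexI[OF _ b(2)] bexI[OF _ T'(1)] conjI T'(2) ballI impI)
      fix e assume e: "e \<in> els N d" "\<exists>\<gamma>. app N r e \<gamma> \<and> \<gamma> \<in> els N \<sigma>"
      then have "N.rk e \<in> els N \<sigma>" using r(2) by auto
      then have "e \<in> els N E" unfolding E(2) using e(1) by blast
      then show "accepts_ext N T' e a k b w" using b(3) unfolding kE by blast
    qed
    then show ?thesis unfolding Z(2) by blast
  qed
  from N.overspill[OF al Z(1) low] obtain \<sigma> where s: "\<sigma> \<in> Ord N" "\<sigma> \<notin> S" "\<sigma> \<in> els N \<alpha>" "\<sigma> \<notin> els N Z" by blast
  then have "?P \<sigma>" unfolding Z(2) by blast
  then obtain b T where b: "b\<in>els N w" "T\<in>els N \<tau>" "sound N T"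
      "\<forall>e\<in>els N d. (\<exists>\<gamma>. app N r e \<gamma> \<and> \<gamma> \<in> els N \<sigma>) \<longrightarrow> accepts_ext N T e a k b w" by blast
  have bU: "b \<in> univ N" by (rule N.els_U[OF b(1)])
  have "TrueN e (ns @ [b]) w" if e: "e \<in> S" "TrueM e (ms @ [m])" for e
  proof -
    have ed: "e \<in> els N d" using e c(3) d(2) by blast
    have "N.rk e \<in> els N \<sigma>" by (rule N.Ord_out[OF s(1,2) e(1)])
    then have "accepts_ext N T e a k b w" using b(4) ed r(2) by metis
    then have "accepts N T e (N.asg (ns @ [b])) w" unfolding a_def kN N.accepts_ext_asg[OF ns bU] .
    then show ?thesis unfolding TrueN_def using b(2,3) by blast
  qed
  then have "matched w (ms @ [m]) (ns @ [b])" unfolding matched_def using len msm ns bU w by auto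
  then show ?thesis using b(1) by blast
qed

text \<open>
  Let \<open>d\<close> code the complement of the type of \<open>ns @ [n]\<close>, and \<open>c\<close> the same subset of \<open>S\<close> in \<open>M\<close>. If every candidate
  \<open>m\<close> satisfied some code in an initial part \<open>E\<close> of \<open>c\<close>, then the code \<open>(4, ((j, k), E))\<close> would be true of \<open>ms\<close>, hence
  of \<open>ns\<close>, and \<open>n\<close> would satisfy a code in \<open>E\<close>. The set \<open>Z\<close> of bad \<open>\<sigma>\<close> is \<open>\<Sigma>\<^sub>1\<^sup>P\<close> and so exists in \<open>M\<close>.
\<close>

lemma back_step:
  assumes g: "matched w ms ns" and j: "j < length ms" and n: "n \<in> univ N" "n \<in> els N (ns ! j) \<or> els N n \<subseteq> els N (ns ! j)"
  shows "\<exists>m\<in>univ M. matched w (ms @ [m]) (ns @ [n])"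
proof -
  have len: "length ns = length ms" and ms: "set ms \<subseteq> univ M" and ns: "set ns \<subseteq> univ N" and w: "w \<in> univ N" "trans_set N w"
    using g unfolding matched_def by simp_all
  define k where "k = M.nm (length ms)"
  have kS: "k \<in> S" unfolding k_def by (rule nm_S)
  have kN: "k = N.nm (length ns)" unfolding k_def len nm_agree ..
  define y where "y = ms ! j"
  have yU: "y \<in> univ M" unfolding y_def using ms j by (meson nth_mem subsetD)
  define a where "a = M.asg ms"
  have aU: "a \<in> univ M" unfolding a_def using M.asg[OF ms] by blast
  have nsn: "set (ns @ [n]) \<subseteq> univ N" using ns n by simp
  define A where "A = N.asg (ns @ [n])"
  have AU: "A \<in> univ N" unfolding A_def using N.asg[OF nsn] by blast
  obtain v where v: "v \<in> univ N" "S \<subseteq> els N v" using N.S_cover by (rule bexE)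
  obtain d where d: "d\<in>univ N" "els N d = {e \<in> els N v. \<not> (\<exists>T\<in>els N \<tau>. sound N T \<and> accepts N T e A w)}"
    by (rule bexE[OF N.sep[where Q="\<lambda>N e \<tau> A w x y z. \<not> (\<exists>T\<in>els N \<tau>. sound N T \<and> accepts N T e A w)", OF _ v(1) \<tau> AU w(1) w(1) w(1) w(1)]]) (intro definable_intros definable_sound definable_accepts, rule that)
  have dTr: "e \<in> els N d \<longleftrightarrow> \<not> TrueN e (ns @ [n]) w" if "e \<in> S" for e
    unfolding d(2) TrueN_def A_def using v(2) that by blast
  from code_NM[OF d(1)] obtain c where c: "c \<in> univ M" "\<forall>x\<in>S. x \<in> els M c \<longleftrightarrow> x \<in> els N d" by (rule bexE)
  \<comment> \<open>\<open>R\<close> is the set of candidates for \<open>m\<close>.\<close>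
  from M.Pow_ex[OF yU] obtain P where P: "P \<in> univ M" "els M P = {z\<in>univ M. els M z \<subseteq> els M y}" by (rule bexE)
  from M.Un_ex[OF P(1) yU] obtain R where R: "R \<in> univ M" "els M R = els M P \<union> els M y" by (rule bexE)
  have R': "m \<in> els M R \<longleftrightarrow> m \<in> univ M \<and> (m \<in> els M y \<or> els M m \<subseteq> els M y)" for m
    unfolding R(2) P(2) using M.els_U by blast
  from M.Ord_out_ex obtain \<alpha> where al: "\<alpha> \<in> Ord M" "\<alpha> \<notin> S" by (rule bexE)
  from M.rk_fun_on[OF c(1)] obtain r where r: "r\<in>univ M" "\<forall>y\<in>els M c. \<forall>z. app M r y z \<longleftrightarrow> z = M.rk y" by (rule bexE)
  let ?B = "\<lambda>\<sigma> T w0. \<forall>m\<in>els M R. \<exists>e\<in>els M c. (\<exists>\<gamma>. app M r e \<gamma> \<and> \<gamma> \<in> els M \<sigma>) \<and> accepts_ext M T e a k m w0"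
  let ?P = "\<lambda>\<sigma>. \<exists>x\<in>univ M. \<exists>T\<in>els M x. \<exists>w0\<in>els M x. sound M T \<and> ?B \<sigma> T w0"
  obtain Z where Z: "Z\<in>univ M" "els M Z = {\<sigma>\<in>els M \<alpha>. ?P \<sigma>}"
    by (rule bexE[OF M.sigma_sep[where Q="\<lambda>M x \<sigma> R c r a k. \<exists>T\<in>els M x. \<exists>w0\<in>els M x. sound M T \<and> (\<forall>m\<in>els M R. \<exists>e\<in>els M c. (\<exists>\<gamma>. app M r e \<gamma> \<and> \<gamma> \<in> els M \<sigma>) \<and> accepts_ext M T e a k m w0)",
          OF sig _ M.Ord_U[OF al(1)] R(1) c(1) r(1) aU M.S_U[OF kS]]]) (intro definable_intros definable_sound definable_accepts_ext, rule that)
  have low: "\<sigma> \<notin> els M Z" if s: "\<sigma> \<in> S" "\<sigma> \<in> Ord M" for \<sigma>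
  proof
    assume "\<sigma> \<in> els M Z"
    then obtain x T w0 where T: "x \<in> univ M" "T \<in> els M x" "w0 \<in> els M x" "sound M T" "?B \<sigma> T w0" unfolding Z(2) by blast
    from M.below_set[OF c(1) M.Ord_U[OF s(2)]] obtain E where E: "E \<in> univ M" "els M E = {e \<in> els M c. M.rk e \<in> els M \<sigma>}" by (rule bexE)
    have ES: "E \<in> S" by (rule M.S_small[OF E(1) s(2,1)]) (simp add: E(2))
    have EM: "els M E = els N E" by (rule S_agree[OF ES])
    define q where "q = M.pr (M.nm j) k"
    have qS: "q \<in> S" unfolding q_def by (rule M.S_pr[OF nm_S kS])
    have "\<exists>e\<in>els M E. accepts_ext M T e a k m w0" if m: "m \<in> univ M" "m \<in> els M y \<or> els M m \<subseteq> els M y" for m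
    proof -
      have "m \<in> els M R" unfolding R' using m by blast
      then obtain e where e: "e \<in> els M c" "\<exists>\<gamma>. app M r e \<gamma> \<and> \<gamma> \<in> els M \<sigma>" "accepts_ext M T e a k m w0" using T(5) by blast
      then have "e \<in> els M E" unfolding E(2) using r(2) by auto
      then show ?thesis using e(3) by blast
    qed
    moreover have "app M a (M.nm j) y" unfolding a_def y_def M.asg_app[OF ms] using j by blast
    ultimately have "\<exists>q' E'. opr M q' E' (M.pr q E) \<and> (\<exists>j k. opr M j k q' \<and> (\<exists>y. app M a j y \<and>
        (\<forall>b\<in>univ M. b \<in> els M y \<or> els M b \<subseteq> els M y \<longrightarrow> (\<exists>e\<in>els M E'. accepts_ext M T e a k b w0))))"
      using pr_opr_M[OF qS ES] pr_opr_M[OF nm_S kS, of j, folded q_def] by blast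
    then have "clause 4 M T (M.pr q E) (M.asg ms) w0" unfolding clause_def a_def by simp
    from transfer[OF g M.els_U[OF T(2)] M.els_U[OF T(3)] T(4) M.S_pr[OF qS ES] _ this]
    obtain T' where T': "T' \<in> els N \<tau>" "sound N T'" "clause 4 N T' (M.pr q E) (N.asg ns) w" by auto
    then obtain q' E' j' k' y' where b: "opr N q' E' (M.pr q E)" "opr N j' k' q'" "app N (N.asg ns) j' y'"
      "\<forall>b\<in>univ N. b \<in> els N y' \<or> els N b \<subseteq> els N y' \<longrightarrow> (\<exists>e\<in>els N E'. accepts_ext N T' e (N.asg ns) k' b w)"
      unfolding clause_def by auto
    have qE: "q' = q" "E' = E" using N.opr_inj[OF b(1) pr_opr_N[OF qS ES]] by blast+
    have jk: "j' = M.nm j" "k' = k" using N.opr_inj[OF b(2)[unfolded qE] pr_opr_N[OF nm_S kS, of j, folded q_def]] by blast+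
    have "y' = ns ! j" using b(3) unfolding jk nm_agree[symmetric] N.asg_app[OF ns] by blast
    then obtain e where e: "e\<in>els N E" "accepts_ext N T' e (N.asg ns) k n w" using b(4) n unfolding qE jk by blast
    have "accepts N T' e (N.asg (ns @ [n])) w" using e(2) unfolding kN N.accepts_ext_asg[OF ns n(1)] .
    then have tr: "TrueN e (ns @ [n]) w" unfolding TrueN_def using T' by blast
    have eS: "e \<in> S" by (rule N.S_els[OF ES e(1)])
    have "e \<in> els M c" using e(1) unfolding EM[symmetric] E(2) by blast
    then show False using c(2) dTr[OF eS] eS tr by blast
  qed
  from M.overspill[OF al Z(1) low] obtain \<sigma> where s: "\<sigma> \<in> Ord M" "\<sigma> \<notin> S" "\<sigma> \<in> els M \<alpha>" "\<sigma> \<notin> els M Z" by blast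
  have noP: "\<not> ?P \<sigma>" using s(3,4) unfolding Z(2) by blast
  from M.below_set[OF c(1) M.Ord_U[OF s(1)]] obtain E where E: "E \<in> univ M" "els M E = {e \<in> els M c. M.rk e \<in> els M \<sigma>}" by (rule bexE)
  have "\<exists>m\<in>els M R. \<forall>e\<in>els M E. \<not> TrueM e (ms @ [m])"
  proof (rule ccontr)
    assume no: "\<not> ?thesis"
    have "\<exists>T\<in>univ M. \<exists>w0\<in>univ M. sound M T \<and> (\<forall>m\<in>els M R. \<exists>e\<in>els M E. accepts_ext M T e a k m w0)"
    proof (rule M.collect_truth[where Q="\<lambda>M m T w0 E a k. \<exists>e\<in>els M E. accepts_ext M T e a k m w0", OF _ R(1) E(1) aU M.S_U[OF kS]])
      show "definable (\<lambda>M \<rho>. \<exists>e\<in>els M (\<rho> 3). accepts_ext M (\<rho> (Suc 0)) e (\<rho> 4) (\<rho> 5) (\<rho> 0) (\<rho> 2))"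
        by (intro definable_intros definable_accepts_ext)
      fix m assume m: "m \<in> els M R"
      then obtain e where e: "e \<in> els M E" "TrueM e (ms @ [m])" using no by blast
      then obtain T w0 where T: "T\<in>univ M" "w0\<in>univ M" "sound M T" "accepts M T e (M.asg (ms @ [m])) w0" unfolding TrueM_def by blast
      have "accepts_ext M T e a k m w0" unfolding a_def k_def M.accepts_ext_asg[OF ms M.els_U[OF m]] by (rule T(4))
      then show "\<exists>T\<in>univ M. \<exists>w0\<in>univ M. sound M T \<and> (\<exists>e\<in>els M E. accepts_ext M T e a k m w0)" using T e(1) by blast
    next
      fix m T T' w0 w0' assume h: "\<exists>e\<in>els M E. accepts_ext M T e a k m w0" "els M T \<subseteq> els M T'" "els M w0 \<subseteq> els M w0'"
      show "\<exists>e\<in>els M E. accepts_ext M T' e a k m w0'" using h(1) accepts_ext_mono[OF _ h(2,3)] by blast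
    qed
    then obtain T w0 where T: "T\<in>univ M" "w0\<in>univ M" "sound M T" "\<forall>m\<in>els M R. \<exists>e\<in>els M E. accepts_ext M T e a k m w0" by blast
    from M.upair_ex[OF T(1,2)] obtain x where x: "x \<in> univ M" "els M x = {T, w0}" by (rule bexE)
    have "?B \<sigma> T w0"
    proof
      fix m assume "m \<in> els M R"
      then obtain e where e: "e \<in> els M E" "accepts_ext M T e a k m w0" using T(4) by blast
      then have "e \<in> els M c" "M.rk e \<in> els M \<sigma>" unfolding E(2) by blast+
      then show "\<exists>e\<in>els M c. (\<exists>\<gamma>. app M r e \<gamma> \<and> \<gamma> \<in> els M \<sigma>) \<and> accepts_ext M T e a k m w0" using e(2) r(2) by metis
    qed
    then have "?P \<sigma>"
      by (intro bexI[OF _ x(1)] bexI[of _ T] bexI[of _ w0]) (use T(3) x(2) in simp_all)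
    then show False using noP by contradiction
  qed
  then obtain m where m: "m \<in> els M R" "\<forall>e\<in>els M E. \<not> TrueM e (ms @ [m])" by (rule bexE)
  have mU: "m \<in> univ M" by (rule M.els_U[OF m(1)])
  have "TrueN e (ns @ [n]) w" if e: "e \<in> S" "TrueM e (ms @ [m])" for e
  proof -
    have "M.rk e \<in> els M \<sigma>" by (rule M.Ord_out[OF s(1,2) e(1)])
    then have "e \<notin> els M c" using m(2) e(2) unfolding E(2) by blast
    then show ?thesis using c(2) dTr[OF e(1)] e(1) by blast
  qed
  then have "matched w (ms @ [m]) (ns @ [n])" unfolding matched_def using len ms nsn mU w by auto
  then show ?thesis using mU by blast
qed

text \<open>
  With \<open>\<mu>\<close> a transitive set containing the witnesses for all true codes, each true code \<open>e\<close> of \<open>ms\<close> gives the true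
  code \<open>(5, (k, e))\<close> of \<open>ms @ [\<mu>]\<close>; its truth at \<open>ns @ [\<nu>]\<close> says that \<open>e\<close> holds of \<open>ns\<close> with bound \<open>\<nu>\<close>.
\<close>

lemma split_step:
  assumes g: "matched w ms ns" and ne: "ms \<noteq> []"
  shows "\<exists>m n. n \<in> els N w \<and> matched w (ms @ [m]) (ns @ [n]) \<and> matched n ms ns"
proof -
  have len: "length ns = length ms" and ms: "set ms \<subseteq> univ M" and ns: "set ns \<subseteq> univ N" and w: "w \<in> univ N" "trans_set N w"
    using g unfolding matched_def by simp_all
  define k where "k = M.nm (length ms)"
  have kS: "k \<in> S" unfolding k_def by (rule nm_S)
  have kN: "k = N.nm (length ns)" unfolding k_def len nm_agree ..
  obtain c where c: "c\<in>univ M" "\<forall>e\<in>els M c. TrueM e ms" "\<forall>e\<in>S. TrueM e ms \<longrightarrow> e \<in> els M c"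
    using type_code_M[OF ms] by blast
  obtain T w0 where T: "T\<in>univ M" "w0\<in>univ M" "sound M T" "\<forall>e\<in>els M c. accepts M T e (M.asg ms) w0"
    using collect_accepts[OF ms c(1)] c(2) by blast
  obtain \<mu> where mu: "\<mu> \<in> univ M" "trans_set M \<mu>" "w0 \<in> els M \<mu>" using M.trans_ex[OF T(2)] by blast
  have sub: "els M w0 \<subseteq> els M \<mu>" using mu(2,3) unfolding trans_set_def by blast
  from forth_step[OF g mu(1)] obtain \<nu> where nu: "\<nu> \<in> els N w" "matched w (ms @ [\<mu>]) (ns @ [\<nu>])" by (rule bexE)
  have nuU: "\<nu> \<in> univ N" by (rule N.els_U[OF nu(1)])
  have nsn: "set (ns @ [\<nu>]) \<subseteq> univ N" using ns nuU by simp
  have msm: "set (ms @ [\<mu>]) \<subseteq> univ M" using ms mu(1) by simp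
  have key: "trans_set N \<nu> \<and> TrueN e ns \<nu>" if e: "e \<in> S" "TrueM e ms" for e
  proof -
    have "e \<in> els M c" using c(3) e by blast
    then have "accepts M T e (M.asg ms) w0" using T(4) by blast
    then have "accepts M T e (M.asg ms) \<mu>" by (rule accepts_mono[OF _ subset_refl sub])
    then have "accepts_drop M T e (M.asg (ms @ [\<mu>])) k \<mu>" unfolding k_def M.accepts_drop_asg[OF ms mu(1)] .
    moreover have "app M (M.asg (ms @ [\<mu>])) k \<mu>" unfolding k_def M.asg_app[OF msm] by simp
    ultimately have "clause 5 M T (M.pr k e) (M.asg (ms @ [\<mu>])) w0"
      unfolding clause_def using pr_opr_M[OF kS e(1)] mu(2) by auto
    from transfer[OF nu(2) T(1-3) M.S_pr[OF kS e(1)] _ this]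
    obtain T' where T': "T' \<in> els N \<tau>" "sound N T'" "clause 5 N T' (M.pr k e) (N.asg (ns @ [\<nu>])) w" by auto
    then obtain k' e' v where b: "opr N k' e' (M.pr k e)" "app N (N.asg (ns @ [\<nu>])) k' v" "trans_set N v"
      "accepts_drop N T' e' (N.asg (ns @ [\<nu>])) k' v"
      unfolding clause_def by auto
    have kE: "k' = k" "e' = e" using N.opr_inj[OF b(1) pr_opr_N[OF kS e(1)]] by blast+
    have v: "v = \<nu>" using b(2) unfolding kE kN N.asg_app[OF nsn] by simp
    have "accepts N T' e (N.asg ns) \<nu>" using b(4) unfolding kE kN v N.accepts_drop_asg[OF ns nuU] .
    then show ?thesis using b(3) T' unfolding v TrueN_def by blast
  qed
  \<comment> \<open>Some code has to be true of \<open>ms\<close> for \<open>\<nu>\<close> to inherit transitivity; that the first entry is not an element of itself will do.\<close>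
  define p where "p = M.pr (M.nm 0) (M.nm 0)"
  have pS: "p \<in> S" unfolding p_def by (rule M.S_pr[OF nm_S nm_S])
  have "app M (M.asg ms) (M.nm 0) (ms ! 0)" unfolding M.asg_app[OF ms] using ne by simp
  moreover have "ms ! 0 \<notin> els M (ms ! 0)" using M.irrefl ms ne by (meson length_greater_0_conv nth_mem subsetD)
  ultimately have "\<exists>j k. opr M j k p \<and> (\<exists>u. app M (M.asg ms) j u \<and> (\<exists>v. app M (M.asg ms) k v \<and> u \<notin> els M v))"
    using pr_opr_M[OF nm_S nm_S, of 0 0, folded p_def] by blast
  then have "clause 1 M T p (M.asg ms) w0" unfolding clause_def by simp
  then have "TrueM (code 1 p) ms" using TrueM_intro[OF T(1-3) pS _ ms] by simp
  then have "trans_set N \<nu>" using key code_S[OF pS] by blast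
  then have "matched \<nu> ms ns" unfolding matched_def using len ms ns nuU key by simp
  then show ?thesis using nu by blast
qed

lemma matched_mem:
  assumes g: "matched w ms ns" and i: "i < length ms" "j < length ms"
  shows "ms ! i \<in> els M (ms ! j) \<longleftrightarrow> ns ! i \<in> els N (ns ! j)"
proof -
  have len: "length ns = length ms" and ms: "set ms \<subseteq> univ M" and ns: "set ns \<subseteq> univ N" and w: "w \<in> univ N" "trans_set N w"
    using g unfolding matched_def by simp_all
  obtain T where T: "T \<in> univ M" "sound M T" using M.sound_ex by (rule bexE)
  define p where "p = M.pr (M.nm i) (M.nm j)"
  have pS: "p \<in> S" unfolding p_def by (rule M.S_pr[OF nm_S nm_S])
  have oM: "opr M (M.nm i) (M.nm j) p" and oN: "opr N (M.nm i) (M.nm j) p"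
    unfolding p_def by (rule pr_opr_M[OF nm_S nm_S], rule pr_opr_N[OF nm_S nm_S])
  have aM: "app M (M.asg ms) (M.nm i) (ms ! i)" "app M (M.asg ms) (M.nm j) (ms ! j)"
    unfolding M.asg_app[OF ms] using i by blast+
  have aN: "u = ns ! l" if "app N (N.asg ns) (M.nm l) u" for l u
    using that unfolding nm_agree[symmetric] N.asg_app[OF ns] by blast
  show ?thesis
  proof
    assume "ms ! i \<in> els M (ms ! j)"
    then have "\<exists>j k. opr M j k p \<and> (\<exists>u. app M (M.asg ms) j u \<and> (\<exists>v. app M (M.asg ms) k v \<and> u \<in> els M v))"
      using oM aM by blast
    then have "clause 0 M T p (M.asg ms) T" unfolding clause_def by simp
    from transfer[OF g T(1,1,2) pS _ this] obtain T' where "clause 0 N T' p (N.asg ns) w" by auto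
    then obtain j' k u v where "opr N j' k p" "app N (N.asg ns) j' u" "app N (N.asg ns) k v" "u \<in> els N v" unfolding clause_def by auto
    then show "ns ! i \<in> els N (ns ! j)" using N.opr_inj[OF _ oN] aN by blast
  next
    assume r: "ns ! i \<in> els N (ns ! j)"
    show "ms ! i \<in> els M (ms ! j)"
    proof (rule ccontr)
      assume "ms ! i \<notin> els M (ms ! j)"
      then have "\<exists>j k. opr M j k p \<and> (\<exists>u. app M (M.asg ms) j u \<and> (\<exists>v. app M (M.asg ms) k v \<and> u \<notin> els M v))"
        using oM aM by blast
      then have "clause 1 M T p (M.asg ms) T" unfolding clause_def by simp
      from transfer[OF g T(1,1,2) pS _ this] obtain T' where "clause 1 N T' p (N.asg ns) w" by auto
      then obtain j' k u v where "opr N j' k p" "app N (N.asg ns) j' u" "app N (N.asg ns) k v" "u \<notin> els N v" unfolding clause_def by auto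
      then have "ns ! i \<notin> els N (ns ! j)" using N.opr_inj[OF _ oN] aN by blast
      then show False using r by contradiction
    qed
  qed
qed

text \<open>
  Code \<open>2\<close> applied to the pair of the name \<open>i\<close> and the value.
\<close>

lemma matched_S:
  assumes g: "matched w ms ns" and i: "i < length ms" "ms ! i \<in> S"
  shows "ns ! i = ms ! i"
proof -
  have len: "length ns = length ms" and ms: "set ms \<subseteq> univ M" and ns: "set ns \<subseteq> univ N"
    using g unfolding matched_def by simp_all
  obtain T where T: "T \<in> univ M" "sound M T" using M.sound_ex by (rule bexE)
  define p where "p = M.pr (M.nm i) (ms ! i)"
  have pS: "p \<in> S" unfolding p_def by (rule M.S_pr[OF nm_S i(2)])
  have "app M (M.asg ms) (M.nm i) (ms ! i)" unfolding M.asg_app[OF ms] using i by blast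
  then have "p \<in> els M (M.asg ms)" unfolding M.app_pr p_def by blast
  then have "clause 2 M T p (M.asg ms) T" unfolding clause_def by simp
  from transfer[OF g T(1,1,2) pS _ this] obtain T' where "clause 2 N T' p (N.asg ns) w" by auto
  then have "p \<in> els N (N.asg ns)" unfolding clause_def by simp
  then have "app N (N.asg ns) (M.nm i) (ms ! i)"
    unfolding app_def using pr_opr_N[OF nm_S i(2), of i, folded p_def] by blast
  then show ?thesis unfolding nm_agree[symmetric] N.asg_app[OF ns] by simp
qed

end

section \<open>Embeddings closed under elements and subsets\<close>

locale closed_emb = M: kpp M + N: kpp N for M N :: "'a str" +
  fixes i :: "'a \<Rightarrow> 'a"
  assumes emb: "embedding M N i"
    and tr: "\<And>m n. m \<in> univ M \<Longrightarrow> n \<in> els N (i m) \<Longrightarrow> n \<in> i ` univ M"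
    and sub: "\<And>m n. m \<in> univ M \<Longrightarrow> n \<in> univ N \<Longrightarrow> els N n \<subseteq> els N (i m) \<Longrightarrow> n \<in> i ` univ M"
begin

lemma i_U: "x \<in> univ M \<Longrightarrow> i x \<in> univ N"
  using emb unfolding embedding_def by blast

lemma i_els: "x \<in> univ M \<Longrightarrow> y \<in> univ M \<Longrightarrow> i x \<in> els N (i y) \<longleftrightarrow> x \<in> els M y"
  using emb i_U unfolding embedding_def els_def by blast

lemma sat_abs:
  assumes "\<phi> \<in> Delta0P" "range \<rho> \<subseteq> univ M"
  shows "sat M \<rho> \<phi> \<longleftrightarrow> sat N (\<lambda>n. i (\<rho> n)) \<phi>"
  by (rule Delta0P_absolute[OF emb _ _ assms]) (fact tr sub)+

lemma definable_abs:
  assumes "definable P" "range \<rho> \<subseteq> univ M"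
  shows "P M \<rho> \<longleftrightarrow> P N (\<lambda>n. i (\<rho> n))"
proof -
  obtain \<phi> where \<phi>: "\<phi>\<in>Delta0P" "\<forall>M \<rho>. sat M \<rho> \<phi> \<longleftrightarrow> P M \<rho>" using assms(1) unfolding definable_def by blast
  show ?thesis using sat_abs[OF \<phi>(1) assms(2)] \<phi>(2) by simp
qed

lemma i_rk: "x \<in> univ M \<Longrightarrow> i (M.rk x) = N.rk (i x)"
proof -
  assume x: "x \<in> univ M"
  from M.rk_fun[OF x] obtain f t where f: "f\<in>univ M" "t\<in>univ M" "recfun rankG rankH M f t" "x \<in> els M t"
    "\<forall>y\<in>els M t. \<forall>z. app M f y z \<longleftrightarrow> z = M.rk y" by blast
  have a: "app M f x (M.rk x)" using f(4,5) by blast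
  have r: "recfun rankG rankH N (i f) (i t)"
    using definable_abs[OF kpp_rec.definable_recfun[OF M.rank_rec, of 0 1], of "case_nat f (\<lambda>_. t)"] f(1-3) by (simp add: range_case_nat)
  have a': "app N (i f) (i x) (i (M.rk x))"
    using definable_abs[OF definable_app[of 0 1 2], of "case_nat f (case_nat x (\<lambda>_. M.rk x))"] f(1) x M.rk_U[OF x] a
    by (simp add: range_case_nat eval_nat_numeral)
  have "i x \<in> els N (i t)" using i_els[OF x f(2)] f(4) by blast
  then show ?thesis
    using kpp_rec.val_app[OF N.rank_rec r i_U[OF f(1)] i_U[OF f(2)], of "i x" "i (M.rk x)"] a' unfolding N.rk_def by blast
qed

lemma i_Ord: "a \<in> Ord M \<Longrightarrow> i a \<in> Ord N"
  using i_rk[OF M.Ord_U, of a] M.rk_of_Ord[of a] N.rk_Ord[OF i_U[OF M.Ord_U, of a]] by simp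

text \<open>
  The image contains \<open>i(v)\<close>, where \<open>v\<close> collects the sets of rank at most \<open>rk m\<close> in \<open>M\<close>. By induction every set of rank
  at most \<open>rk (i m)\<close> in \<open>N\<close> is an element of \<open>i(v)\<close>: once its elements are, it is a subset of \<open>i(v)\<close>, so it lies in
  the image and its preimage has the right rank.
\<close>

lemma covers:
  assumes n: "n \<in> univ N" and m: "m \<in> univ M" and le: "N.rk n \<in> els N (N.rk (i m)) \<or> N.rk n = N.rk (i m)"
  shows "n \<in> i ` univ M"
proof -
  obtain s where s: "s \<in> Ord M" "els M s = insert (M.rk m) (els M (M.rk m))" using M.succ_ex[OF M.rk_Ord[OF m]] by (rule bexE)
  have sU: "s \<in> univ M" by (rule M.Ord_U[OF s(1)])
  from M.V_ex[OF s(1)] obtain v where v: "v \<in> univ M" "els M v = {x\<in>univ M. M.rk x \<in> els M s}" by (rule bexE)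
  have oi: "i s \<in> Ord N" by (rule i_Ord[OF s(1)])
  have isU: "i s \<in> univ N" "i v \<in> univ N" using i_U sU v(1) by blast+
  from N.trans_ex[OF n] obtain t where t: "t \<in> univ N" "trans_set N t" "n \<in> els N t" by blast
  from N.rk_fun_on[OF t(1)] obtain f where f: "f \<in> univ N" "\<forall>y\<in>els N t. \<forall>z. app N f y z \<longleftrightarrow> z = N.rk y" by (rule bexE)
  let ?P = "\<lambda>y. N.rk y \<in> els N (i s) \<longrightarrow> y \<in> els N (i v)"
  have "?P n"
  proof (rule N.trans_induct[where P="?P", OF _ t])
    have "\<exists>z\<in>univ N. els N z = {y\<in>els N t. \<forall>r. app N f y r \<longrightarrow> (r \<in> els N (i s) \<longrightarrow> y \<in> els N (i v))}"
      by (rule N.sep[where Q="\<lambda>N y f si iv a b c. \<forall>r. app N f y r \<longrightarrow> (r \<in> els N si \<longrightarrow> y \<in> els N iv)",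
          OF _ t(1) f(1) isU isU(1) isU(1) isU(1)]) (intro definable_intros)
    moreover have "{y\<in>els N t. \<forall>r. app N f y r \<longrightarrow> (r \<in> els N (i s) \<longrightarrow> y \<in> els N (i v))} = {y\<in>els N t. ?P y}"
      using f(2) by auto
    ultimately show "\<exists>z\<in>univ N. els N z = {y\<in>els N t. ?P y}" by simp
    fix y assume y: "y \<in> els N t" and IH: "\<And>z. z \<in> els N y \<Longrightarrow> ?P z"
    have yU: "y \<in> univ N" by (rule N.els_U[OF y])
    show "?P y"
    proof
      assume l: "N.rk y \<in> els N (i s)"
      have "els N y \<subseteq> els N (i v)"
      proof
        fix z assume z: "z \<in> els N y"
        show "z \<in> els N (i v)" using IH[OF z] N.Ord_trans[OF oi l N.rk_mono[OF yU z]] by blast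
      qed
      then obtain y0 where y0: "y0 \<in> univ M" "y = i y0" using sub[OF v(1) yU] by blast
      have "i (M.rk y0) \<in> els N (i s)" using l unfolding y0(2) i_rk[OF y0(1)] .
      then have "M.rk y0 \<in> els M s" using i_els[OF M.rk_U[OF y0(1)] sU] by blast
      then have "y0 \<in> els M v" unfolding v(2) using y0(1) by blast
      then show "y \<in> els N (i v)" using i_els[OF y0(1) v(1)] y0(2) by blast
    qed
  qed
  moreover have "N.rk n \<in> els N (i s)"
  proof -
    have "M.rk m \<in> els M s" unfolding s(2) by blast
    then have r: "N.rk (i m) \<in> els N (i s)" unfolding i_rk[OF m, symmetric] using i_els[OF M.rk_U[OF m] sU] by blast
    show ?thesis using le r N.Ord_trans[OF oi r] by auto
  qed
  ultimately show ?thesis using tr[OF v(1)] by blast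
qed

lemma rank_initial: "rank_initial M N i"
  unfolding rank_initial_def
proof (intro conjI emb ballI impI)
  fix n m assume n: "n \<in> univ N" and m: "m \<in> univ M" and r: "rank_le N n (i m)"
  show "n \<in> i ` univ M" by (rule covers[OF n m]) (use r N.rank_le_iff[OF n i_U[OF m]] in blast)
qed

end

lemma closed_embI:
  assumes M: "models M KPP" and N: "models N KPP" and r: "rank_initial M N i"
  shows "closed_emb M N i"
proof -
  interpret N: kpp N by unfold_locales fact
  have emb: "embedding M N i" using r unfolding rank_initial_def by blast
  have iU: "i m \<in> univ N" if "m \<in> univ M" for m using emb that unfolding embedding_def by blast
  have cl: "n \<in> i ` univ M" if "m \<in> univ M" "n \<in> univ N" "N.rk n \<in> els N (N.rk (i m)) \<or> N.rk n = N.rk (i m)" for m n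
    using r that N.rank_le_iff[OF that(2) iU[OF that(1)]] unfolding rank_initial_def by blast
  show ?thesis
  proof unfold_locales
    show "models M KPP" "embedding M N i" by fact+
    show "n \<in> i ` univ M" if "m \<in> univ M" "n \<in> els N (i m)" for m n
      by (rule cl[OF that(1) N.els_U[OF that(2)]]) (use N.rk_mono[OF iU[OF that(1)] that(2)] in blast)
    show "n \<in> i ` univ M" if "m \<in> univ M" "n \<in> univ N" "els N n \<subseteq> els N (i m)" for m n
      by (rule cl[OF that(1,2)], rule N.rk_subset[OF that(2) iU[OF that(1)] that(3)])
  qed
qed

text \<open>
  Needed because \<open>rank_less\<close> speaks of ranks computed in the image of an embedding: as an isomorphic copy
  of \<open>M\<close> the image satisfies the same axioms, so its ranks agree with those of \<open>N\<close>.
\<close>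

lemma sat_iso:
  assumes U: "univ J = j ` univ M" and inj: "inj_on j (univ M)"
    and mem: "\<And>x y. x \<in> univ M \<Longrightarrow> y \<in> univ M \<Longrightarrow> mem M x y \<longleftrightarrow> mem J (j x) (j y)"
    and "range \<rho> \<subseteq> univ M"
  shows "sat M \<rho> \<phi> \<longleftrightarrow> sat J (\<lambda>n. j (\<rho> n)) \<phi>"
  using assms(4)
proof (induction \<phi> arbitrary: \<rho>)
  case (Mem x y)
  then show ?case using mem[of "\<rho> x" "\<rho> y"] by (auto simp: image_subset_iff)
next
  case (Eq x y)
  then have "\<rho> x \<in> univ M" "\<rho> y \<in> univ M" by auto
  then show ?case using inj by (auto dest: inj_onD)
next
  case (All x \<phi>)
  have upd: "(\<lambda>n. j ((\<rho>(x := a)) n)) = (\<lambda>n. j (\<rho> n))(x := j a)" for a by auto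
  have "sat M (\<rho>(x := a)) \<phi> \<longleftrightarrow> sat J ((\<lambda>n. j (\<rho> n))(x := j a)) \<phi>" if "a \<in> univ M" for a
    by (rule All.IH[of "\<rho>(x := a)", unfolded upd]) (use All.prems that in auto)
  then show ?case by (simp add: U)
next
  case (Ex x \<phi>)
  have upd: "(\<lambda>n. j ((\<rho>(x := a)) n)) = (\<lambda>n. j (\<rho> n))(x := j a)" for a by auto
  have "sat M (\<rho>(x := a)) \<phi> \<longleftrightarrow> sat J ((\<lambda>n. j (\<rho> n))(x := j a)) \<phi>" if "a \<in> univ M" for a
    by (rule Ex.IH[of "\<rho>(x := a)", unfolded upd]) (use Ex.prems that in auto)
  then show ?case by (simp add: U)
qed simp_all

lemma models_image:
  assumes e: "embedding M N j" and T: "models M T"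
  shows "models (image_str M N j) T"
proof -
  let ?J = "image_str M N j"
  have U: "univ ?J = j ` univ M" by (simp add: image_str_def)
  have inj: "inj_on j (univ M)" using e unfolding embedding_def by blast
  have mem: "mem M x y \<longleftrightarrow> mem ?J (j x) (j y)" if "x \<in> univ M" "y \<in> univ M" for x y
    using e that by (simp add: embedding_def image_str_def)
  show ?thesis unfolding models_def
  proof (intro conjI ballI allI impI)
    show "univ ?J \<noteq> {}" using T U unfolding models_def by simp
    fix \<phi> and \<rho> :: "nat \<Rightarrow> _" assume p: "\<phi> \<in> T" and r: "range \<rho> \<subseteq> univ ?J"
    have ex: "\<exists>m\<in>univ M. j m = \<rho> n" for n
    proof -
      have "\<rho> n \<in> j ` univ M" using r unfolding U by blast
      then show ?thesis by auto
    qed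
    define \<rho>' where "\<rho>' (n::nat) = (SOME m. m \<in> univ M \<and> j m = \<rho> n)" for n
    have r': "\<rho>' n \<in> univ M \<and> j (\<rho>' n) = \<rho> n" for n unfolding \<rho>'_def by (rule someI_ex) (use ex[of n] in blast)
    have rr: "range \<rho>' \<subseteq> univ M" using r' by blast
    have "sat M \<rho>' \<phi>" using T p rr unfolding models_def by blast
    then have "sat ?J (\<lambda>n. j (\<rho>' n)) \<phi>" using sat_iso[OF U inj mem rr] by simp
    then show "sat ?J \<rho> \<phi>" using r' by simp
  qed
qed

lemma rank_lessI:
  assumes M: "models M KPP" and N: "models N KPP" and i: "closed_emb M N i" and j: "closed_emb M N j"
    and less: "i ` univ M \<subset> j ` univ M"
  shows "rank_less M N i j"
proof -
  interpret N: kpp N by unfold_locales fact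
  interpret i: closed_emb M N i by fact
  interpret j: closed_emb M N j by fact
  define J where "J = image_str M N j"
  define I where "I = image_str M N i"
  have UJ: "univ J = j ` univ M" "mem J = mem N" and UI: "univ I = i ` univ M" "mem I = mem N"
    unfolding I_def J_def image_str_def by simp_all
  have JN: "univ J \<subseteq> univ N" unfolding UJ using j.i_U by blast
  interpret J: kpp J unfolding J_def by unfold_locales (rule models_image[OF j.emb M])
  have eJ: "els J x = els N x \<inter> univ J" for x unfolding els_def UJ(2) using JN by blast
  interpret k: closed_emb J N id
  proof unfold_locales
    show "embedding J N id" using JN by (auto simp: embedding_def UJ(2))
    show "n \<in> id ` univ J" if "m \<in> univ J" "n \<in> els N (id m)" for m n
      using that j.tr unfolding UJ(1) by auto
    show "n \<in> id ` univ J" if "m \<in> univ J" "n \<in> univ N" "els N n \<subseteq> els N (id m)" for m n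
      using that j.sub unfolding UJ(1) by auto
  qed
  have "rank_initial_substructure I J"
    unfolding rank_initial_substructure_def rank_initial_def substructure_def
  proof (intro conjI ballI impI)
    show IJ: "univ I \<subseteq> univ J" using less unfolding UI(1) UJ(1) by blast
    show "mem I x y \<longleftrightarrow> mem J x y" for x y by (simp add: UI UJ)
    show "embedding I J id" using IJ by (auto simp: embedding_def UI UJ)
    fix n m assume n: "n \<in> univ J" and m: "m \<in> univ I" and r: "rank_le J n (id m)"
    have mJ: "m \<in> univ J" using IJ m by blast
    have "J.rk n \<in> els J (J.rk m) \<or> J.rk n = J.rk m" using r J.rank_le_iff[OF n mJ] by simp
    then have "N.rk n \<in> els N (N.rk m) \<or> N.rk n = N.rk m"
      using k.i_rk[OF n] k.i_rk[OF mJ] eJ by auto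
    moreover obtain m' where "m' \<in> univ M" "m = i m'" using m unfolding UI(1) by blast
    moreover have "n \<in> univ N" using n JN by blast
    ultimately show "n \<in> id ` univ I" using i.covers[of n m'] unfolding UI(1) image_id id_apply by blast
  qed
  then show ?thesis unfolding rank_less_def I_def J_def using less by blast
qed

section \<open>The tree of embeddings\<close>

text \<open>
  Each request has to recur: an element of \<open>M\<close> must receive a partner below every later bound, and a
  request to go back may come before the entry it refers to.
\<close>

lemma enumerate_infinitely_often:
  assumes "countable A" "A \<noteq> {}"
  shows "\<exists>e :: nat \<Rightarrow> 'b. (\<forall>t. e t \<in> A) \<and> (\<forall>p\<in>A. \<forall>k. \<exists>t\<ge>k. e t = p)"
proof (rule exI[of _ "\<lambda>t. from_nat_into A (fst (prod_decode t))"], intro conjI allI ballI)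
  let ?e = "\<lambda>t. from_nat_into A (fst (prod_decode t))"
  show "?e t \<in> A" for t by (rule from_nat_into[OF assms(2)])
  fix p k assume "p \<in> A"
  then obtain i where "from_nat_into A i = p" using from_nat_into_surj[OF assms(1)] by blast
  then show "\<exists>t\<ge>k. ?e t = p"
    by (intro exI[of _ "prod_encode (i, k)"]) (simp add: le_prod_encode_2)
qed

context cut_pair
begin

text \<open>
  One round at state \<open>s\<close>: a step forth for \<open>x\<close>, a step back for \<open>n\<close> if \<open>y\<close> is an entry above \<open>n\<close>, and a split. The
  result does not mention the branch, so two branches share it until they part.
\<close>

definition round_step :: "'a \<times> 'a list \<times> 'a list \<Rightarrow> 'a \<times> 'a \<times> 'a \<Rightarrow> 'a list \<times> 'a list \<times> 'a \<times> 'a \<Rightarrow> bool" where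
  "round_step s r q \<longleftrightarrow> (case s of (w, ms, ns) \<Rightarrow> case r of (x, n, y) \<Rightarrow> case q of (ms', ns', \<mu>, \<nu>) \<Rightarrow>
     (\<exists>u. ms' = ms @ u) \<and> (\<exists>v. ns' = ns @ v) \<and>
     (\<exists>i<length ms'. ms' ! i = x \<and> ns' ! i \<in> els N w) \<and>
     (\<forall>i<length ms. ns ! i = y \<longrightarrow> n \<in> els N y \<or> els N n \<subseteq> els N y \<longrightarrow> n \<in> set ns') \<and>
     \<nu> \<in> els N w \<and> matched w (ms' @ [\<mu>]) (ns' @ [\<nu>]) \<and> matched \<nu> ms' ns')"

lemma round_step_ex:
  assumes g: "matched w ms ns" and ne: "ms \<noteq> []" and x: "x \<in> univ M" and n: "n \<in> univ N"
  shows "\<exists>q. round_step (w, ms, ns) (x, n, y) q"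
proof -
  have len: "length ns = length ms" using g unfolding matched_def by simp
  from forth_step[OF g x] obtain n1 where n1: "n1 \<in> els N w" "matched w (ms @ [x]) (ns @ [n1])" by (rule bexE)
  have "\<exists>u v. matched w (ms @ [x] @ u) (ns @ [n1] @ v) \<and> (\<forall>i<length ms. ns ! i = y \<longrightarrow> n \<in> els N y \<or> els N n \<subseteq> els N y \<longrightarrow> n \<in> set v)"
  proof (cases "\<exists>i<length ms. ns ! i = y \<and> (n \<in> els N y \<or> els N n \<subseteq> els N y)")
    case True
    then obtain i where i: "i < length ms" "ns ! i = y" "n \<in> els N y \<or> els N n \<subseteq> els N y" by blast
    have "(ns @ [n1]) ! i = y" using i len by (simp add: nth_append)
    then obtain m2 where "matched w ((ms @ [x]) @ [m2]) ((ns @ [n1]) @ [n])" using back_step[OF n1(2), of i n] i n by auto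
    then show ?thesis by (intro exI[of _ "[m2]"] exI[of _ "[n]"]) simp
  next
    case False
    then show ?thesis using n1(2) by (intro exI[of _ "[]"]) auto
  qed
  then obtain u v where uv: "matched w (ms @ [x] @ u) (ns @ [n1] @ v)"
    "\<forall>i<length ms. ns ! i = y \<longrightarrow> n \<in> els N y \<or> els N n \<subseteq> els N y \<longrightarrow> n \<in> set v" by blast
  have "ms @ [x] @ u \<noteq> []" by simp
  from split_step[OF uv(1) this] obtain \<mu> \<nu> where s: "\<nu> \<in> els N w" "matched w ((ms @ [x] @ u) @ [\<mu>]) ((ns @ [n1] @ v) @ [\<nu>])"
    "matched \<nu> (ms @ [x] @ u) (ns @ [n1] @ v)" by blast
  have "\<exists>i<length (ms @ [x] @ u). (ms @ [x] @ u) ! i = x \<and> (ns @ [n1] @ v) ! i \<in> els N w"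
    by (rule exI[of _ "length ms"]) (use len n1(1) in \<open>simp add: nth_append\<close>)
  then have "round_step (w, ms, ns) (x, n, y) (ms @ [x] @ u, ns @ [n1] @ v, \<mu>, \<nu>)"
    unfolding round_step_def using s uv(2) by auto
  then show ?thesis by blast
qed

primrec stage :: "(nat \<Rightarrow> 'a \<times> 'a \<times> 'a) \<Rightarrow> 'a \<Rightarrow> 'a \<Rightarrow> (nat \<Rightarrow> bool) \<Rightarrow> nat \<Rightarrow> 'a \<times> 'a list \<times> 'a list" where
  "stage e m n g 0 = (\<tau>, [m], [n])"
| "stage e m n g (Suc t) = (case SOME q. round_step (stage e m n g t) (e t) q of (ms', ns', \<mu>, \<nu>) \<Rightarrow>
     if g t then (fst (stage e m n g t), ms' @ [\<mu>], ns' @ [\<nu>]) else (\<nu>, ms', ns'))"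

lemma stage_agree: "(\<And>k. k < t \<Longrightarrow> g k = g' k) \<Longrightarrow> stage e m n g t = stage e m n g' t"
proof (induction t)
  case (Suc t)
  have "stage e m n g t = stage e m n g' t" by (rule Suc.IH) (use Suc.prems in simp)
  moreover have "g t = g' t" using Suc.prems by simp
  ultimately show ?case by (simp only: stage.simps)
qed simp

end

text \<open>
  A request \<open>(x, n, y)\<close> asks for a partner of \<open>x\<close>, and for one of \<open>n\<close> in case \<open>n\<close> is an element or a subset of \<open>y\<close>.
\<close>

locale request_tree = cut_pair +
  fixes e :: "nat \<Rightarrow> 'a \<times> 'a \<times> 'a" and m0 n0 :: 'a
  assumes e_in: "\<And>t. e t \<in> univ M \<times> univ N \<times> univ N"
    and e_io: "\<And>p k. p \<in> univ M \<times> univ N \<times> univ N \<Longrightarrow> \<exists>t\<ge>k. e t = p"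
    and init: "matched \<tau> [m0] [n0]"
begin

definition W :: "(nat \<Rightarrow> bool) \<Rightarrow> nat \<Rightarrow> 'a" where "W g t = fst (stage e m0 n0 g t)"
definition ms :: "(nat \<Rightarrow> bool) \<Rightarrow> nat \<Rightarrow> 'a list" where "ms g t = fst (snd (stage e m0 n0 g t))"
definition ns :: "(nat \<Rightarrow> bool) \<Rightarrow> nat \<Rightarrow> 'a list" where "ns g t = snd (snd (stage e m0 n0 g t))"

lemma stage_eq: "stage e m0 n0 g t = (W g t, ms g t, ns g t)"
  by (simp add: W_def ms_def ns_def)

definition nxt :: "(nat \<Rightarrow> bool) \<Rightarrow> nat \<Rightarrow> 'a list \<times> 'a list \<times> 'a \<times> 'a" where
  "nxt g t = (SOME q. round_step (W g t, ms g t, ns g t) (e t) q)"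

lemma stage_matched: "matched (W g t) (ms g t) (ns g t) \<and> ms g t \<noteq> [] \<and> round_step (W g t, ms g t, ns g t) (e t) (nxt g t)"
proof -
  have R: "round_step (W g t, ms g t, ns g t) (e t) (nxt g t)" if "matched (W g t) (ms g t) (ns g t)" "ms g t \<noteq> []" for t
  proof -
    obtain x n y where p: "e t = (x, n, y)" "x \<in> univ M" "n \<in> univ N" using e_in[of t] by (cases "e t") auto
    show ?thesis unfolding nxt_def p(1) by (rule someI_ex) (rule round_step_ex[OF that p(2,3)])
  qed
  have "matched (W g t) (ms g t) (ns g t) \<and> ms g t \<noteq> []"
  proof (induction t)
    case 0
    show ?case using init by (simp add: W_def ms_def ns_def)
  next
    case (Suc t)
    obtain ms' ns' \<mu> \<nu> where q: "nxt g t = (ms', ns', \<mu>, \<nu>)" by (cases "nxt g t") auto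
    obtain x n y where p: "e t = (x, n, y)" by (cases "e t") auto
    have r: "round_step (W g t, ms g t, ns g t) (x, n, y) (ms', ns', \<mu>, \<nu>)" using R Suc q p by metis
    have "stage e m0 n0 g (Suc t) = (if g t then (W g t, ms' @ [\<mu>], ns' @ [\<nu>]) else (\<nu>, ms', ns'))"
      using q unfolding nxt_def by (simp add: stage_eq)
    then show ?case using r Suc unfolding round_step_def by (auto simp: W_def ms_def ns_def)
  qed
  then show ?thesis using R by blast
qed

lemma stage_step:
  "\<exists>ms' ns' \<mu> \<nu>. nxt g t = (ms', ns', \<mu>, \<nu>) \<and> round_step (W g t, ms g t, ns g t) (e t) (ms', ns', \<mu>, \<nu>) \<and>
     W g (Suc t) = (if g t then W g t else \<nu>) \<and> ms g (Suc t) = (if g t then ms' @ [\<mu>] else ms') \<and>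
     ns g (Suc t) = (if g t then ns' @ [\<nu>] else ns')"
proof -
  obtain ms' ns' \<mu> \<nu> where q: "nxt g t = (ms', ns', \<mu>, \<nu>)" by (cases "nxt g t") auto
  have "stage e m0 n0 g (Suc t) = (if g t then (W g t, ms' @ [\<mu>], ns' @ [\<nu>]) else (\<nu>, ms', ns'))"
    using q unfolding nxt_def by (simp add: stage_eq)
  then have "W g (Suc t) = (if g t then W g t else \<nu>) \<and> ms g (Suc t) = (if g t then ms' @ [\<mu>] else ms') \<and>
     ns g (Suc t) = (if g t then ns' @ [\<nu>] else ns')" by (simp add: W_def ms_def ns_def)
  then show ?thesis using q stage_matched[of g t] by auto
qed

lemma len: "length (ns g t) = length (ms g t)"
  using stage_matched[of g t] unfolding matched_def by simp

lemma prefix: "t \<le> t' \<Longrightarrow> \<exists>u v. ms g t' = ms g t @ u \<and> ns g t' = ns g t @ v"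
proof (induction t' rule: dec_induct)
  case base
  show ?case by simp
next
  case (step t')
  obtain x n y where p: "e t' = (x, n, y)" by (cases "e t'") auto
  obtain ms' ns' \<mu> \<nu> where q: "round_step (W g t', ms g t', ns g t') (e t') (ms', ns', \<mu>, \<nu>)"
     "ms g (Suc t') = (if g t' then ms' @ [\<mu>] else ms')" "ns g (Suc t') = (if g t' then ns' @ [\<nu>] else ns')"
    using stage_step[of g t'] by blast
  obtain u v where "ms' = ms g t' @ u" "ns' = ns g t' @ v" using q(1) unfolding p round_step_def by auto
  then show ?case using step.IH q(2,3) by auto
qed

lemma W_step: "els N (W g (Suc t)) \<subseteq> els N (W g t)"
proof -
  obtain x n y where p: "e t = (x, n, y)" by (cases "e t") auto
  obtain ms' ns' \<mu> \<nu> where q: "round_step (W g t, ms g t, ns g t) (e t) (ms', ns', \<mu>, \<nu>)"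
     "W g (Suc t) = (if g t then W g t else \<nu>)"
    using stage_step[of g t] by blast
  have "\<nu> \<in> els N (W g t)" using q(1) unfolding p round_step_def by auto
  moreover have "trans_set N (W g t)" using stage_matched[of g t] unfolding matched_def by simp
  ultimately have "els N \<nu> \<subseteq> els N (W g t)" unfolding trans_set_def by blast
  then show ?thesis using q(2) by simp
qed

lemma W_mono: "t \<le> t' \<Longrightarrow> els N (W g t') \<subseteq> els N (W g t)"
  by (induction t' rule: dec_induct) (use W_step in blast)+

definition Rel :: "(nat \<Rightarrow> bool) \<Rightarrow> 'a \<Rightarrow> 'a \<Rightarrow> bool" where
  "Rel g x y \<longleftrightarrow> (\<exists>t i. i < length (ms g t) \<and> ms g t ! i = x \<and> ns g t ! i = y)"

lemma Rel_late:
  assumes "Rel g x y"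
  shows "\<exists>t0. \<forall>t\<ge>t0. \<exists>i<length (ms g t). ms g t ! i = x \<and> ns g t ! i = y"
proof -
  obtain t0 i where i: "i < length (ms g t0)" "ms g t0 ! i = x" "ns g t0 ! i = y" using assms unfolding Rel_def by blast
  have "\<exists>i<length (ms g t). ms g t ! i = x \<and> ns g t ! i = y" if le: "t0 \<le> t" for t
  proof -
    obtain u v where "ms g t = ms g t0 @ u" "ns g t = ns g t0 @ v" using prefix[OF le] by blast
    then show ?thesis using i len[of g t0] by (intro exI[of _ i]) (simp add: nth_append)
  qed
  then show ?thesis by blast
qed

lemma Rel_U: "Rel g x y \<Longrightarrow> x \<in> univ M \<and> y \<in> univ N"
proof -
  assume "Rel g x y"
  then obtain t i where i: "i < length (ms g t)" "ms g t ! i = x" "ns g t ! i = y" unfolding Rel_def by blast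
  have "set (ms g t) \<subseteq> univ M" "set (ns g t) \<subseteq> univ N" using stage_matched[of g t] unfolding matched_def by simp_all
  then show ?thesis using i len[of g t] by (metis nth_mem subsetD)
qed

lemma Rel_mem: "Rel g x y \<Longrightarrow> Rel g x' y' \<Longrightarrow> x \<in> els M x' \<longleftrightarrow> y \<in> els N y'"
proof -
  assume "Rel g x y" "Rel g x' y'"
  then obtain t0 t1 where t: "\<forall>t\<ge>t0. \<exists>i<length (ms g t). ms g t ! i = x \<and> ns g t ! i = y"
    "\<forall>t\<ge>t1. \<exists>i<length (ms g t). ms g t ! i = x' \<and> ns g t ! i = y'" using Rel_late by meson
  define t where "t = max t0 t1"
  obtain i j where ij: "i<length (ms g t)" "ms g t ! i = x" "ns g t ! i = y" "j<length (ms g t)" "ms g t ! j = x'" "ns g t ! j = y'"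
    using t[THEN spec, of t] unfolding t_def by auto
  show ?thesis using matched_mem[OF _ ij(1,4)] stage_matched[of g t] ij by blast
qed

lemma Rel_S: "Rel g s y \<Longrightarrow> s \<in> S \<Longrightarrow> y = s"
proof -
  assume "Rel g s y" and s: "s \<in> S"
  then obtain t i where i: "i < length (ms g t)" "ms g t ! i = s" "ns g t ! i = y" unfolding Rel_def by blast
  show ?thesis using matched_S[OF _ i(1)] stage_matched[of g t] i s by metis
qed

lemma Rel_total: "x \<in> univ M \<Longrightarrow> \<exists>y\<in>els N (W g k). Rel g x y"
proof -
  assume x: "x \<in> univ M"
  obtain n where n: "n \<in> univ N" using N.U_ne by blast
  obtain t where t: "t \<ge> k" "e t = (x, n, n)" using e_io[of "(x, n, n)" k] x n by auto
  obtain ms' ns' \<mu> \<nu> where q: "round_step (W g t, ms g t, ns g t) (e t) (ms', ns', \<mu>, \<nu>)"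
     "ms g (Suc t) = (if g t then ms' @ [\<mu>] else ms')" "ns g (Suc t) = (if g t then ns' @ [\<nu>] else ns')"
    using stage_step[of g t] by blast
  have g': "matched \<nu> ms' ns'" and "\<exists>i<length ms'. ms' ! i = x \<and> ns' ! i \<in> els N (W g t)"
    using q(1) unfolding t(2) round_step_def by auto
  then obtain i where i: "i<length ms'" "ms' ! i = x" "ns' ! i \<in> els N (W g t)" by blast
  have "length ns' = length ms'" using g' unfolding matched_def by simp
  then have "i < length (ms g (Suc t)) \<and> ms g (Suc t) ! i = x \<and> ns g (Suc t) ! i = ns' ! i"
    using i q(2,3) by (auto simp: nth_append)
  then have "Rel g x (ns' ! i)" unfolding Rel_def by blast
  then show ?thesis using i(3) W_mono[OF t(1), of g] by blast
qed

lemma Rel_back: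
  assumes r: "Rel g x y" and n: "n \<in> univ N" "n \<in> els N y \<or> els N n \<subseteq> els N y"
  shows "\<exists>x'. Rel g x' n"
proof -
  have u: "x \<in> univ M" "y \<in> univ N" using Rel_U[OF r] by blast+
  obtain t0 where t0: "\<forall>t\<ge>t0. \<exists>i<length (ms g t). ms g t ! i = x \<and> ns g t ! i = y" using Rel_late[OF r] by blast
  obtain t where t: "t \<ge> t0" "e t = (x, n, y)" using e_io[of "(x, n, y)" t0] u n(1) by auto
  obtain i where i: "i<length (ms g t)" "ns g t ! i = y" using t0 t(1) by blast
  obtain ms' ns' \<mu> \<nu> where q: "round_step (W g t, ms g t, ns g t) (e t) (ms', ns', \<mu>, \<nu>)"
     "ms g (Suc t) = (if g t then ms' @ [\<mu>] else ms')" "ns g (Suc t) = (if g t then ns' @ [\<nu>] else ns')"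
    using stage_step[of g t] by blast
  have "n \<in> set ns'" using q(1) i n(2) unfolding t(2) round_step_def by auto
  then have "n \<in> set (ns g (Suc t))" using q(3) by auto
  then obtain j where "j < length (ns g (Suc t))" "ns g (Suc t) ! j = n" by (auto simp: in_set_conv_nth)
  then have "Rel g (ms g (Suc t) ! j) n" unfolding Rel_def using len[of g "Suc t"] by auto
  then show ?thesis by blast
qed

text \<open>
  Equality of two entries is not expressed by a code. If \<open>y\<close> and \<open>y'\<close> differ, an element of one that is not in the other
  has a partner by the steps back, and this partner would have to be both in \<open>x\<close> and not in \<open>x\<close>. Injectivity is
  dual.
\<close>

lemma Rel_unique:
  assumes r: "Rel g x y" "Rel g x y'"
  shows "y = y'"
proof (rule N.ext)
  have sub: "els N y \<subseteq> els N y'" if r: "Rel g x y" "Rel g x y'" for y y'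
  proof
    fix z assume z: "z \<in> els N y"
    obtain z0 where z0: "Rel g z0 z" using Rel_back[OF r(1) N.els_U[OF z]] z by blast
    then show "z \<in> els N y'" using Rel_mem[OF z0 r(1)] Rel_mem[OF z0 r(2)] z by blast
  qed
  show "els N y = els N y'" using sub[OF r] sub[OF r(2,1)] by blast
qed (use Rel_U r in blast)+

lemma Rel_inj:
  assumes r: "Rel g x y" "Rel g x' y"
  shows "x = x'"
proof (rule M.ext)
  have sub: "els M x \<subseteq> els M x'" if r: "Rel g x y" "Rel g x' y" for x x'
  proof
    fix z assume z: "z \<in> els M x"
    obtain z0 where z0: "Rel g z z0" using Rel_total[OF M.els_U[OF z]] by blast
    then show "z \<in> els M x'" using Rel_mem[OF z0 r(1)] Rel_mem[OF z0 r(2)] z by blast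
  qed
  show "els M x = els M x'" using sub[OF r] sub[OF r(2,1)] by blast
qed (use Rel_U r in blast)+

definition emb :: "(nat \<Rightarrow> bool) \<Rightarrow> 'a \<Rightarrow> 'a" where "emb g x = (THE y. Rel g x y)"

lemma emb_iff: "x \<in> univ M \<Longrightarrow> Rel g x y \<longleftrightarrow> emb g x = y"
proof -
  assume x: "x \<in> univ M"
  obtain y0 where y0: "Rel g x y0" using Rel_total[OF x] by blast
  have "emb g x = y0" unfolding emb_def by (rule the_equality) (rule y0, rule Rel_unique[OF _ y0])
  then show ?thesis using y0 Rel_unique[OF y0] by blast
qed

lemma emb_Rel: "x \<in> univ M \<Longrightarrow> Rel g x (emb g x)"
  using emb_iff by blast

lemma emb_image: "Rel g x y \<Longrightarrow> y \<in> emb g ` univ M"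
  using emb_iff[of x g y] Rel_U[of g x y] by blast

lemma emb_closed: "closed_emb M N (emb g)"
proof unfold_locales
  show "embedding M N (emb g)" unfolding embedding_def
  proof (intro conjI ballI)
    show "emb g ` univ M \<subseteq> univ N" using emb_Rel Rel_U by blast
    show "inj_on (emb g) (univ M)"
    proof (rule inj_onI)
      fix x x' assume x: "x \<in> univ M" "x' \<in> univ M" "emb g x = emb g x'"
      show "x = x'" using Rel_inj[OF emb_Rel[OF x(1)], of g x'] emb_Rel[OF x(2), of g] x(3) by simp
    qed
    fix x y assume x: "x \<in> univ M" and y: "y \<in> univ M"
    have "emb g x \<in> univ N" using Rel_U[OF emb_Rel[OF x]] by blast
    then show "mem M x y \<longleftrightarrow> mem N (emb g x) (emb g y)"
      using Rel_mem[OF emb_Rel[OF x] emb_Rel[OF y], of g] x by (simp add: els_def)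
  qed
  show "n \<in> emb g ` univ M" if "m \<in> univ M" "n \<in> els N (emb g m)" for m n
    using Rel_back[OF emb_Rel[OF that(1)] N.els_U[OF that(2)]] that(2) emb_image by blast
  show "n \<in> emb g ` univ M" if "m \<in> univ M" "n \<in> univ N" "els N n \<subseteq> els N (emb g m)" for m n
    using Rel_back[OF emb_Rel[OF that(1)] that(2)] that(3) emb_image by blast
qed

text \<open>
  Every element of \<open>M\<close> is treated again after stage \<open>k\<close>, and its partner is then taken from a later, hence
  smaller, bound.
\<close>

lemma emb_W: "emb g ` univ M \<subseteq> els N (W g k)"
proof
  fix y assume "y \<in> emb g ` univ M"
  then obtain x where x: "x \<in> univ M" "y = emb g x" by blast
  then obtain y' where "y' \<in> els N (W g k)" "Rel g x y'" using Rel_total[OF x(1)] by blast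
  then show "y \<in> els N (W g k)" using emb_iff[OF x(1)] x(2) by metis
qed

lemma emb_S: "s \<in> S \<Longrightarrow> emb g s = s"
  using Rel_S[OF emb_Rel[OF M.S_U]] by blast

lemma emb_m0: "emb g m0 = n0"
proof -
  have "Rel g m0 n0" unfolding Rel_def by (rule exI[of _ 0], rule exI[of _ 0]) (simp add: ms_def ns_def)
  then show ?thesis using emb_iff Rel_U by blast
qed

text \<open>
  At the first difference the branch \<open>g\<close> takes \<open>\<nu>\<close> as its bound, whereas \<open>g'\<close> puts \<open>\<nu>\<close> into its image, which is
  closed under elements.
\<close>

lemma emb_mono:
  assumes "less_fun g g'"
  shows "emb g ` univ M \<subset> emb g' ` univ M"
proof -
  obtain t where t: "g t < g' t" "\<And>k. k < t \<Longrightarrow> g k = g' k" using assms unfolding less_fun_def by blast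
  have gt: "\<not> g t" "g' t" using t(1) by auto
  have s: "stage e m0 n0 g t = stage e m0 n0 g' t" by (rule stage_agree[OF t(2)])
  then have eq: "W g t = W g' t" "ms g t = ms g' t" "ns g t = ns g' t" by (simp_all add: W_def ms_def ns_def)
  then have nx: "nxt g t = nxt g' t" unfolding nxt_def by simp
  obtain ms' ns' \<mu> \<nu> where q: "nxt g t = (ms', ns', \<mu>, \<nu>)" "W g (Suc t) = \<nu>"
    using stage_step[of g t] gt by auto
  obtain ms2 ns2 \<mu>2 \<nu>2 where q2: "nxt g' t = (ms2, ns2, \<mu>2, \<nu>2)" "round_step (W g' t, ms g' t, ns g' t) (e t) (ms2, ns2, \<mu>2, \<nu>2)"
     "ms g' (Suc t) = ms2 @ [\<mu>2]" "ns g' (Suc t) = ns2 @ [\<nu>2]"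
    using stage_step[of g' t] gt by auto
  have v: "\<nu>2 = \<nu>" using q(1) q2(1) nx by simp
  obtain x n y where p: "e t = (x, n, y)" by (cases "e t") auto
  have "length ns2 = length ms2" using q2(2) unfolding p round_step_def matched_def by auto
  then have "Rel g' \<mu>2 \<nu>" unfolding Rel_def v[symmetric]
    by (intro exI[of _ "Suc t"] exI[of _ "length ms2"]) (simp add: q2(3,4) nth_append)
  then have vin: "\<nu> \<in> emb g' ` univ M" by (rule emb_image)
  interpret g': closed_emb M N "emb g'" by (rule emb_closed)
  have "els N \<nu> \<subseteq> emb g' ` univ M" using vin g'.tr by blast
  moreover have "emb g ` univ M \<subseteq> els N \<nu>" using emb_W[of g "Suc t"] q(2) by simp
  moreover have "\<nu> \<in> univ N" using vin g'.i_U by blast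
  ultimately show ?thesis using vin N.irrefl[of \<nu>] by blast
qed

end

section \<open>The equivalences\<close>

text \<open>
  The renaming sends all other variables to \<open>0\<close>.
\<close>

lemma definable_trim:
  assumes definable: "definable P" and dep: "\<And>M \<rho> \<rho>'. \<rho> 0 = \<rho>' 0 \<Longrightarrow> \<rho> 1 = \<rho>' 1 \<Longrightarrow> \<rho> 2 = \<rho>' 2 \<Longrightarrow> P M \<rho> = P M \<rho>'"
  shows "\<exists>\<delta>\<in>Delta0P. fv \<delta> \<subseteq> {0, 1, 2} \<and> (\<forall>M \<rho>. sat M \<rho> \<delta> \<longleftrightarrow> P M \<rho>)"
proof -
  obtain \<phi> where \<phi>: "\<phi>\<in>Delta0P" "\<forall>M \<rho>. sat M \<rho> \<phi> \<longleftrightarrow> P M \<rho>" using definable unfolding definable_def by blast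
  define f :: "nat \<Rightarrow> nat" where "f n = (if n < 3 then n else 0)" for n
  obtain \<psi> where \<psi>: "\<psi>\<in>Delta0P" "fv \<psi> \<subseteq> f ` fv \<phi>" "\<forall>(M::'a str) \<rho>. sat M \<rho> \<psi> \<longleftrightarrow> sat M (\<lambda>n. \<rho> (f n)) \<phi>"
    using Delta0P_rename[OF \<phi>(1)] by metis
  have "f ` fv \<phi> \<subseteq> {0, 1, 2}" unfolding f_def by auto
  then have "fv \<psi> \<subseteq> {0, 1, 2}" using \<psi>(2) by (rule subset_trans[rotated])
  moreover have "sat M \<rho> \<psi> \<longleftrightarrow> P M \<rho>" for M \<rho>
    unfolding \<psi>(3)[rule_format] \<phi>(2)[rule_format] by (rule dep) (simp_all add: f_def)
  ultimately show ?thesis using \<psi>(1) by blast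
qed

text \<open>
  Describes the assignment of the sequence \<open>[m]\<close>, so that truth of a code at \<open>[m]\<close> becomes a formula in \<open>m\<close>.
\<close>

definition single_asg :: "'a str \<Rightarrow> 'a \<Rightarrow> 'a \<Rightarrow> bool" where
  "single_asg M a m \<longleftrightarrow> (\<exists>p\<in>els M a. els M a = {p} \<and> (\<exists>c x. opr M c x p \<and> is_num 0 M c \<and> x = m))"

lemma definable_single_asg: "definable (\<lambda>M \<rho>. single_asg M (\<rho> i) (\<rho> j))"
  unfolding single_asg_def by (intro definable_intros definable_is_num)

lemma (in kpp) single_asg_iff:
  assumes a: "a \<in> U" and m: "m \<in> U"
  shows "single_asg M a m \<longleftrightarrow> a = asg [m]"
proof -
  have nU: "nm 0 \<in> U" "is_num 0 M (nm 0)" using nm by blast+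
  have e: "asg [m] \<in> U" "els M (asg [m]) = {pr (nm 0) m}" using asg[of "[m]"] m by auto
  have p: "pr (nm 0) m \<in> U" "opr M (nm 0) m (pr (nm 0) m)" using pr[OF nU(1) m] by blast+
  show ?thesis
  proof
    assume "single_asg M a m"
    then obtain p c where c: "p \<in> els M a" "els M a = {p}" "opr M c m p" "is_num 0 M c" unfolding single_asg_def by blast
    have "c = nm 0" using is_num_unique[OF _ nU(1) c(4) nU(2)] opr_U[OF c(3)] by blast
    then have "p = pr (nm 0) m" using opr_pr[OF els_U[OF c(1)]] c(3) by blast
    then show "a = asg [m]" using ext[OF a e(1)] c(2) e(2) by simp
  next
    assume "a = asg [m]"
    then have "els M a = {pr (nm 0) m}" using e(2) by simp
    then show "single_asg M a m" unfolding single_asg_def using p(2) nU(2) by auto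
  qed
qed

lemma cut_pairI:
  assumes "models M (KPP \<union> Separation (SigmaP 1))" "models N KPP"
    and "rank_initial_substructure S M" "topless_substructure S M"
    and "rank_initial_substructure S N" "topless_substructure S N"
    and "SSy S M = SSy S N" and "\<tau> \<in> univ N"
  shows "cut_pair M N (univ S) \<tau>"
proof -
  have M: "models M KPP" and sig: "models M (Separation (SigmaP 1))"
    using assms(1) unfolding models_def by blast+
  interpret M: kpp_cut M "univ S" by (rule kpp_cutI[OF M assms(3,4)])
  interpret N: kpp_cut N "univ S" by (rule kpp_cutI[OF assms(2,5,6)])
  show ?thesis
  proof unfold_locales
    show "els M x = els N x" if x: "x \<in> univ S" for x
    proof -
      have m: "mem M y x \<longleftrightarrow> mem N y x" if "y \<in> univ S" for y
        using assms(3,5) that x unfolding rank_initial_substructure_def substructure_def by blast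
      show ?thesis
      proof (intro set_eqI iffI)
        fix y assume y: "y \<in> els M x"
        have yS: "y \<in> univ S" by (rule M.S_els[OF x y])
        then show "y \<in> els N x" using y m[OF yS] N.S_U[OF yS] unfolding els_def by blast
      next
        fix y assume y: "y \<in> els N x"
        have yS: "y \<in> univ S" by (rule N.S_els[OF x y])
        then show "y \<in> els M x" using y m[OF yS] M.S_U[OF yS] unfolding els_def by blast
      qed
    qed
    show "models M (Separation (SigmaP 1))" by (rule sig)
    show "{{x \<in> univ S. mem M x c} |c. c \<in> univ M} = {{x \<in> univ S. mem N x c} |c. c \<in> univ N}"
      using assms(7) unfolding SSy_def by simp
    show "\<tau> \<in> univ N" by (rule assms(8))
  qed
qed

text \<open>
  A witness \<open>x\<close> in \<open>M\<close> is sent to \<open>i x\<close>, which lies in \<open>V\<^sub>\<beta>\<close> as the image is below \<open>\<beta>\<close>.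
\<close>

lemma embedding_imp_types:
  assumes M: "models M KPP" and N: "models N KPP"
    and SM: "rank_initial_substructure S M" "topless_substructure S M"
    and SN: "rank_initial_substructure S N" "topless_substructure S N"
    and m0: "m0 \<in> univ M" and \<beta>: "\<beta> \<in> Ord N"
    and i: "good_embedding M N S m0 n0 \<beta> i"
  shows "SSy S M = SSy S N \<and>
      (\<forall>s\<in>univ S. \<forall>\<delta>\<in>Delta0P. fv \<delta> \<subseteq> {0, 1, 2} \<longrightarrow>
        (\<exists>x\<in>univ M. sat M ((\<lambda>_. s)(0 := x, 1 := m0, 2 := s)) \<delta>) \<longrightarrow>
        (\<exists>v. is_V N \<beta> v \<and>
          (\<exists>x\<in>univ N. mem N x v \<and> sat N ((\<lambda>_. s)(0 := x, 1 := n0, 2 := s)) \<delta>)))"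
proof -
  interpret M: kpp_cut M "univ S" by (rule kpp_cutI[OF M SM])
  interpret N: kpp_cut N "univ S" by (rule kpp_cutI[OF N SN])
  have ri: "rank_initial M N i" and iS: "\<And>s. s \<in> univ S \<Longrightarrow> i s = s" and im: "i m0 = n0" and ib: "i ` univ M \<subseteq> below N \<beta>"
    using i unfolding good_embedding_def by blast+
  interpret i: closed_emb M N i by (rule closed_embI[OF M N ri])
  have mem_i: "mem M x c \<longleftrightarrow> mem N x (i c)" if x: "x \<in> univ S" and c: "c \<in> univ M" for x c
    using i.i_els[OF M.S_U[OF x] c] M.S_U[OF x] N.S_U[OF x] unfolding iS[OF x] els_def by blast
  have "{{x \<in> univ S. mem M x c} |c. c \<in> univ M} = {{x \<in> univ S. mem N x c} |c. c \<in> univ N}"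
  proof (intro equalityI subsetI)
    fix X assume "X \<in> {{x \<in> univ S. mem M x c} |c. c \<in> univ M}"
    then obtain c where c: "c \<in> univ M" "X = {x \<in> univ S. mem M x c}" by blast
    have "X = {x \<in> univ S. mem N x (i c)}" unfolding c(2) using mem_i[OF _ c(1)] by blast
    then show "X \<in> {{x \<in> univ S. mem N x c} |c. c \<in> univ N}" using i.i_U[OF c(1)] by blast
  next
    fix X assume "X \<in> {{x \<in> univ S. mem N x c} |c. c \<in> univ N}"
    then obtain d where d: "d \<in> univ N" "X = {x \<in> univ S. mem N x d}" by blast
    obtain v where v: "v \<in> univ M" "univ S \<subseteq> els M v" using M.S_cover by (rule bexE)
    obtain y where y: "y \<in> univ N" "els N y = {u \<in> els N d. u \<in> els N (i v)}"
      by (rule bexE[OF N.sep[where Q="\<lambda>M u a b c d e f. u \<in> els M a", OF _ d(1) i.i_U[OF v(1)] d(1) d(1) d(1) d(1) d(1)]]) (intro definable_intros, rule that)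
    then obtain c where c: "c \<in> univ M" "y = i c" using i.sub[OF v(1) y(1)] by blast
    have "mem N x d \<longleftrightarrow> mem M x c" if x: "x \<in> univ S" for x
    proof -
      have "x \<in> els N (i v)" using i.i_els[OF M.S_U[OF x] v(1)] v(2) x iS[OF x] by auto
      then have "x \<in> els N y \<longleftrightarrow> x \<in> els N d" unfolding y(2) by blast
      then show ?thesis unfolding mem_i[OF x c(1)] c(2)[symmetric] els_def using N.S_U[OF x] by blast
    qed
    then have "X = {x \<in> univ S. mem M x c}" unfolding d(2) by blast
    then show "X \<in> {{x \<in> univ S. mem M x c} |c. c \<in> univ M}" using c(1) by blast
  qed
  then have "SSy S M = SSy S N" unfolding SSy_def by simp
  moreover have "\<exists>v. is_V N \<beta> v \<and>
          (\<exists>x\<in>univ N. mem N x v \<and> sat N ((\<lambda>_. s)(0 := x, 1 := n0, 2 := s)) \<delta>)"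
    if s: "s \<in> univ S" and \<delta>: "\<delta> \<in> Delta0P" and x: "x \<in> univ M" "sat M ((\<lambda>_. s)(0 := x, 1 := m0, 2 := s)) \<delta>" for s \<delta> x
  proof -
    from N.V_ex[OF \<beta>] obtain v where v: "v \<in> univ N" "els N v = {x\<in>univ N. N.rk x \<in> els N \<beta>}" by (rule bexE)
    have "is_V N \<beta> v" using v N.is_V_iff by blast
    moreover have ix: "i x \<in> els N v" using ib x(1) N.below_iff unfolding v(2) by blast
    have env: "range ((\<lambda>_. s)(0 := x, 1 := m0, 2 := s)) \<subseteq> univ M" using M.S_U[OF s] x(1) m0 by auto
    have eq: "(\<lambda>n. i (((\<lambda>_. s)(0 := x, 1 := m0, 2 := s)) n)) = (\<lambda>_. s)(0 := i x, 1 := n0, 2 := s)"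
      using iS[OF s] im by (auto simp: fun_eq_iff)
    have "sat N ((\<lambda>_. s)(0 := i x, 1 := n0, 2 := s)) \<delta>"
      using i.sat_abs[OF \<delta> env] x(2) unfolding eq by blast
    moreover have "mem N (i x) v" "i x \<in> univ N" using ix unfolding els_def by blast+
    ultimately show ?thesis by blast
  qed
  ultimately show ?thesis by blast
qed

text \<open>
  The construction starts with \<open>[m0]\<close>, \<open>[n0]\<close> and \<open>V\<^sub>\<beta>\<close> as both the first bound and the reservoir \<open>\<tau>\<close>. The hypothesis on
  types, for the formula saying that \<open>x\<close> contains a sound set, a bound and the assignment of \<open>[m0]\<close>, is the
  initial invariant; bound and sound set are elements of \<open>V\<^sub>\<beta>\<close> because \<open>V\<^sub>\<beta>\<close> is transitive.
\<close>

lemma types_imp_tree: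
  assumes M: "models M (KPP \<union> Separation (SigmaP 1))" and N: "models N KPP"
    and cM: "countable (univ M)" and cN: "countable (univ N)"
    and SM: "rank_initial_substructure S M" "topless_substructure S M"
    and SN: "rank_initial_substructure S N" "topless_substructure S N"
    and m0: "m0 \<in> univ M" and n0: "n0 \<in> univ N" and \<beta>: "\<beta> \<in> Ord N"
    and ssy: "SSy S M = SSy S N"
    and types: "\<And>s \<delta> x. s \<in> univ S \<Longrightarrow> \<delta> \<in> Delta0P \<Longrightarrow> fv \<delta> \<subseteq> {0, 1, 2} \<Longrightarrow>
        x \<in> univ M \<Longrightarrow> sat M ((\<lambda>_. s)(0 := x, 1 := m0, 2 := s)) \<delta> \<Longrightarrow>
        \<exists>v. is_V N \<beta> v \<and>
          (\<exists>x\<in>univ N. mem N x v \<and> sat N ((\<lambda>_. s)(0 := x, 1 := n0, 2 := s)) \<delta>)"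
  shows "\<exists>I :: (nat \<Rightarrow> bool) \<Rightarrow> 'a \<Rightarrow> 'a. (\<forall>g. good_embedding M N S m0 n0 \<beta> (I g)) \<and>
      (\<forall>g g'. less_fun g g' \<longrightarrow> rank_less M N (I g) (I g'))"
proof -
  have MK: "models M KPP" using M unfolding models_def by blast
  interpret N: kpp N by unfold_locales fact
  from N.V_ex[OF \<beta>] obtain \<tau> where tau: "\<tau> \<in> univ N" "els N \<tau> = {x\<in>univ N. N.rk x \<in> els N \<beta>}" by (rule bexE)
  interpret cut_pair M N "univ S" \<tau> by (rule cut_pairI[OF M N SM SN ssy tau(1)])
  have tr: "trans_set N \<tau>" unfolding trans_set_def
  proof (intro ballI subsetI)
    fix x y assume x: "x \<in> els N \<tau>" and y: "y \<in> els N x"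
    have "N.rk y \<in> els N (N.rk x)" by (rule N.rk_mono[OF N.els_U[OF x] y])
    moreover have "N.rk x \<in> els N \<beta>" using x unfolding tau(2) by blast
    ultimately show "y \<in> els N \<tau>" unfolding tau(2) using N.Ord_trans[OF \<beta>] N.els_U[OF y] by blast
  qed
  let ?P = "\<lambda>M \<rho>. \<exists>T\<in>els M (\<rho> 0). \<exists>w\<in>els M (\<rho> 0). \<exists>a\<in>els M (\<rho> 0).
     single_asg M a (\<rho> 1) \<and> sound M T \<and> accepts M T (\<rho> 2) a w"
  have "definable ?P" by (intro definable_intros definable_single_asg definable_sound definable_accepts)
  then have "\<exists>\<delta>\<in>Delta0P. fv \<delta> \<subseteq> {0, 1, 2} \<and> (\<forall>(M::'a str) \<rho>. sat M \<rho> \<delta> \<longleftrightarrow> ?P M \<rho>)"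
    by (rule definable_trim) (simp only:)
  then obtain \<delta> where \<delta>: "\<delta> \<in> Delta0P" "fv \<delta> \<subseteq> {0, 1, 2}" and sat_\<delta>: "\<forall>(M::'a str) \<rho>. sat M \<rho> \<delta> \<longleftrightarrow> ?P M \<rho>"
    by (elim bexE conjE)
  have "TrueN e [n0] \<tau>" if e: "e \<in> univ S" "TrueM e [m0]" for e
  proof -
    obtain T w where T: "T\<in>univ M" "w\<in>univ M" "sound M T" "accepts M T e (M.asg [m0]) w" using e(2) unfolding TrueM_def by blast
    have a: "M.asg [m0] \<in> univ M" using M.asg[of "[m0]"] m0 by simp
    from M.upair_ex[OF T(1,2)] obtain x0 where x0: "x0 \<in> univ M" "els M x0 = {T, w}" by (rule bexE)
    from M.insert_ex[OF a x0(1)] obtain x where x: "x \<in> univ M" "els M x = insert (M.asg [m0]) (els M x0)" by (rule bexE)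
    have in_x: "T \<in> els M x" "w \<in> els M x" "M.asg [m0] \<in> els M x" unfolding x(2) x0(2) by blast+
    have sg: "single_asg M (M.asg [m0]) m0" using M.single_asg_iff[OF a m0] by blast
    have "\<exists>T\<in>els M x. \<exists>w\<in>els M x. \<exists>a\<in>els M x. single_asg M a m0 \<and> sound M T \<and> accepts M T e a w"
      by (rule bexI[OF _ in_x(1)], rule bexI[OF _ in_x(2)], rule bexI[OF _ in_x(3)]) (simp add: sg T(3,4))
    then have "sat M ((\<lambda>_. e)(0 := x, 1 := m0, 2 := e)) \<delta>"
      using sat_\<delta> by simp
    from types[OF e(1) \<delta>(1,2) x(1) this] obtain v z where v: "is_V N \<beta> v" "z \<in> univ N" "mem N z v"
      "sat N ((\<lambda>_. e)(0 := z, 1 := n0, 2 := e)) \<delta>" by blast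
    have z\<tau>: "z \<in> els N \<tau>" 
    proof -
      have "els N v = els N \<tau>" using v(1) unfolding N.is_V_iff tau(2) by blast
      moreover have "z \<in> els N v" using v(2,3) unfolding els_def by blast
      ultimately show ?thesis by simp
    qed
    from v(4) obtain T' w' a' where T': "T' \<in> els N z" "w' \<in> els N z" "a' \<in> els N z"
      "single_asg N a' n0" "sound N T'" "accepts N T' e a' w'" unfolding sat_\<delta>[rule_format] by auto
    have "a' = N.asg [n0]" using N.single_asg_iff[OF N.els_U[OF T'(3)] n0] T'(4) by blast
    moreover have "T' \<in> els N \<tau>" "w' \<in> els N \<tau>" using T'(1,2) z\<tau> tr unfolding trans_set_def by blast+
    moreover have "els N w' \<subseteq> els N \<tau>" using calculation(3) tr unfolding trans_set_def by blast
    ultimately show ?thesis unfolding TrueN_def using T'(5) accepts_mono[OF T'(6) subset_refl] by blast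
  qed
  then have init: "matched \<tau> [m0] [n0]" unfolding matched_def using m0 n0 tau(1) tr by simp
  have "countable (univ M \<times> univ N \<times> univ N)" using cM cN by (intro countable_SIGMA)
  moreover have "univ M \<times> univ N \<times> univ N \<noteq> {}" using m0 n0 by blast
  ultimately have "\<exists>e :: nat \<Rightarrow> _. (\<forall>t. e t \<in> univ M \<times> univ N \<times> univ N) \<and> (\<forall>p\<in>univ M \<times> univ N \<times> univ N. \<forall>k. \<exists>t\<ge>k. e t = p)"
    by (rule enumerate_infinitely_often)
  then obtain e :: "nat \<Rightarrow> 'a \<times> 'a \<times> 'a" where e: "\<And>t. e t \<in> univ M \<times> univ N \<times> univ N"
    "\<And>p k. p \<in> univ M \<times> univ N \<times> univ N \<Longrightarrow> \<exists>t\<ge>k. e t = p" by metis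
  interpret request_tree M N "univ S" \<tau> e m0 n0 by unfold_locales (fact e init)+
  have "good_embedding M N S m0 n0 \<beta> (emb g)" for g
  proof -
    interpret c: closed_emb M N "emb g" by (rule emb_closed)
    have "emb g ` univ M \<subseteq> els N \<tau>" using emb_W[of g 0] by (simp add: W_def)
    then have "emb g ` univ M \<subseteq> below N \<beta>" unfolding tau(2) using N.below_iff by blast
    then show ?thesis unfolding good_embedding_def using c.rank_initial emb_S emb_m0 by blast
  qed
  moreover have "rank_less M N (emb g) (emb g')" if "less_fun g g'" for g g'
    by (rule rank_lessI[OF MK N emb_closed emb_closed emb_mono[OF that]])
  ultimately show ?thesis by blast
qed

lemma uncountable_binary_sequences: "\<not> countable (UNIV :: (nat \<Rightarrow> bool) set)"
proof
  assume "countable (UNIV :: (nat \<Rightarrow> bool) set)"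
  then have "range (from_nat_into (UNIV :: (nat \<Rightarrow> bool) set)) = UNIV" by (rule range_from_nat_into[OF UNIV_not_empty])
  then obtain n where "from_nat_into UNIV n = (\<lambda>k. \<not> from_nat_into (UNIV :: (nat \<Rightarrow> bool) set) k k)" by (metis UNIV_I imageE)
  then show False by metis
qed

lemma less_fun_linear_binary: "g \<noteq> g' \<Longrightarrow> less_fun g g' \<or> less_fun g' (g :: nat \<Rightarrow> bool)"
proof -
  assume "g \<noteq> g'"
  then have ex: "\<exists>k. g k \<noteq> g' k" by auto
  define k where "k = (LEAST k. g k \<noteq> g' k)"
  have k: "g k \<noteq> g' k" unfolding k_def by (rule LeastI_ex[OF ex])
  have below: "g j = g' j" if "j < k" for j using not_less_Least[of j "\<lambda>k. g k \<noteq> g' k"] that unfolding k_def by blast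
  show ?thesis
  proof (cases "g k")
    case True
    then have "less_fun g' g" unfolding less_fun_def using k below by (intro exI[of _ k]) auto
    then show ?thesis ..
  next
    case False
    then have "less_fun g g'" unfolding less_fun_def using k below by (intro exI[of _ k]) auto
    then show ?thesis ..
  qed
qed

text \<open>
  If \<open>c g\<close> is the least ordinal missed by the image of \<open>g\<close> and \<open>g\<close> is below \<open>g'\<close>, then \<open>c g\<close> is at most the rank of
  some element of the larger image outside the smaller one; so the larger image contains \<open>c g\<close>, but not \<open>c g'\<close>.
\<close>

lemma tree_imp_topless:
  assumes M: "models M KPP" and N: "models N KPP" and cN: "countable (univ N)" and \<beta>: "\<beta> \<in> Ord N"
    and I: "\<And>g. good_embedding M N S m0 n0 \<beta> (I g)"
    and less: "\<And>g g' :: nat \<Rightarrow> bool. less_fun g g' \<Longrightarrow> rank_less M N (I g) (I g')"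
  shows "\<exists>g. topless M N (I g)"
proof (rule ccontr)
  assume no: "\<nexists>g. topless M N (I g)"
  interpret N: kpp N by unfold_locales fact
  have cl: "closed_emb M N (I g)" for g
    by (rule closed_embI[OF M N]) (use I[of g] in \<open>simp add: good_embedding_def\<close>)
  have "\<exists>\<alpha>\<in>Ord N - I g ` univ M. \<forall>\<gamma>\<in>Ord N - I g ` univ M. \<alpha> = \<gamma> \<or> mem N \<alpha> \<gamma>" for g
  proof -
    have "embedding M N (I g)" using closed_emb.emb[OF cl] .
    moreover have "\<exists>\<alpha>\<in>Ord N. I g ` univ M \<subseteq> below N \<alpha>" using I[of g] \<beta> unfolding good_embedding_def by blast
    ultimately show ?thesis using no unfolding topless_def by blast
  qed
  then have "\<forall>g. \<exists>\<alpha>. \<alpha> \<in> Ord N - I g ` univ M \<and> (\<forall>\<gamma>\<in>Ord N - I g ` univ M. \<alpha> = \<gamma> \<or> mem N \<alpha> \<gamma>)" by blast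
  then obtain c where c: "\<And>g. c g \<in> Ord N - I g ` univ M" "\<And>g \<gamma>. \<gamma> \<in> Ord N - I g ` univ M \<Longrightarrow> c g = \<gamma> \<or> mem N (c g) \<gamma>"
    by metis
  have key: "c g \<noteq> c g'" if l: "less_fun g g'" for g g'
  proof -
    interpret i: closed_emb M N "I g" by (rule cl)
    interpret j: closed_emb M N "I g'" by (rule cl)
    have "I g ` univ M \<subset> I g' ` univ M"
      using less[OF l] unfolding rank_less_def rank_initial_substructure_def substructure_def image_str_def by auto
    then obtain m where m: "m \<in> univ M" "I g' m \<notin> I g ` univ M" by blast
    define n where "n = I g' m"
    have nU: "n \<in> univ N" unfolding n_def by (rule j.i_U[OF m(1)])
    have r: "N.rk n = I g' (i.M.rk m)" unfolding n_def using j.i_rk[OF m(1)] by simp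
    have rU: "i.M.rk m \<in> univ M" by (rule i.M.rk_U[OF m(1)])
    have "N.rk n \<notin> I g ` univ M"
    proof
      assume "N.rk n \<in> I g ` univ M"
      then obtain k where k: "k \<in> univ M" "N.rk n = I g k" by blast
      have "N.rk (I g k) = N.rk n" using N.rk_of_Ord[OF N.rk_Ord[OF nU]] unfolding k(2) .
      then show False using i.covers[OF nU k(1)] m(2) unfolding n_def by simp
    qed
    then have "c g = N.rk n \<or> mem N (c g) (N.rk n)" using c(2) N.rk_Ord[OF nU] by blast
    moreover have "c g \<in> univ N" using c(1)[of g] N.Ord_U by blast
    ultimately have "c g = N.rk n \<or> c g \<in> els N (N.rk n)" unfolding els_def by blast
    then have "c g \<in> I g' ` univ M" using j.tr[OF rU] rU unfolding r by blast
    then show ?thesis using c(1)[of g'] by auto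
  qed
  have "inj c"
  proof (rule injI)
    fix g g' assume "c g = c g'"
    then show "g = g'" using less_fun_linear_binary[of g g'] key[of g g'] key[of g' g] by auto
  qed
  moreover have "range c \<subseteq> univ N" using c(1) N.Ord_U by blast
  ultimately have "countable (UNIV :: (nat \<Rightarrow> bool) set)"
    using countable_subset[OF _ cN] countable_image_inj_on[of c UNIV] by blast
  then show False using uncountable_binary_sequences by blast
qed

theorem theorem5p2p2:
  fixes M N S :: "'a str" and m\<^sub>0 n\<^sub>0 \<beta> :: 'a
  assumes "models M (KPP \<union> Separation (SigmaP 1))" and "models N KPP"
    and "countable (univ M)" and "countable (univ N)"
    and "nonstandard M" and "nonstandard N"
    and "rank_initial_substructure S M" and "topless_substructure S M"
    and "rank_initial_substructure S N" and "topless_substructure S N"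
    and "m\<^sub>0 \<in> univ M" and "n\<^sub>0 \<in> univ N" and "\<beta> \<in> Ord N"
  defines "A \<equiv> \<exists>i. good_embedding M N S m\<^sub>0 n\<^sub>0 \<beta> i"
    and "B \<equiv> SSy S M = SSy S N \<and>
      (\<forall>s\<in>univ S. \<forall>\<delta>\<in>Delta0P. fv \<delta> \<subseteq> {0, 1, 2} \<longrightarrow>
        (\<exists>x\<in>univ M. sat M ((\<lambda>_. s)(0 := x, 1 := m\<^sub>0, 2 := s)) \<delta>) \<longrightarrow>
        (\<exists>v. is_V N \<beta> v \<and>
          (\<exists>x\<in>univ N. mem N x v \<and> sat N ((\<lambda>_. s)(0 := x, 1 := n\<^sub>0, 2 := s)) \<delta>)))"
    and "C \<equiv> \<exists>I :: (nat \<Rightarrow> bool) \<Rightarrow> 'a \<Rightarrow> 'a.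
      (\<forall>g. good_embedding M N S m\<^sub>0 n\<^sub>0 \<beta> (I g)) \<and>
      (\<forall>g g'. less_fun g g' \<longrightarrow> rank_less M N (I g) (I g'))"
    and "D \<equiv> \<exists>i. topless M N i \<and> good_embedding M N S m\<^sub>0 n\<^sub>0 \<beta> i"
  shows "(A \<longleftrightarrow> B) \<and> (B \<longleftrightarrow> C) \<and> (C \<longleftrightarrow> D)"
proof -
  have MK: "models M KPP" using assms(1) unfolding models_def by blast
  have AB: B if A
  proof -
    obtain i where i: "good_embedding M N S m\<^sub>0 n\<^sub>0 \<beta> i" using \<open>A\<close> unfolding A_def by blast
    show ?thesis unfolding B_def
      by (rule embedding_imp_types[OF MK assms(2) assms(7-10) assms(11,13) i])
  qed
  have BC: C if B
  proof -
    have ssy: "SSy S M = SSy S N" using \<open>B\<close> unfolding B_def by (rule conjunct1)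
    show ?thesis unfolding C_def
    proof (rule types_imp_tree[OF assms(1-4) assms(7-13) ssy])
      fix s \<delta> x assume "s \<in> univ S" "\<delta> \<in> Delta0P" "fv \<delta> \<subseteq> {0, 1, 2}"
        "x \<in> univ M" "sat M ((\<lambda>_. s)(0 := x, 1 := m\<^sub>0, 2 := s)) \<delta>"
      then show "\<exists>v. is_V N \<beta> v \<and> (\<exists>x\<in>univ N. mem N x v \<and> sat N ((\<lambda>_. s)(0 := x, 1 := n\<^sub>0, 2 := s)) \<delta>)"
        using \<open>B\<close> unfolding B_def by blast
    qed
  qed
  have CD: D if C
  proof -
    obtain I :: "(nat \<Rightarrow> bool) \<Rightarrow> 'a \<Rightarrow> 'a" where I: "\<And>g. good_embedding M N S m\<^sub>0 n\<^sub>0 \<beta> (I g)"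
      "\<And>g g'. less_fun g g' \<Longrightarrow> rank_less M N (I g) (I g')" using \<open>C\<close> unfolding C_def by blast
    from tree_imp_topless[OF MK assms(2,4,13) I] obtain g where "topless M N (I g)" ..
    then show ?thesis unfolding D_def using I(1) by blast
  qed
  have DA: A if D using that unfolding A_def D_def by blast
  show ?thesis using AB BC CD DA by blast
qed

end
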